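(* Let $d\ge 1$ and let $P\in\mathbb{C}[z_1,\dots,z_d]$ with $P\neq 0$. Then the Euler operator $P(\theta)$ is surjective on $\mathscr{D}'_F(\mathbb{R}^d)$. Moreover, for every $p\in[1,+\infty]$, $P(\theta)$ is surjective on $\mathscr{D}'_F(\Omega)$, where $\Omega=\{x\in\mathbb{R}^d: \|x\|_p<1\}$ is the open unit ball of $\ell_p^d$; in particular this holds for the open Euclidean unit ball of $\mathbb{R}^d$.
   Context: Put $\theta_j=x_j\,\partial/\partial x_j$ for $j=1,\dots,d$ and $\theta^\alpha=\theta_1^{\alpha_1}\cdots\theta_d^{\alpha_d}$ for $\alpha\in\mathbb{N}_0^d$. For a polynomial $P(z)=\sum_\alpha c_\alpha z^\alpha$ with complex coefficients, the Euler operator is $P(\theta)=\sum_\alpha c_\alpha\theta^\alpha$, acting on distributions. For open $\Omega\subset\mathbb{R}^d$, $\mathscr{D}'_F(\Omega)$ is the space of distributions of finite order on $\Omega$. Here $\ell_p^d$ is $\mathbb{R}^d$ with the norm $\|x\|_p=(\sum_{j=1}^d|x_j|^p)^{1/p}$ for $1\le p<\infty$ and $\|x\|_\infty=\max_j|x_j|$. Surjectivity on $\mathscr{D}'_F(\Omega)$ means that for every $T\in\mathscr{D}'_F(\Omega)$ there is $S\in\mathscr{D}'_F(\Omega)$ with $P(\theta)S=T$ on $\Omega$. *)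

theory Defs
  imports "HOL-Analysis.Analysis" "HOL-Library.Poly_Mapping"
begin

(* The index type 'n :: {finite, linorder} plays the role of {1 < ... < d}, with d = CARD('n);
   the numeral types 1, 2, 3, ... provide an instance for every d >= 1. *)

definition partial :: "'n::finite \<Rightarrow> (real ^ 'n \<Rightarrow> complex) \<Rightarrow> real ^ 'n \<Rightarrow> complex" where
  "partial j \<phi> = (\<lambda>x. frechet_derivative \<phi> (at x) (axis j 1))"

definition partials :: "'n::finite list \<Rightarrow> (real ^ 'n \<Rightarrow> complex) \<Rightarrow> real ^ 'n \<Rightarrow> complex" where
  "partials js \<phi> = foldr partial js \<phi>"

(* Differentiability of the partial derivatives of every order gives their continuity as well,
   so this is the usual class of infinitely differentiable functions. *)
definition smooth :: "(real ^ 'n::finite \<Rightarrow> complex) \<Rightarrow> bool" where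
  "smooth \<phi> \<longleftrightarrow> (\<forall>js. partials js \<phi> differentiable_on UNIV)"

definition test_functions :: "(real ^ 'n::finite) set \<Rightarrow> (real ^ 'n \<Rightarrow> complex) set" where
  "test_functions \<Omega> =
    {\<phi>. smooth \<phi> \<and> compact (closure (support_on UNIV \<phi>)) \<and> closure (support_on UNIV \<phi>) \<subseteq> \<Omega>}"

(* Sum of the sup norms of all partial derivatives of order at most N. Lists of indices count
   mixed derivatives several times, which only changes the seminorm by a bounded factor. *)
definition test_seminorm :: "nat \<Rightarrow> (real ^ 'n::finite \<Rightarrow> complex) \<Rightarrow> real" where
  "test_seminorm N \<phi> = (\<Sum>js | length js \<le> N. SUP x. norm (partials js \<phi> x))"

(* A distribution on \<Omega> is a functional of which only the values on test_functions \<Omega> matter;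
   two such functionals are the same distribution iff they agree there. *)

definition linear_on_test ::
    "(real ^ 'n::finite) set \<Rightarrow> ((real ^ 'n \<Rightarrow> complex) \<Rightarrow> complex) \<Rightarrow> bool" where
  "linear_on_test \<Omega> T \<longleftrightarrow>
    (\<forall>\<phi>\<in>test_functions \<Omega>. \<forall>\<psi>\<in>test_functions \<Omega>. T (\<lambda>x. \<phi> x + \<psi> x) = T \<phi> + T \<psi>) \<and>
    (\<forall>c. \<forall>\<phi>\<in>test_functions \<Omega>. T (\<lambda>x. c * \<phi> x) = c * T \<phi>)"

definition bounded_with_order ::
    "nat \<Rightarrow> (real ^ 'n::finite) set \<Rightarrow> (real ^ 'n) set \<Rightarrow> ((real ^ 'n \<Rightarrow> complex) \<Rightarrow> complex) \<Rightarrow> bool" where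
  "bounded_with_order N \<Omega> K T \<longleftrightarrow>
    (\<exists>C. \<forall>\<phi>\<in>test_functions \<Omega>. closure (support_on UNIV \<phi>) \<subseteq> K \<longrightarrow>
           norm (T \<phi>) \<le> C * test_seminorm N \<phi>)"

definition distributions ::
    "(real ^ 'n::finite) set \<Rightarrow> ((real ^ 'n \<Rightarrow> complex) \<Rightarrow> complex) set" where
  "distributions \<Omega> =
    {T. linear_on_test \<Omega> T \<and>
        (\<forall>K. compact K \<and> K \<subseteq> \<Omega> \<longrightarrow> (\<exists>N. bounded_with_order N \<Omega> K T))}"

definition finite_order_distributions ::
    "(real ^ 'n::finite) set \<Rightarrow> ((real ^ 'n \<Rightarrow> complex) \<Rightarrow> complex) set" where
  "finite_order_distributions \<Omega> =
    {T \<in> distributions \<Omega>. \<exists>N. \<forall>K. compact K \<and> K \<subseteq> \<Omega> \<longrightarrow> bounded_with_order N \<Omega> K T}"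

definition distr_partial ::
    "'n::finite \<Rightarrow> ((real ^ 'n \<Rightarrow> complex) \<Rightarrow> complex) \<Rightarrow> (real ^ 'n \<Rightarrow> complex) \<Rightarrow> complex" where
  "distr_partial j T = (\<lambda>\<phi>. - T (partial j \<phi>))"

definition distr_mult ::
    "(real ^ 'n::finite \<Rightarrow> complex) \<Rightarrow> ((real ^ 'n \<Rightarrow> complex) \<Rightarrow> complex) \<Rightarrow> (real ^ 'n \<Rightarrow> complex) \<Rightarrow> complex" where
  "distr_mult f T = (\<lambda>\<phi>. T (\<lambda>x. f x * \<phi> x))"

(* The monoid algebra of ('n \<Rightarrow>\<^sub>0 nat, +) over the complex numbers: a polynomial is the
   finitely supported family of its coefficients, indexed by multi-indices. *)
type_synonym 'n cpoly = "('n \<Rightarrow>\<^sub>0 nat) \<Rightarrow>\<^sub>0 complex"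

definition theta ::
    "'n::finite \<Rightarrow> ((real ^ 'n \<Rightarrow> complex) \<Rightarrow> complex) \<Rightarrow> (real ^ 'n \<Rightarrow> complex) \<Rightarrow> complex" where
  "theta j T = distr_mult (\<lambda>x. complex_of_real (x $ j)) (distr_partial j T)"

definition theta_pow ::
    "('n::{finite,linorder} \<Rightarrow>\<^sub>0 nat) \<Rightarrow> (((real, 'n) vec \<Rightarrow> complex) \<Rightarrow> complex) \<Rightarrow> ((real, 'n) vec \<Rightarrow> complex) \<Rightarrow> complex" where
  "theta_pow \<alpha> T = foldr (\<lambda>j. theta j ^^ Poly_Mapping.lookup \<alpha> j) (sorted_list_of_set UNIV) T"

definition euler_op ::
    "'n::{finite,linorder} cpoly \<Rightarrow> (((real, 'n) vec \<Rightarrow> complex) \<Rightarrow> complex) \<Rightarrow> ((real, 'n) vec \<Rightarrow> complex) \<Rightarrow> complex" where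
  "euler_op P T = (\<lambda>\<phi>. \<Sum>\<alpha>\<in>Poly_Mapping.keys P. Poly_Mapping.lookup P \<alpha> * theta_pow \<alpha> T \<phi>)"

definition euler_surjective_on ::
    "'n::{finite,linorder} cpoly \<Rightarrow> (real, 'n) vec set \<Rightarrow> bool" where
  "euler_surjective_on P \<Omega> \<longleftrightarrow>
    (\<forall>T\<in>finite_order_distributions \<Omega>. \<exists>S\<in>finite_order_distributions \<Omega>.
       \<forall>\<phi>\<in>test_functions \<Omega>. euler_op P S \<phi> = T \<phi>)"

definition lp_norm :: "ereal \<Rightarrow> real ^ 'n::finite \<Rightarrow> real" where
  "lp_norm p x =
    (if p = \<infinity> then MAX j\<in>UNIV. \<bar>x $ j\<bar>
     else (\<Sum>j\<in>UNIV. \<bar>x $ j\<bar> powr real_of_ereal p) powr (1 / real_of_ereal p))"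

end

theory Submission
  imports Defs
begin

text \<open>
  On test functions the transpose of \<open>P(\<theta>)\<close> is \<open>P(\<tau>)\<close> with \<open>\<tau>\<^sub>j \<phi> = - \<partial>\<^sub>j (x\<^sub>j \<phi>)\<close>, so by Hahn-Banach
  it suffices to bound a given functional of finite order by weighted sup norms of derivatives of
  \<open>P(\<tau>) \<phi>\<close>.

  In \<open>L\<^sup>2\<close> the operators \<open>s \<tau>\<^sub>j + a\<^sub>j\<close> with real \<open>s\<close>, \<open>a\<^sub>j\<close> commute, and \<open>s \<tau>\<^sub>j + a\<^sub>j\<close> has the adjoint
  \<open>- s \<tau>\<^sub>j + a\<^sub>j - s\<close>. Polynomials in them are therefore normal and have the same norms as their
  adjoints. Multiplication by a monomial \<open>x\<^sup>\<gamma>\<close> translates \<open>\<tau>\<close> by \<open>\<gamma>\<close>, hence with the conjugate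
  polynomial \<open>Q\<close> of \<open>P\<close> we have \<open>\<parallel>x\<^sup>\<gamma> P(\<tau>) f\<parallel> = \<parallel>x\<^sup>\<gamma> Q(2 \<gamma> - 1 - \<tau>) f\<parallel>\<close> for every multi-index \<open>\<gamma>\<close>. Along
  \<open>\<gamma> = \<eta> + i v\<close> the function \<open>Q(2 \<gamma> - 1 - \<tau>) f\<close> is a polynomial in \<open>i\<close> whose leading coefficient is, for
  suitable \<open>v\<close>, a nonzero multiple of \<open>f\<close>. A finite difference in \<open>i\<close> thus bounds \<open>f\<close> by finitely
  many weighted norms of \<open>P(\<tau>) f\<close>, with a constant that does not depend on \<open>\<eta>\<close>.

  The Hardy and Sobolev inequalities turn this into a bound for \<open>sup \<bar>x\<^sup>\<eta> f\<bar>\<close> that is still uniform in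
  \<open>\<eta>\<close>. The domains in question are exhausted by compact sets that are convex with respect to
  monomials, so suprema of monomials majorize any prescribed growth towards the boundary.
\<close>

section \<open>Smooth functions and test functions\<close>

text \<open>Euler operators degenerate on the coordinate hyperplanes, where distributions may be
  concentrated, so Fourier analysis in logarithmic coordinates on the open orthants is not enough.
  Monomials with natural exponents are smooth across the hyperplanes and allow estimates on the
  whole space at once.

  Uniformity of the constants carries the argument. Growth at the boundary is majorized by a
  supremum over infinitely many monomials, so a constant depending on \<open>\<eta>\<close> would be
  useless. Differentiation of order \<open>\<kappa>\<close> turns \<open>P(\<tau>)\<close> into
  \<open>P(\<tau> - \<kappa>)\<close>, so uniformity in real shifts is wanted too. Both hold for one
  reason: the leading coefficient in \<open>i\<close> sees only the top-degree part of
  \<open>P\<close> and the direction \<open>v\<close>, never a translation.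

  The \<open>L^2\<close> estimate controls \<open>x^(\<eta> + m v) f\<close>, whose exponent exceeds
  the desired \<open>\<eta>\<close>. Hardy's inequality removes the surplus at the cost of
  \<open>m v\<close> derivatives, with a factor 4 per derivative whatever the weight. The loss of
  derivatives depends on \<open>P\<close> and the dimension alone, which keeps the solution of
  finite order.\<close>

abbreviation supp :: "(real ^ 'n::finite \<Rightarrow> complex) \<Rightarrow> (real ^ 'n) set" where
  "supp \<phi> \<equiv> closure (support_on UNIV \<phi>)"

lemma zero_outside_supp: "x \<notin> supp \<phi> \<Longrightarrow> \<phi> x = 0"
  using closure_subset[of "support_on UNIV \<phi>"] by (auto simp: in_support_on)

lemma supp_subset_closed: "closed K \<Longrightarrow> (\<And>x. x \<notin> K \<Longrightarrow> \<phi> x = 0) \<Longrightarrow> supp \<phi> \<subseteq> K"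
  by (rule closure_minimal) (auto simp: support_on_def)

lemma partial_eq: "(f has_derivative D) (at x) \<Longrightarrow> partial j f x = D (axis j 1)"
  unfolding partial_def by (metis frechet_derivative_at)

lemma partials_Nil [simp]: "partials [] \<phi> = \<phi>"
  and partials_Cons: "partials (j # js) \<phi> = partial j (partials js \<phi>)"
  and partials_append: "partials (is @ js) \<phi> = partials is (partials js \<phi>)"
  by (auto simp: partials_def)

text \<open>A recursive counterpart of \<open>smooth\<close> that peels off the innermost
  derivative, so that closure under products, inverses and composition can be proved by induction on
  the order.\<close>

fun diffk :: "nat \<Rightarrow> (real ^ 'n::finite \<Rightarrow> complex) \<Rightarrow> bool" where
  "diffk 0 \<phi> \<longleftrightarrow> (\<forall>x. \<phi> differentiable at x)"
| "diffk (Suc n) \<phi> \<longleftrightarrow> (\<forall>x. \<phi> differentiable at x) \<and> (\<forall>j. diffk n (partial j \<phi>))"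

lemma diffk_iff: "diffk n \<phi> \<longleftrightarrow> (\<forall>js. length js \<le> n \<longrightarrow> partials js \<phi> differentiable_on UNIV)"
proof (induction n arbitrary: \<phi>)
  case 0
  then show ?case by (auto simp: differentiable_on_def)
next
  case (Suc n)
  show ?case
  proof
    assume *: "diffk (Suc n) \<phi>"
    show "\<forall>js. length js \<le> Suc n \<longrightarrow> partials js \<phi> differentiable_on UNIV"
    proof (intro allI impI)
      fix js :: "'a list" assume "length js \<le> Suc n"
      then show "partials js \<phi> differentiable_on UNIV"
        using * Suc.IH by (cases js rule: rev_exhaust) (auto simp: differentiable_on_def partials_append partials_Cons)
    qed
  next
    assume *: "\<forall>js. length js \<le> Suc n \<longrightarrow> partials js \<phi> differentiable_on UNIV"
    have "partials js (partial j \<phi>) differentiable_on UNIV" if "length js \<le> n" for js j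
      using *[rule_format, of "js @ [j]"] that by (simp add: partials_append partials_Cons)
    moreover have "\<phi> differentiable_on UNIV" using *[rule_format, of "[]"] by simp
    ultimately show "diffk (Suc n) \<phi>" using Suc.IH by (auto simp: differentiable_on_def)
  qed
qed

lemma smooth_iff_diffk: "smooth \<phi> \<longleftrightarrow> (\<forall>n. diffk n \<phi>)"
  unfolding smooth_def diffk_iff by blast

lemma diffk_differentiable: "diffk n \<phi> \<Longrightarrow> \<phi> differentiable at x"
  by (cases n) auto

lemma diffk_Suc_imp: "diffk (Suc n) \<phi> \<Longrightarrow> diffk n \<phi>"
  unfolding diffk_iff by auto

lemma smooth_differentiable: "smooth \<phi> \<Longrightarrow> \<phi> differentiable at x"
  using diffk_differentiable smooth_iff_diffk by blast

lemma smooth_continuous: "smooth \<phi> \<Longrightarrow> continuous_on S \<phi>"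
  by (meson continuous_at_imp_continuous_on differentiable_imp_continuous_within smooth_differentiable)

lemma smooth_partial: "smooth \<phi> \<Longrightarrow> smooth (partial j \<phi>)"
  unfolding smooth_iff_diffk using diffk.simps(2) by blast

lemma smooth_partials: "smooth \<phi> \<Longrightarrow> smooth (partials js \<phi>)"
  by (induction js) (auto simp: partials_Cons smooth_partial)

lemma smooth_has_derivative: "smooth \<phi> \<Longrightarrow> (\<phi> has_derivative frechet_derivative \<phi> (at x)) (at x)"
  using smooth_differentiable frechet_derivative_works by blast

lemma partial_const [simp]: "partial j (\<lambda>x. c) = (\<lambda>x. 0)"
  by (rule ext, subst partial_eq[OF has_derivative_const]) simp

lemma partial_add: "f differentiable at x \<Longrightarrow> g differentiable at x \<Longrightarrow>
    partial j (\<lambda>x. f x + g x) x = partial j f x + partial j g x"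
  unfolding differentiable_def
  by (auto simp: partial_eq[OF has_derivative_add] partial_eq)

lemma partial_mult: "f differentiable at x \<Longrightarrow> g differentiable at x \<Longrightarrow>
    partial j (\<lambda>x. f x * g x) x = partial j f x * g x + f x * partial j g x"
  unfolding differentiable_def
  by (auto simp: partial_eq[OF has_derivative_mult] partial_eq)

lemma partial_cmult: "f differentiable at x \<Longrightarrow> partial j (\<lambda>x. c * f x) x = c * partial j f x"
  using partial_mult[of "\<lambda>x. c" x f j] by simp

lemma partial_cnj: "f differentiable at x \<Longrightarrow> partial j (\<lambda>x. cnj (f x)) x = cnj (partial j f x)"
  unfolding differentiable_def
  by (auto simp: partial_eq[OF bounded_linear.has_derivative[OF bounded_linear_cnj]] partial_eq)

lemma has_derivative_coord:
  "((\<lambda>x. of_real (x $ i)) has_derivative (\<lambda>x. of_real (x $ i))) (at x)"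
  by (intro bounded_linear_imp_has_derivative bounded_linear_compose[OF bounded_linear_of_real]
      bounded_linear_vec_nth)

lemma partial_coord: "partial j (\<lambda>x. of_real (x $ i)) = (\<lambda>x. if i = j then 1 else 0)"
proof
  fix x :: "real ^ 'a"
  from partial_eq[OF has_derivative_coord, of j i x] show "partial j (\<lambda>x. of_real (x $ i)) x = (if i = j then 1 else 0)"
    by (auto simp: axis_def)
qed

lemma differentiable_cnj: "f differentiable at x \<Longrightarrow> (\<lambda>x. cnj (f x)) differentiable at x"
  unfolding differentiable_def using bounded_linear.has_derivative[OF bounded_linear_cnj] by blast

lemma diffk_const: "diffk n (\<lambda>x. c)"
  by (induction n arbitrary: c) auto

lemma diffk_add: "diffk n f \<Longrightarrow> diffk n g \<Longrightarrow> diffk n (\<lambda>x. f x + g x)"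
proof (induction n arbitrary: f g)
  case (Suc n)
  have "partial j (\<lambda>x. f x + g x) = (\<lambda>x. partial j f x + partial j g x)" for j
    using Suc.prems by (auto simp: partial_add)
  then show ?case using Suc by auto
qed auto

lemma diffk_mult: "diffk n f \<Longrightarrow> diffk n g \<Longrightarrow> diffk n (\<lambda>x. f x * g x)"
proof (induction n arbitrary: f g)
  case (Suc n)
  have "partial j (\<lambda>x. f x * g x) = (\<lambda>x. partial j f x * g x + f x * partial j g x)" for j
    using Suc.prems by (auto simp: partial_mult)
  moreover have "diffk n (\<lambda>x. partial j f x * g x)" "diffk n (\<lambda>x. f x * partial j g x)" for j
    using Suc.prems diffk_Suc_imp[of n f] diffk_Suc_imp[of n g] Suc.IH by (meson diffk.simps(2))+
  ultimately show ?case using Suc.prems by (auto intro!: diffk_add)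
qed auto

lemma diffk_cnj: "diffk n f \<Longrightarrow> diffk n (\<lambda>x. cnj (f x))"
proof (induction n arbitrary: f)
  case (Suc n)
  have "partial j (\<lambda>x. cnj (f x)) = (\<lambda>x. cnj (partial j f x))" for j
    using Suc.prems by (auto simp: partial_cnj)
  then show ?case using Suc by (auto simp: differentiable_cnj)
qed (auto simp: differentiable_cnj)

lemma smooth_const [intro, simp]: "smooth (\<lambda>x. c)"
  and smooth_add [intro]: "smooth f \<Longrightarrow> smooth g \<Longrightarrow> smooth (\<lambda>x. f x + g x)"
  and smooth_mult [intro]: "smooth f \<Longrightarrow> smooth g \<Longrightarrow> smooth (\<lambda>x. f x * g x)"
  and smooth_cnj [intro]: "smooth f \<Longrightarrow> smooth (\<lambda>x. cnj (f x))"
  by (auto simp: smooth_iff_diffk diffk_const diffk_add diffk_mult diffk_cnj)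

lemma smooth_uminus [intro]: "smooth f \<Longrightarrow> smooth (\<lambda>x. - f x)"
  using smooth_mult[of "\<lambda>x. -1" f] by simp

lemma smooth_diff [intro]: "smooth f \<Longrightarrow> smooth g \<Longrightarrow> smooth (\<lambda>x. f x - g x)"
  using smooth_add[of f "\<lambda>x. - g x"] smooth_uminus[of g] by simp

lemma smooth_sum [intro]: "(\<And>i. i \<in> I \<Longrightarrow> smooth (f i)) \<Longrightarrow> smooth (\<lambda>x. \<Sum>i\<in>I. f i x)"
  by (induction I rule: infinite_finite_induct) auto

lemma smooth_prod [intro]: "(\<And>i. i \<in> I \<Longrightarrow> smooth (f i)) \<Longrightarrow> smooth (\<lambda>x. \<Prod>i\<in>I. f i x)"
  by (induction I rule: infinite_finite_induct) auto

lemma smooth_power [intro]: "smooth f \<Longrightarrow> smooth (\<lambda>x. f x ^ n)"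
  by (induction n) auto

lemma smooth_coord [intro, simp]: "smooth (\<lambda>x. of_real (x $ i))"
proof -
  have "(\<lambda>x::real^'a. of_real (x $ i)) differentiable at x" for x
    unfolding differentiable_def using has_derivative_coord by blast
  then have "diffk n (\<lambda>x::real^'a. of_real (x $ i))" for n
    by (cases n) (auto simp: partial_coord diffk_const)
  then show ?thesis by (simp add: smooth_iff_diffk)
qed

text \<open>Differentiating \<open>f * inverse f = 1\<close> expresses the partials of
  \<open>inverse f\<close> through those of \<open>f\<close> and \<open>inverse f\<close> itself, so
  each order of differentiability yields the next.\<close>

lemma smooth_inverse:
  assumes "smooth f" "\<And>x. f x \<noteq> 0"
  shows "smooth (\<lambda>x. inverse (f x))"
proof -
  have D: "(\<lambda>x. inverse (f x)) differentiable at x" for x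
    using smooth_differentiable[OF assms(1), of x] assms(2)
    by (intro differentiable_inverse) auto
  have P: "partial j (\<lambda>x. inverse (f x)) = (\<lambda>x. - 1 * (partial j f x * (inverse (f x) * inverse (f x))))" for j
  proof
    fix x
    have "(\<lambda>x. f x * inverse (f x)) = (\<lambda>x. 1)" using assms(2) by auto
    then have "partial j f x * inverse (f x) + f x * partial j (\<lambda>x. inverse (f x)) x = 0"
      using partial_mult[OF smooth_differentiable[OF assms(1), of x] D[of x], of j] by simp
    then show "partial j (\<lambda>x. inverse (f x)) x = - 1 * (partial j f x * (inverse (f x) * inverse (f x)))"
      using assms(2)[of x] by (simp add: field_simps eq_neg_iff_add_eq_0)
  qed
  have "diffk n (\<lambda>x. inverse (f x))" for n
  proof (induction n)
    case (Suc n)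
    have "diffk n (partial j f)" for j
      using smooth_partial[OF assms(1)] smooth_iff_diffk by blast
    then have "diffk n (partial j (\<lambda>x. inverse (f x)))" for j
      unfolding P by (intro diffk_mult diffk_const Suc)
    then show ?case using D by auto
  qed (use D in auto)
  then show ?thesis by (simp add: smooth_iff_diffk)
qed

text \<open>The index map \<open>D\<close> encodes that the family \<open>F\<close> is closed under
  differentiation, so the chain rule stays inside products of members at \<open>B\<close> with
  derivatives of \<open>B\<close>. The intended family is \<open>expbump\<close>, indexed by
  polynomials.\<close>

lemma smooth_compose_family:
  fixes F :: "'a \<Rightarrow> real \<Rightarrow> real" and B :: "real ^ 'n::finite \<Rightarrow> real"
  assumes F: "\<And>p t. (F p has_real_derivative F (D p) t) (at t)"
    and B: "smooth (\<lambda>x. of_real (B x))"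
  shows "smooth (\<lambda>x. of_real (F p (B x)))"
proof -
  have dB: "(B has_derivative (\<lambda>h. Re (frechet_derivative (\<lambda>x. of_real (B x)) (at x) h))) (at x)" for x
    using bounded_linear.has_derivative[OF bounded_linear_Re smooth_has_derivative[OF B, of x]] by simp
  have "((\<lambda>x. of_real (B x)) has_derivative
      (\<lambda>h. of_real (Re (frechet_derivative (\<lambda>x. of_real (B x)) (at x) h)))) (at x)" for x
    by (rule bounded_linear.has_derivative[OF bounded_linear_of_real dB])
  from partial_eq[OF this] have pB: "partial j (\<lambda>x. of_real (B x)) x =
     of_real (Re (frechet_derivative (\<lambda>x. of_real (B x)) (at x) (axis j 1)))" for j x .
  have dF: "((\<lambda>x. of_real (F p (B x))) has_derivative
      (\<lambda>h. of_real (F (D p) (B x) * Re (frechet_derivative (\<lambda>x. of_real (B x)) (at x) h)))) (at x)" for p x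
    by (intro bounded_linear.has_derivative[OF bounded_linear_of_real]
        has_derivative_compose[OF dB F[THEN has_field_derivative_imp_has_derivative], of p x])
  have P: "partial j (\<lambda>x. of_real (F p (B x))) =
      (\<lambda>x. of_real (F (D p) (B x)) * partial j (\<lambda>x. of_real (B x)) x)" for p j
    by (rule ext) (simp add: partial_eq[OF dF] pB)
  have dif: "(\<lambda>x. of_real (F p (B x))) differentiable at x" for p x
    using dF unfolding differentiable_def by blast
  have "diffk n (\<lambda>x. of_real (F p (B x)))" for n p
  proof (induction n arbitrary: p)
    case (Suc n)
    have "diffk n (partial j (\<lambda>x. of_real (B x)))" for j
      using smooth_partial[OF B] smooth_iff_diffk by blast
    then have "diffk n (partial j (\<lambda>x. of_real (F p (B x))))" for j
      unfolding P by (intro diffk_mult Suc)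
    then show ?case using dif by auto
  qed (use dif in auto)
  then show ?thesis by (simp add: smooth_iff_diffk)
qed

lemma partials_add: "smooth f \<Longrightarrow> smooth g \<Longrightarrow>
    partials js (\<lambda>x. f x + g x) = (\<lambda>x. partials js f x + partials js g x)"
proof (induction js)
  case (Cons j js)
  then show ?case
    by (simp only: partials_Cons) (rule ext, simp add: partial_add smooth_differentiable smooth_partials)
qed simp

lemma partials_cmult: "smooth f \<Longrightarrow> partials js (\<lambda>x. c * f x) = (\<lambda>x. c * partials js f x)"
proof (induction js)
  case (Cons j js)
  then show ?case
    by (simp only: partials_Cons) (rule ext, simp add: partial_cmult smooth_differentiable smooth_partials)
qed simp

lemma partial_zero_outside_supp:
  assumes "x \<notin> supp \<phi>" shows "partial j \<phi> x = 0"
proof -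
  have "open (- supp \<phi>)" by (rule open_Compl) (rule closed_closure)
  then have "(\<phi> has_derivative (\<lambda>h. 0)) (at x)"
    by (rule has_derivative_transform_within_open[OF has_derivative_const[of 0]])
      (use assms zero_outside_supp in fastforce)+
  then show ?thesis by (simp add: partial_eq)
qed

lemma supp_partial: "supp (partial j \<phi>) \<subseteq> supp \<phi>"
  by (rule supp_subset_closed) (auto simp: partial_zero_outside_supp)

lemma supp_partials: "supp (partials js \<phi>) \<subseteq> supp \<phi>"
  by (induction js) (use supp_partial in \<open>auto simp: partials_Cons\<close>)

lemma test_functionsD:
  assumes "\<phi> \<in> test_functions \<Omega>"
  shows "smooth \<phi>" "compact (supp \<phi>)" "supp \<phi> \<subseteq> \<Omega>"
  using assms by (auto simp: test_functions_def)

lemma test_functionsI: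
  "smooth \<phi> \<Longrightarrow> compact K \<Longrightarrow> K \<subseteq> \<Omega> \<Longrightarrow> (\<And>x. x \<notin> K \<Longrightarrow> \<phi> x = 0) \<Longrightarrow> \<phi> \<in> test_functions \<Omega>"
  using supp_subset_closed[of K \<phi>] compact_imp_closed[of K] compact_Int_closed[of K "supp \<phi>"]
  by (auto simp: test_functions_def inf.absorb2)

lemma test_functions_mono: "\<phi> \<in> test_functions \<Omega> \<Longrightarrow> \<Omega> \<subseteq> \<Omega>' \<Longrightarrow> \<phi> \<in> test_functions \<Omega>'"
  by (auto simp: test_functions_def)

lemma test_mult: "\<phi> \<in> test_functions \<Omega> \<Longrightarrow> smooth f \<Longrightarrow> (\<lambda>x. f x * \<phi> x) \<in> test_functions \<Omega>"
  by (rule test_functionsI[of _ "supp \<phi>"]) (auto dest: test_functionsD zero_outside_supp)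

lemma test_cmult: "\<phi> \<in> test_functions \<Omega> \<Longrightarrow> (\<lambda>x. c * \<phi> x) \<in> test_functions \<Omega>"
  by (rule test_mult) auto

lemma test_uminus: "\<phi> \<in> test_functions \<Omega> \<Longrightarrow> (\<lambda>x. - \<phi> x) \<in> test_functions \<Omega>"
  using test_cmult[of \<phi> \<Omega> "-1"] by simp

lemma test_cnj: "\<phi> \<in> test_functions \<Omega> \<Longrightarrow> (\<lambda>x. cnj (\<phi> x)) \<in> test_functions \<Omega>"
  by (rule test_functionsI[of _ "supp \<phi>"]) (auto dest: test_functionsD zero_outside_supp)

lemma test_add: "\<phi> \<in> test_functions \<Omega> \<Longrightarrow> \<psi> \<in> test_functions \<Omega> \<Longrightarrow> (\<lambda>x. \<phi> x + \<psi> x) \<in> test_functions \<Omega>"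
  by (rule test_functionsI[of _ "supp \<phi> \<union> supp \<psi>"]) (auto dest: test_functionsD simp: zero_outside_supp)

lemma test_diff: "\<phi> \<in> test_functions \<Omega> \<Longrightarrow> \<psi> \<in> test_functions \<Omega> \<Longrightarrow> (\<lambda>x. \<phi> x - \<psi> x) \<in> test_functions \<Omega>"
  using test_add[of \<phi> \<Omega> "\<lambda>x. - \<psi> x"] test_uminus[of \<psi>] by simp

lemma test_zero: "(\<lambda>x. 0) \<in> test_functions \<Omega>"
  by (rule test_functionsI[of _ "{}"]) auto

lemma test_sum: "(\<And>i. i \<in> I \<Longrightarrow> f i \<in> test_functions \<Omega>) \<Longrightarrow> (\<lambda>x. \<Sum>i\<in>I. f i x) \<in> test_functions \<Omega>"
  by (induction I rule: infinite_finite_induct) (auto simp: test_zero test_add)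

lemma test_partial: "\<phi> \<in> test_functions \<Omega> \<Longrightarrow> partial j \<phi> \<in> test_functions \<Omega>"
  by (rule test_functionsI[of _ "supp \<phi>"]) (auto dest: test_functionsD partial_zero_outside_supp intro: smooth_partial)

lemma test_partials: "\<phi> \<in> test_functions \<Omega> \<Longrightarrow> partials js \<phi> \<in> test_functions \<Omega>"
  by (induction js) (auto simp: partials_Cons test_partial)

section \<open>Symmetry of second derivatives\<close>

text \<open>The mean value inequality is applied in direction \<open>i\<close> to an increment in
  direction \<open>j\<close>; the only second-order information used is the differentiability of
  \<open>partial i f\<close> at \<open>x\<close>. The difference is symmetric in \<open>i\<close>
  and \<open>j\<close> while the derivative is not, and this asymmetry yields commutation.\<close>

lemma second_difference_approx:
  fixes f :: "real ^ 'n::finite \<Rightarrow> complex"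
  assumes f: "smooth f" and e: "e > 0"
  shows "\<exists>d>0. \<forall>h::real. 0 < h \<and> h < d \<longrightarrow>
    norm (f (x + h *\<^sub>R axis i 1 + h *\<^sub>R axis j 1) - f (x + h *\<^sub>R axis i 1) - f (x + h *\<^sub>R axis j 1) + f x
      - of_real (h\<^sup>2) * partial j (partial i f) x) \<le> e * h\<^sup>2"
proof -
  define u where "u = partial i f"
  define L where "L = frechet_derivative u (at x)"
  have uL: "(u has_derivative L) (at x)"
    unfolding u_def L_def by (intro smooth_has_derivative smooth_partial f)
  interpret L: bounded_linear L using uL by (rule has_derivative_bounded_linear)
  \<comment> \<open>The tolerance \<open>e / 3\<close> is spent three times: the points compared
    below lie at distances at most \<open>2 * h\<close> and \<open>h\<close> from
    \<open>x\<close>.\<close>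
  obtain d where d: "d > 0" and dd: "\<And>y. norm (y - x) < d \<Longrightarrow>
      norm (u y - u x - L (y - x)) \<le> e / 3 * norm (y - x)"
    using uL e unfolding has_derivative_at_alt by (metis divide_pos_pos zero_less_numeral)
  have Lj: "L (axis j 1) = partial j u x" by (simp add: L_def partial_def)
  show ?thesis
  proof (intro exI[of _ "d/2"] conjI allI impI)
    fix h :: real assume h: "0 < h \<and> h < d / 2"
    define a where "a = (axis i 1 :: real^'n)"
    define b where "b = (axis j 1 :: real^'n)"
    have na: "norm a = 1" "norm b = 1" by (auto simp: a_def b_def)
    \<comment> \<open>The increment along \<open>b\<close> minus its linear model, as a function of
      the position along \<open>a\<close>; \<open>\<psi>'\<close> is its derivative.\<close>
    define \<psi> where "\<psi> s = f (x + s *\<^sub>R a + h *\<^sub>R b) - f (x + s *\<^sub>R a) - of_real (s * h) * L b" for s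
    define \<psi>' where "\<psi>' s = u (x + s *\<^sub>R a + h *\<^sub>R b) - u (x + s *\<^sub>R a) - of_real h * L b" for s
    have fd: "((\<lambda>s. f (z + s *\<^sub>R a)) has_derivative (\<lambda>t. of_real t * u (z + s *\<^sub>R a))) (at s)" for z s
    proof -
      have "((\<lambda>s. f (z + s *\<^sub>R a)) has_derivative (\<lambda>t. frechet_derivative f (at (z + s *\<^sub>R a)) (t *\<^sub>R a))) (at s)"
        by (rule has_derivative_compose[OF _ smooth_has_derivative[OF f]]) (auto intro!: derivative_eq_intros)
      moreover have "frechet_derivative f (at (z + s *\<^sub>R a)) (t *\<^sub>R a) = of_real t * u (z + s *\<^sub>R a)" for t
        using linear_scale[OF linear_frechet_derivative[OF smooth_differentiable[OF f]]]
        by (simp add: u_def a_def partial_def scaleR_conv_of_real)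
      ultimately show ?thesis by simp
    qed
    have der: "(\<psi> has_derivative (\<lambda>t. of_real t * \<psi>' s)) (at s within {0..h})" for s
    proof -
      have "((\<lambda>s. f (x + h *\<^sub>R b + s *\<^sub>R a)) has_derivative (\<lambda>t. of_real t * u (x + h *\<^sub>R b + s *\<^sub>R a))) (at s within {0..h})"
        "((\<lambda>s. f (x + s *\<^sub>R a)) has_derivative (\<lambda>t. of_real t * u (x + s *\<^sub>R a))) (at s within {0..h})"
        by (rule has_derivative_at_withinI, rule fd)+
      moreover have "((\<lambda>s. of_real (s * h) * L b) has_derivative (\<lambda>t. of_real t * (of_real h * L b))) (at s within {0..h})"
        by (auto intro!: derivative_eq_intros simp: algebra_simps)
      ultimately have "((\<lambda>s. f (x + h *\<^sub>R b + s *\<^sub>R a) - f (x + s *\<^sub>R a) - of_real (s * h) * L b) has_derivative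
         (\<lambda>t. of_real t * u (x + h *\<^sub>R b + s *\<^sub>R a) - of_real t * u (x + s *\<^sub>R a) - of_real t * (of_real h * L b))) (at s within {0..h})"
        by (intro has_derivative_diff)
      then show ?thesis
        unfolding \<psi>_def[abs_def] \<psi>'_def by (simp add: algebra_simps)
    qed
    have bd: "norm (\<psi>' s) \<le> e * h" if s: "s \<in> {0..h}" for s
    proof -
      define y where "y = x + s *\<^sub>R a + h *\<^sub>R b"
      define z where "z = x + s *\<^sub>R a"
      have ny: "norm (y - x) \<le> 2 * h" and nz: "norm (z - x) \<le> h"
        using s h norm_triangle_ineq[of "s *\<^sub>R a" "h *\<^sub>R b"] na by (auto simp: y_def z_def)
      have "L (y - x) = L (z - x) + of_real h * L b"
        by (simp add: y_def z_def L.add L.scaleR scaleR_conv_of_real[of _ "L _"] add.commute)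
      then have "\<psi>' s = (u y - u x - L (y - x)) - (u z - u x - L (z - x))"
        by (simp add: \<psi>'_def y_def z_def)
      also have "norm \<dots> \<le> norm (u y - u x - L (y - x)) + norm (u z - u x - L (z - x))"
        by (rule norm_triangle_ineq4)
      also have "\<dots> \<le> e / 3 * norm (y - x) + e / 3 * norm (z - x)"
        by (intro add_mono dd) (use ny nz h in linarith)+
      also have "\<dots> \<le> e / 3 * (2 * h) + e / 3 * h"
        by (intro add_mono mult_left_mono ny nz) (use e in auto)
      finally show ?thesis by simp
    qed
    have "norm (\<psi> h - \<psi> 0) \<le> e * h * norm (h - 0)"
    proof (rule differentiable_bound[OF convex_real_interval(5)[of 0 h] der])
      show "onorm (\<lambda>t. of_real t * \<psi>' s) \<le> e * h" if "s \<in> {0..h}" for s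
        by (rule onorm_le) (use bd[OF that] in \<open>simp add: norm_mult mult_mono mult.commute\<close>)
    qed (use h in auto)
    moreover have "\<psi> h - \<psi> 0 = f (x + h *\<^sub>R a + h *\<^sub>R b) - f (x + h *\<^sub>R a) - f (x + h *\<^sub>R b) + f x
      - of_real (h\<^sup>2) * partial j u x"
      using Lj by (simp add: \<psi>_def b_def algebra_simps power2_eq_square)
    ultimately show "norm (f (x + h *\<^sub>R axis i 1 + h *\<^sub>R axis j 1) - f (x + h *\<^sub>R axis i 1) - f (x + h *\<^sub>R axis j 1) + f x
      - of_real (h\<^sup>2) * partial j (partial i f) x) \<le> e * h\<^sup>2"
      using h by (simp add: a_def b_def u_def power2_eq_square)
  qed (use d in auto)
qed

text \<open>The second difference divided by \<open>h^2\<close> approximates both mixed derivatives.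
  With tolerance \<open>\<delta> / 3\<close> for each, they differ by at most two thirds of their
  distance \<open>\<delta>\<close>, which forces \<open>\<delta> = 0\<close>.\<close>

lemma partial_commute:
  assumes f: "smooth f" shows "partial i (partial j f) = partial j (partial i f)"
proof
  fix x
  define \<delta> where "\<delta> = norm (partial i (partial j f) x - partial j (partial i f) x)"
  show "partial i (partial j f) x = partial j (partial i f) x"
  proof (rule ccontr)
    assume "\<not> ?thesis"
    then have "\<delta> / 3 > 0" by (simp add: \<delta>_def)
    from second_difference_approx[OF f this, of x i j] second_difference_approx[OF f this, of x j i]
    obtain d d' where d: "d > 0" "\<And>h::real. 0 < h \<Longrightarrow> h < d \<Longrightarrow>
      norm (f (x + h *\<^sub>R axis i 1 + h *\<^sub>R axis j 1) - f (x + h *\<^sub>R axis i 1) - f (x + h *\<^sub>R axis j 1) + f x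
      - of_real (h\<^sup>2) * partial j (partial i f) x) \<le> \<delta>/3 * h\<^sup>2"
     and d': "d' > 0" "\<And>h::real. 0 < h \<Longrightarrow> h < d' \<Longrightarrow>
      norm (f (x + h *\<^sub>R axis j 1 + h *\<^sub>R axis i 1) - f (x + h *\<^sub>R axis j 1) - f (x + h *\<^sub>R axis i 1) + f x
      - of_real (h\<^sup>2) * partial i (partial j f) x) \<le> \<delta>/3 * h\<^sup>2" by blast
    define h where "h = min d d' / 2"
    have h: "0 < h" "h < d" "h < d'" using d d' by (auto simp: h_def)
    define D where "D = f (x + h *\<^sub>R axis i 1 + h *\<^sub>R axis j 1) - f (x + h *\<^sub>R axis i 1) - f (x + h *\<^sub>R axis j 1) + f x"
    have 1: "norm (D - of_real (h\<^sup>2) * partial j (partial i f) x) \<le> \<delta>/3 * h\<^sup>2"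
      using d(2)[OF h(1,2)] by (simp add: D_def)
    have 2: "norm (D - of_real (h\<^sup>2) * partial i (partial j f) x) \<le> \<delta>/3 * h\<^sup>2"
      using d'(2)[OF h(1,3)] by (simp add: D_def algebra_simps)
    have "h\<^sup>2 * \<delta> = norm ((D - of_real (h\<^sup>2) * partial j (partial i f) x) - (D - of_real (h\<^sup>2) * partial i (partial j f) x))"
      by (simp add: \<delta>_def norm_mult norm_power flip: right_diff_distrib)
    also have "\<dots> \<le> \<delta>/3 * h\<^sup>2 + \<delta>/3 * h\<^sup>2"
      using norm_triangle_ineq4 1 2 by (meson add_mono order_trans)
    finally have "\<delta> * h\<^sup>2 \<le> 0" by (simp add: algebra_simps)
    then show False using \<open>\<delta> / 3 > 0\<close> h by (simp add: mult_le_0_iff)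
  qed
qed

section \<open>Integration by parts\<close>

lemma line_has_vector_derivative:
  assumes f: "smooth f"
  shows "((\<lambda>s. f (z + s *\<^sub>R axis i 1)) has_vector_derivative partial i f (z + s *\<^sub>R axis i 1)) (at s)"
proof -
  have "((\<lambda>s. f (z + s *\<^sub>R axis i 1)) has_derivative
      (\<lambda>t. frechet_derivative f (at (z + s *\<^sub>R axis i 1)) (t *\<^sub>R axis i 1))) (at s)"
    by (rule has_derivative_compose[OF _ smooth_has_derivative[OF f]]) (auto intro!: derivative_eq_intros)
  then show ?thesis
    using linear_scale[OF linear_frechet_derivative[OF smooth_differentiable[OF f]]]
    by (simp add: has_vector_derivative_def partial_def)
qed

lemma test_bounded:
  assumes "\<phi> \<in> test_functions \<Omega>" shows "\<exists>B\<ge>0. \<forall>x. norm (\<phi> x) \<le> B"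
proof -
  have "compact (\<phi> ` supp \<phi>)"
    using assms by (intro compact_continuous_image smooth_continuous) (auto dest: test_functionsD)
  then obtain B where B: "\<And>y. y \<in> \<phi> ` supp \<phi> \<Longrightarrow> norm y \<le> B"
    using compact_imp_bounded bounded_iff by metis
  have "norm (\<phi> x) \<le> max B 0" for x
    using B[of "\<phi> x"] zero_outside_supp[of x \<phi>] by (cases "x \<in> supp \<phi>") auto
  then show ?thesis by (intro exI[of _ "max B 0"]) auto
qed

lemma integrable_compact_support:
  fixes g :: "real ^ 'n::finite \<Rightarrow> 'b::{banach, second_countable_topology}"
  assumes "continuous_on UNIV g" "compact K" "\<And>x. x \<notin> K \<Longrightarrow> g x = 0"
  shows "integrable lborel g"
proof -
  have "integrable lborel (\<lambda>x. indicator K x *\<^sub>R g x)"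
    using assms by (intro borel_integrable_compact) (auto intro: continuous_on_subset)
  moreover have "(\<lambda>x. indicator K x *\<^sub>R g x) = g"
    using assms(3) by (auto simp: fun_eq_iff indicator_def)
  ultimately show ?thesis by simp
qed

lemma test_integrable: "\<phi> \<in> test_functions \<Omega> \<Longrightarrow> integrable lborel \<phi>"
  by (rule integrable_compact_support[of _ "supp \<phi>"])
    (auto dest: test_functionsD simp: smooth_continuous zero_outside_supp)

lemma integral_translate:
  fixes f :: "real ^ 'n::finite \<Rightarrow> complex"
  assumes "f \<in> borel_measurable borel"
  shows "(\<integral>x. f (c + x) \<partial>lborel) = (\<integral>x. f x \<partial>lborel)"
  using integral_distr[of "(+) c" lborel borel f] assms by (simp add: lborel_distr_plus)

lemma integrable_translate:
  fixes f :: "real ^ 'n::finite \<Rightarrow> complex"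
  assumes "integrable lborel f"
  shows "integrable lborel (\<lambda>x. f (c + x))"
  using integrable_distr[of "(+) c" lborel borel f] assms by (simp add: lborel_distr_plus)

text \<open>By translation invariance every difference quotient of \<open>\<phi>\<close> has
  integral 0, and dominated convergence carries this to the derivative. Applied to a product it
  becomes integration by parts.\<close>

lemma integral_partial_eq_0:
  fixes \<phi> :: "real ^ 'n::finite \<Rightarrow> complex"
  assumes \<phi>: "\<phi> \<in> test_functions UNIV"
  shows "(\<integral>x. partial j \<phi> x \<partial>lborel) = 0"
proof -
  define e where "e = (axis j 1 :: real^'n)"
  define h where "h n = inverse (real (Suc n))" for n
  have sm: "smooth \<phi>" using \<phi> by (auto dest: test_functionsD)
  have meas: "\<phi> \<in> borel_measurable borel"
    by (intro borel_measurable_continuous_onI smooth_continuous sm)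
  obtain B where B: "B \<ge> 0" "\<And>x. norm (partial j \<phi> x) \<le> B"
    using test_bounded[OF test_partial[OF \<phi>]] by blast
  obtain R where R: "supp \<phi> \<subseteq> cball 0 R"
    using compact_imp_bounded[OF test_functionsD(2)[OF \<phi>], unfolded bounded_iff] by (auto simp: subset_iff)
  define s where "s n x = of_real (inverse (h n)) * (\<phi> (h n *\<^sub>R e + x) - \<phi> x)" for n x
  have h: "0 < h n" "h n \<le> 1" for n by (auto simp: h_def field_simps)
  have h0: "h \<longlonglongrightarrow> 0" unfolding h_def by (rule LIMSEQ_inverse_real_of_nat)
  have 0: "(\<integral>x. s n x \<partial>lborel) = 0" for n
  proof -
    have "(\<integral>x. \<phi> (h n *\<^sub>R e + x) - \<phi> x \<partial>lborel) = 0"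
      by (subst Bochner_Integration.integral_diff[OF integrable_translate[OF test_integrable[OF \<phi>]] test_integrable[OF \<phi>]])
        (simp only: integral_translate[OF meas] diff_self)
    then show ?thesis unfolding s_def by (simp only: integral_mult_right_zero mult_zero_right)
  qed
  have "(\<lambda>n. \<integral>x. s n x \<partial>lborel) \<longlonglongrightarrow> (\<integral>x. partial j \<phi> x \<partial>lborel)"
  proof (rule integral_dominated_convergence)
    show "partial j \<phi> \<in> borel_measurable lborel"
      using smooth_continuous[OF smooth_partial[OF sm], of UNIV j]
      by (simp add: borel_measurable_continuous_onI)
    have "continuous_on UNIV (\<lambda>x. \<phi> (h n *\<^sub>R e + x))" for n
      by (rule continuous_on_compose2[OF smooth_continuous[OF sm, of UNIV]])
        (auto intro: continuous_on_add continuous_on_const continuous_on_id)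
    then have "continuous_on UNIV (s n)" for n
      unfolding s_def[abs_def]
      by (intro continuous_on_mult continuous_on_const continuous_on_diff) (auto intro: smooth_continuous[OF sm])
    then have "s n \<in> borel_measurable borel" for n
      by (rule borel_measurable_continuous_onI)
    then show "s n \<in> borel_measurable lborel" for n by simp
    \<comment> \<open>Shifts by \<open>h n \<le> 1\<close> keep the difference quotients supported
      in the ball of radius \<open>R + 1\<close>, where the mean value inequality bounds them by
      \<open>B\<close>.\<close>
    show "integrable lborel (\<lambda>x::real^'n. B * indicator (cball 0 (R + 1)) x :: real)"
      by (intro integrable_mult_right integrable_real_indicator) (use emeasure_lborel_cball_finite in \<open>auto simp: less_top\<close>)
    show "AE x in lborel. (\<lambda>n. s n x) \<longlonglongrightarrow> partial j \<phi> x"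
    proof (rule AE_I2)
      fix x
      have "((\<lambda>t. (\<phi> (x + t *\<^sub>R e) - \<phi> x) /\<^sub>R t) \<longlongrightarrow> partial j \<phi> x) (at 0)"
        unfolding e_def
      proof -
        have "((\<lambda>s. \<phi> (x + s *\<^sub>R axis j 1)) has_vector_derivative partial j \<phi> x) (at 0)"
          using line_has_vector_derivative[OF sm, of x j 0] by simp
        from this[unfolded has_vector_derivative_def has_derivative_at]
        have "((\<lambda>t. norm (\<phi> (x + t *\<^sub>R axis j 1) - \<phi> x - t *\<^sub>R partial j \<phi> x) / norm t) \<longlongrightarrow> 0) (at 0)"
          by simp
        then have "((\<lambda>t. norm ((\<phi> (x + t *\<^sub>R axis j 1) - \<phi> x) /\<^sub>R t - partial j \<phi> x)) \<longlongrightarrow> 0) (at 0)"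
        proof (rule Lim_transform_eventually)
          show "\<forall>\<^sub>F t in at 0. norm (\<phi> (x + t *\<^sub>R axis j 1) - \<phi> x - t *\<^sub>R partial j \<phi> x) / norm t =
            norm ((\<phi> (x + t *\<^sub>R axis j 1) - \<phi> x) /\<^sub>R t - partial j \<phi> x)"
            unfolding eventually_at
          proof (intro exI[of _ 1] conjI ballI impI, simp)
            fix t :: real assume "t \<noteq> 0 \<and> dist t 0 < 1"
            then have "(\<phi> (x + t *\<^sub>R axis j 1) - \<phi> x) /\<^sub>R t - partial j \<phi> x =
              (\<phi> (x + t *\<^sub>R axis j 1) - \<phi> x - t *\<^sub>R partial j \<phi> x) /\<^sub>R t"
              by (simp add: scaleR_diff_right)
            then show "norm (\<phi> (x + t *\<^sub>R axis j 1) - \<phi> x - t *\<^sub>R partial j \<phi> x) / norm t =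
               norm ((\<phi> (x + t *\<^sub>R axis j 1) - \<phi> x) /\<^sub>R t - partial j \<phi> x)"
              by (simp add: divide_inverse mult.commute)
          qed
        qed
        then show "((\<lambda>t. (\<phi> (x + t *\<^sub>R axis j 1) - \<phi> x) /\<^sub>R t) \<longlongrightarrow> partial j \<phi> x) (at 0)"
          by (simp add: tendsto_norm_zero_iff LIM_zero_iff)
      qed
      moreover have "filterlim h (at 0) sequentially"
        using h0 h(1) by (auto simp: filterlim_at intro!: always_eventually) (metis less_irrefl)
      ultimately have "(\<lambda>n. (\<phi> (x + h n *\<^sub>R e) - \<phi> x) /\<^sub>R h n) \<longlonglongrightarrow> partial j \<phi> x"
        by (rule filterlim_compose)
      then show "(\<lambda>n. s n x) \<longlonglongrightarrow> partial j \<phi> x"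
        by (simp add: s_def scaleR_conv_of_real add.commute)
    qed
    show "AE x in lborel. norm (s n x) \<le> B * indicator (cball 0 (R + 1)) x" for n
    proof (rule AE_I2)
      fix x
      show "norm (s n x) \<le> B * indicator (cball 0 (R + 1)) x"
      proof (cases "x \<in> cball 0 (R + 1)")
        case True
        have "norm (\<phi> (x + h n *\<^sub>R e) - \<phi> (x + 0 *\<^sub>R e)) \<le> B * norm (h n - 0)"
        proof (rule differentiable_bound[of "{0..h n}" "\<lambda>s. \<phi> (x + s *\<^sub>R e)" "\<lambda>s t. t *\<^sub>R partial j \<phi> (x + s *\<^sub>R e)"])
          show "((\<lambda>s. \<phi> (x + s *\<^sub>R e)) has_derivative (\<lambda>t. t *\<^sub>R partial j \<phi> (x + s *\<^sub>R e))) (at s within {0..h n})" for s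
            unfolding e_def
            by (rule has_derivative_at_withinI) (rule line_has_vector_derivative[OF sm, unfolded has_vector_derivative_def])
          show "onorm (\<lambda>t. t *\<^sub>R partial j \<phi> (x + s *\<^sub>R e)) \<le> B" for s
            by (rule onorm_le) (use B(2)[of "x + s *\<^sub>R e"] in \<open>simp add: mult_right_mono mult.commute[of "\<bar>_\<bar>"]\<close>)
        qed (use B h[of n] in auto)
        then have "norm (\<phi> (h n *\<^sub>R e + x) - \<phi> x) \<le> B * h n"
          using h[of n] by (simp add: add.commute)
        then have "norm (\<phi> (h n *\<^sub>R e + x) - \<phi> x) / h n \<le> B"
          using h(1)[of n] by (simp add: pos_divide_le_eq)
        moreover have "norm (s n x) = norm (\<phi> (h n *\<^sub>R e + x) - \<phi> x) / h n"
          using h(1)[of n] by (simp add: s_def norm_mult norm_inverse divide_inverse mult.commute)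
        ultimately show ?thesis using True by simp
      next
        case False
        then have nx: "norm x > R + 1" by (simp add: dist_norm)
        have "norm (h n *\<^sub>R e) \<le> 1" using h[of n] by (simp add: e_def)
        then have "norm (h n *\<^sub>R e + x) > R" using nx norm_diff_ineq[of x "h n *\<^sub>R e"] by (simp add: add.commute)
        then have "h n *\<^sub>R e + x \<notin> supp \<phi>" "x \<notin> supp \<phi>"
          using subsetD[OF R, of "h n *\<^sub>R e + x"] subsetD[OF R, of x] nx by auto
        then show ?thesis using False by (simp add: s_def zero_outside_supp)
      qed
    qed
  qed
  then show ?thesis using 0 by (simp add: LIMSEQ_const_iff)
qed

section \<open>The \<open>L^2\<close> pairing and the transposed Euler operators\<close>

abbreviation tests :: "(real ^ 'n::finite \<Rightarrow> complex) set" where "tests \<equiv> test_functions UNIV"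

definition ip :: "(real ^ 'n::finite \<Rightarrow> complex) \<Rightarrow> (real ^ 'n \<Rightarrow> complex) \<Rightarrow> complex" where
  "ip f g = (\<integral>x. f x * cnj (g x) \<partial>lborel)"

definition nsq :: "(real ^ 'n::finite \<Rightarrow> complex) \<Rightarrow> real" where
  "nsq f = (\<integral>x. (norm (f x))\<^sup>2 \<partial>lborel)"

lemma test_times_cnj: "f \<in> tests \<Longrightarrow> g \<in> tests \<Longrightarrow> (\<lambda>x. f x * cnj (g x)) \<in> tests"
  by (rule test_mult) (auto dest: test_functionsD intro: test_cnj)

lemma ip_add_left: "f \<in> tests \<Longrightarrow> g \<in> tests \<Longrightarrow> h \<in> tests \<Longrightarrow> ip (\<lambda>x. f x + g x) h = ip f h + ip g h"
  by (simp add: ip_def ring_distribs test_integrable[OF test_times_cnj])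

lemma ip_cmult_left: "f \<in> tests \<Longrightarrow> h \<in> tests \<Longrightarrow> ip (\<lambda>x. c * f x) h = c * ip f h"
  by (simp add: ip_def mult.assoc)

lemma ip_cnj: "ip g f = cnj (ip f g)"
proof -
  have "cnj (ip f g) = (\<integral>x. cnj (f x * cnj (g x)) \<partial>lborel)"
    unfolding ip_def by (rule Bochner_Integration.integral_cnj[symmetric])
  then show ?thesis by (simp add: ip_def mult.commute)
qed

lemma ip_add_right: "f \<in> tests \<Longrightarrow> g \<in> tests \<Longrightarrow> h \<in> tests \<Longrightarrow> ip h (\<lambda>x. f x + g x) = ip h f + ip h g"
  by (subst (1 2 3) ip_cnj) (simp add: ip_add_left)

lemma ip_cmult_right: "f \<in> tests \<Longrightarrow> h \<in> tests \<Longrightarrow> ip h (\<lambda>x. c * f x) = cnj c * ip h f"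
  by (subst (1 2) ip_cnj) (simp add: ip_cmult_left)

lemma ip_sum_left: "(\<And>i. i \<in> I \<Longrightarrow> f i \<in> tests) \<Longrightarrow> g \<in> tests \<Longrightarrow>
    ip (\<lambda>x. \<Sum>i\<in>I. f i x) g = (\<Sum>i\<in>I. ip (f i) g)"
proof (induction I rule: infinite_finite_induct)
  case (insert i I)
  then show ?case using ip_add_left[of "f i" "\<lambda>x. \<Sum>i\<in>I. f i x" g] by (simp add: test_sum)
qed (simp_all add: ip_def)

lemma ip_sum_right: "(\<And>i. i \<in> I \<Longrightarrow> f i \<in> tests) \<Longrightarrow> g \<in> tests \<Longrightarrow>
    ip g (\<lambda>x. \<Sum>i\<in>I. f i x) = (\<Sum>i\<in>I. ip g (f i))"
  by (subst ip_cnj, subst ip_sum_left) (simp_all add: ip_cnj[of g])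

lemma nsq_eq_ip: "of_real (nsq f) = ip f f"
  unfolding nsq_def ip_def integral_complex_of_real[symmetric]
  by (simp only: complex_norm_square)

lemma nsq_nonneg: "0 \<le> nsq f"
  by (simp add: nsq_def)

lemma test_norm2_integrable: "f \<in> tests \<Longrightarrow> integrable lborel (\<lambda>x. (norm (f x))\<^sup>2)"
  by (rule integrable_compact_support[of _ "supp f"])
    (auto dest: test_functionsD simp: zero_outside_supp intro!: continuous_intros smooth_continuous)

lemma ip_partial:
  assumes f: "f \<in> tests" and g: "g \<in> tests"
  shows "ip (partial j f) g = - ip f (partial j g)"
proof -
  have "partial j (\<lambda>x. f x * cnj (g x)) = (\<lambda>x. partial j f x * cnj (g x) + f x * cnj (partial j g x))"
    using f g by (auto simp: partial_mult partial_cnj test_functionsD smooth_differentiable differentiable_cnj)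
  with integral_partial_eq_0[OF test_times_cnj[OF f g], of j]
  have "ip (partial j f) g + ip f (partial j g) = 0"
    using test_integrable[OF test_times_cnj[OF f test_partial[OF g]]]
      test_integrable[OF test_times_cnj[OF test_partial[OF f] g]]
    by (simp add: ip_def)
  then show ?thesis by (simp add: eq_neg_iff_add_eq_0)
qed

text \<open>The transpose of \<open>theta j\<close> on test functions.\<close>

definition tau :: "'n::finite \<Rightarrow> (real ^ 'n \<Rightarrow> complex) \<Rightarrow> real ^ 'n \<Rightarrow> complex" where
  "tau j f = (\<lambda>x. - partial j (\<lambda>x. of_real (x $ j) * f x) x)"

text \<open>The class is stable under all operations used later: the adjoint sends
  \<open>(s, a)\<close> to \<open>(- s, a - s)\<close>, a weight \<open>x^\<gamma>\<close> adds
  \<open>s * \<gamma>\<close> to \<open>a\<close>, and for \<open>s = 1\<close> a partial derivative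
  lowers one entry of \<open>a\<close> by 1. The shift is a whole vector so that the operators for
  all \<open>j\<close> share it.\<close>

definition aff :: "real \<Rightarrow> ('n \<Rightarrow> real) \<Rightarrow> 'n::finite \<Rightarrow> (real ^ 'n \<Rightarrow> complex) \<Rightarrow> real ^ 'n \<Rightarrow> complex" where
  "aff s a j f = (\<lambda>x. of_real s * tau j f x + of_real (a j) * f x)"

lemma tau_eq: "smooth f \<Longrightarrow> tau j f = (\<lambda>x. - f x - of_real (x $ j) * partial j f x)"
  by (rule ext) (simp add: tau_def partial_mult smooth_differentiable partial_coord)

lemma tau_test: "f \<in> test_functions \<Omega> \<Longrightarrow> tau j f \<in> test_functions \<Omega>"
  unfolding tau_def by (intro test_uminus test_partial test_mult smooth_coord)

lemma tau_smooth: "smooth f \<Longrightarrow> smooth (tau j f)"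
  unfolding tau_def by (intro smooth_uminus smooth_partial smooth_mult smooth_coord)

lemma aff_test: "f \<in> test_functions \<Omega> \<Longrightarrow> aff s a j f \<in> test_functions \<Omega>"
  unfolding aff_def by (intro test_add test_cmult tau_test)

lemma tau_commute: "smooth f \<Longrightarrow> tau i (tau j f) = tau j (tau i f)"
proof -
  assume f: "smooth f"
  have P: "partial i (tau j f) x = - partial i f x - ((if i = j then partial j f x else 0)
      + of_real (x $ j) * partial i (partial j f) x)" for i j x
  proof -
    have 1: "tau j f = (\<lambda>x. -1 * (f x + of_real (x $ j) * partial j f x))"
      using tau_eq[OF f] by (auto simp: fun_eq_iff)
    have "(\<lambda>x. of_real (x $ j) * partial j f x) differentiable at x" for x
      by (intro smooth_differentiable smooth_mult smooth_coord smooth_partial f)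
    moreover have "(\<lambda>x. f x + of_real (x $ j) * partial j f x) differentiable at x" for x
      by (intro smooth_differentiable smooth_mult smooth_coord smooth_partial smooth_add f)
    ultimately show ?thesis unfolding 1
      by (subst partial_cmult) (simp_all add: partial_add partial_mult partial_coord smooth_differentiable f smooth_partial)
  qed
  show ?thesis
    unfolding tau_eq[OF tau_smooth[OF f]] P
    by (rule ext) (auto simp: tau_eq[OF f] partial_commute[OF f, of i j] algebra_simps)
qed

text \<open>Linearity is demanded on test functions only: \<open>frechet_derivative\<close> is
  arbitrary at points without a derivative, so \<open>partial\<close> cannot be expected to be
  linear on all functions.\<close>

definition linop :: "((real ^ 'n::finite \<Rightarrow> complex) \<Rightarrow> real ^ 'n \<Rightarrow> complex) \<Rightarrow> bool" where
  "linop T \<longleftrightarrow> (\<forall>f\<in>tests. T f \<in> tests) \<and>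
    (\<forall>f\<in>tests. \<forall>g\<in>tests. T (\<lambda>x. f x + g x) = (\<lambda>x. T f x + T g x)) \<and>
    (\<forall>f\<in>tests. \<forall>c. T (\<lambda>x. c * f x) = (\<lambda>x. c * T f x))"

lemma linopD:
  assumes "linop T"
  shows "f \<in> tests \<Longrightarrow> T f \<in> tests"
    "f \<in> tests \<Longrightarrow> g \<in> tests \<Longrightarrow> T (\<lambda>x. f x + g x) = (\<lambda>x. T f x + T g x)"
    "f \<in> tests \<Longrightarrow> T (\<lambda>x. c * f x) = (\<lambda>x. c * T f x)"
  using assms by (auto simp: linop_def)

lemma linop_lincomb:
  assumes "linop T" "\<And>i. i \<in> I \<Longrightarrow> f i \<in> tests"
  shows "T (\<lambda>x. \<Sum>i\<in>I. c i * f i x) = (\<lambda>x. \<Sum>i\<in>I. c i * T (f i) x)"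
  using assms(2)
proof (induction I rule: infinite_finite_induct)
  case (insert i I)
  have "(\<lambda>x. \<Sum>i\<in>I. c i * f i x) \<in> tests" using insert by (intro test_sum test_cmult) auto
  then show ?case using insert linopD[OF assms(1)] by (simp add: test_cmult)
next
  case empty
  show ?case using linopD(3)[OF assms(1) test_zero, of 0] by simp
next
  case (infinite A)
  then show ?case using linopD(3)[OF assms(1) test_zero, of 0] by simp
qed

lemma linop_id: "linop (\<lambda>f. f)"
  by (simp add: linop_def)

lemma linop_compose: "linop S \<Longrightarrow> linop T \<Longrightarrow> linop (\<lambda>f. S (T f))"
  by (simp add: linop_def)

lemma linop_funpow: "linop T \<Longrightarrow> linop (T ^^ n)"
  by (induction n) (auto simp: linop_id id_def comp_def intro: linop_compose)

lemma linop_fold: "(\<And>j. linop (F j)) \<Longrightarrow> linop (fold F js)"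
  by (induction js) (auto simp: linop_id id_def comp_def intro: linop_compose)

lemma linop_lincomb_op: "(\<And>i. i \<in> I \<Longrightarrow> linop (T i)) \<Longrightarrow> linop (\<lambda>f x. \<Sum>i\<in>I. c i * T i f x)"
  unfolding linop_def
  by (auto intro!: test_sum test_cmult simp: ring_distribs sum.distrib sum_distrib_left ac_simps)

lemma linop_tau: "linop (tau j)"
proof -
  have "tau j (\<lambda>x. f x + g x) = (\<lambda>x. tau j f x + tau j g x)" if "f \<in> tests" "g \<in> tests" for f g
    using that[THEN test_functionsD(1)]
    by (auto simp: tau_eq smooth_add partial_add smooth_differentiable algebra_simps)
  moreover have "tau j (\<lambda>x. c * f x) = (\<lambda>x. c * tau j f x)" if "f \<in> tests" for f c
    using test_functionsD(1)[OF that]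
    by (auto simp: tau_eq smooth_mult partial_cmult smooth_differentiable algebra_simps)
  ultimately show ?thesis by (auto simp: linop_def tau_test)
qed

lemma linop_aff: "linop (aff s a j)"
  unfolding linop_def
proof (intro conjI ballI allI)
  fix f g :: "real^'a \<Rightarrow> complex" and c assume f: "f \<in> tests" and g: "g \<in> tests"
  show "aff s a j (\<lambda>x. f x + g x) = (\<lambda>x. aff s a j f x + aff s a j g x)"
    using linopD(2)[OF linop_tau f g, of j] by (simp add: aff_def algebra_simps)
next
  fix f :: "real^'a \<Rightarrow> complex" and c assume f: "f \<in> tests"
  show "aff s a j (\<lambda>x. c * f x) = (\<lambda>x. c * aff s a j f x)"
    using linopD(3)[OF linop_tau f, of j c] by (simp add: aff_def algebra_simps)
qed (rule aff_test)

lemma linop_mult: "smooth w \<Longrightarrow> linop (\<lambda>f x. w x * f x)"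
  by (auto simp: linop_def test_mult ring_distribs)

lemma aff_commute:
  assumes f: "f \<in> tests" shows "aff s a i (aff t b j f) = aff t b j (aff s a i f)"
proof -
  have T: "tau i (aff t b j f) = (\<lambda>x. t * tau i (tau j f) x + b j * tau i f x)" for i j t b
    unfolding aff_def using f
    by (simp add: linopD(2)[OF linop_tau] linopD(3)[OF linop_tau] test_cmult tau_test)
  show ?thesis
    unfolding aff_def[of s a i "aff t b j f"] aff_def[of t b j "aff s a i f"] T
      tau_commute[OF test_functionsD(1)[OF f], of i j]
    by (simp add: aff_def algebra_simps)
qed

lemma ip_coord:
  "ip (\<lambda>x. of_real (x $ j) * f x) g = ip f (\<lambda>x. of_real (x $ j) * g x)"
  by (simp add: ip_def ac_simps)

lemma ip_tau:
  assumes "f \<in> tests" "g \<in> tests"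
  shows "ip (tau j f) g = ip f (\<lambda>x. - 1 * tau j g x + (- 1) * g x)"
proof -
  have "ip (tau j f) g = - ip (partial j (\<lambda>x. of_real (x $ j) * f x)) g"
    using ip_cmult_left[of "partial j (\<lambda>x. of_real (x $ j) * f x)" g "-1"] assms
    by (simp add: tau_def test_partial test_mult)
  also have "\<dots> = ip (\<lambda>x. of_real (x $ j) * f x) (partial j g)"
    using assms by (simp add: ip_partial test_mult)
  also have "\<dots> = ip f (\<lambda>x. of_real (x $ j) * partial j g x)"
    by (rule ip_coord)
  also have "(\<lambda>x. of_real (x $ j) * partial j g x) = (\<lambda>x. - 1 * tau j g x + (- 1) * g x)"
    using tau_eq[of g j] assms by (auto simp: test_functionsD)
  finally show ?thesis .
qed

lemma ip_aff:
  assumes "f \<in> tests" "g \<in> tests"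
  shows "ip (aff s a j f) g = ip f (aff (- s) (\<lambda>j. a j - s) j g)"
proof -
  let ?t = "tau j f" and ?u = "tau j g"
  note t = assms assms[THEN tau_test[of _ _ j]]
  have "ip ?t g = - ip f ?u - ip f g"
    unfolding ip_tau[OF assms]
    using t ip_add_right[of "\<lambda>x. - 1 * ?u x" "\<lambda>x. - 1 * g x" f] ip_cmult_right[of ?u f "-1"] ip_cmult_right[of g f "-1"]
      test_cmult[of ?u UNIV "-1"] test_cmult[of g UNIV "-1"] by simp
  then have A: "ip (aff s a j f) g = s * (- ip f ?u - ip f g) + a j * ip f g"
    unfolding aff_def using t by (subst ip_add_left) (auto simp: test_cmult ip_cmult_left)
  have B: "ip f (aff (- s) (\<lambda>j. a j - s) j g) = - s * ip f ?u + (a j - s) * ip f g"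
    unfolding aff_def using t by (subst ip_add_right) (auto simp: test_cmult ip_cmult_right simp del: of_real_minus)
  show ?thesis unfolding A B by (simp add: algebra_simps)
qed

section \<open>Normality of polynomials in the Euler operators\<close>

text \<open>\<open>fold\<close> composes in the order opposite to the \<open>foldr\<close> in
  \<open>theta_pow\<close>. Transposition reverses composition, so the two match exactly in
  \<open>theta_foldr\<close>.\<close>

definition mon :: "('n::{finite,linorder} \<Rightarrow> ((real, 'n) vec \<Rightarrow> complex) \<Rightarrow> (real, 'n) vec \<Rightarrow> complex) \<Rightarrow>
    ('n \<Rightarrow> nat) \<Rightarrow> ((real, 'n) vec \<Rightarrow> complex) \<Rightarrow> (real, 'n) vec \<Rightarrow> complex" where
  "mon L \<alpha> = fold (\<lambda>j. L j ^^ \<alpha> j) (sorted_list_of_set UNIV)"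

text \<open>A polynomial evaluated at a family of operators. Exponents \<open>A\<close> and
  coefficients \<open>p\<close> are kept apart, so that conjugated coefficients are just another
  function on the same \<open>A\<close>.\<close>

definition ev :: "('n::{finite,linorder} \<Rightarrow> ((real, 'n) vec \<Rightarrow> complex) \<Rightarrow> (real, 'n) vec \<Rightarrow> complex) \<Rightarrow>
    ('n \<Rightarrow>\<^sub>0 nat) set \<Rightarrow> (('n \<Rightarrow>\<^sub>0 nat) \<Rightarrow> complex) \<Rightarrow> ((real, 'n) vec \<Rightarrow> complex) \<Rightarrow> (real, 'n) vec \<Rightarrow> complex" where
  "ev L A p f = (\<lambda>x. \<Sum>\<alpha>\<in>A. p \<alpha> * mon L (Poly_Mapping.lookup \<alpha>) f x)"

lemma funpow_intertwine:
  assumes "\<And>f. f \<in> D \<Longrightarrow> L f \<in> D" "\<And>f. f \<in> D \<Longrightarrow> M (L f) = L' (M f)" "f \<in> D"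
  shows "(L ^^ n) f \<in> D \<and> M ((L ^^ n) f) = (L' ^^ n) (M f)"
  by (induction n) (use assms in auto)

lemma fold_intertwine:
  assumes "\<And>j f. f \<in> D \<Longrightarrow> L j f \<in> D" "\<And>j f. f \<in> D \<Longrightarrow> M (L j f) = L' j (M f)" "f \<in> D"
  shows "fold (\<lambda>j. L j ^^ \<alpha> j) js f \<in> D \<and>
    M (fold (\<lambda>j. L j ^^ \<alpha> j) js f) = fold (\<lambda>j. L' j ^^ \<alpha> j) js (M f)"
  using assms(3)
proof (induction js arbitrary: f)
  case (Cons j js)
  then show ?case using funpow_intertwine[of D "L j" M "L' j" f "\<alpha> j"] assms(1,2) by simp
qed simp

lemma mon_intertwine:
  assumes "\<And>j f. f \<in> D \<Longrightarrow> L j f \<in> D" "\<And>j f. f \<in> D \<Longrightarrow> M (L j f) = L' j (M f)" "f \<in> D"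
  shows "M (mon L \<alpha> f) = mon L' \<alpha> (M f)"
  unfolding mon_def using fold_intertwine[of D L M L' f \<alpha>] assms by blast

lemma mon_mem:
  assumes "\<And>j f. f \<in> D \<Longrightarrow> L j f \<in> D" "f \<in> D"
  shows "mon L \<alpha> f \<in> D"
  unfolding mon_def using fold_intertwine[of D L "\<lambda>f. f" L f \<alpha>] assms by blast

lemma linop_mon: "(\<And>j. linop (L j)) \<Longrightarrow> linop (mon L \<alpha>)"
  unfolding mon_def by (intro linop_fold linop_funpow)

lemma linop_ev: "(\<And>j. linop (L j)) \<Longrightarrow> linop (ev L A p)"
  unfolding ev_def by (intro linop_lincomb_op linop_mon)

lemma ev_intertwine:
  assumes L: "\<And>j. linop (L j)" and M: "linop M"
    and LM: "\<And>j f. f \<in> tests \<Longrightarrow> M (L j f) = L' j (M f)" and f: "f \<in> tests"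
  shows "M (ev L A p f) = ev L' A p (M f)"
proof -
  have "M (mon L \<alpha> f) = mon L' \<alpha> (M f)" for \<alpha>
    using LM f linopD(1)[OF L] by (intro mon_intertwine[of tests]) auto
  then show ?thesis
    unfolding ev_def using linop_lincomb[OF M, of A "\<lambda>\<alpha>. mon L (Poly_Mapping.lookup \<alpha>) f" p]
      linopD(1)[OF linop_mon[of L, OF L] f] by simp
qed

text \<open>Taking adjoints reverses the order of composition; commutativity of the
  \<open>L'\<close> restores it.\<close>

lemma fold_adjoint:
  assumes L: "\<And>j. linop (L j)" and L': "\<And>j. linop (L' j)"
    and adj: "\<And>j f g. f \<in> tests \<Longrightarrow> g \<in> tests \<Longrightarrow> ip (L j f) g = ip f (L' j g)"
    and com: "\<And>i j f. f \<in> tests \<Longrightarrow> L' i (L' j f) = L' j (L' i f)"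
    and fg: "f \<in> tests" "g \<in> tests"
  shows "ip (fold (\<lambda>j. L j ^^ \<alpha> j) js f) g = ip f (fold (\<lambda>j. L' j ^^ \<alpha> j) js g)"
  using fg
proof (induction js arbitrary: f g)
  case (Cons j js)
  have P: "ip ((L j ^^ n) f) g = ip f ((L' j ^^ n) g)" if "f \<in> tests" "g \<in> tests" for n f g
    using that
  proof (induction n arbitrary: f g)
    case (Suc n)
    have "ip ((L j ^^ Suc n) f) g = ip ((L j ^^ n) f) (L' j g)"
      using adj Suc.prems linopD(1)[OF linop_funpow[OF L[of j], of n]] by simp
    also have "\<dots> = ip f ((L' j ^^ n) (L' j g))"
      using Suc linopD(1)[OF L'[of j]] by simp
    finally show ?case by (simp add: funpow_swap1)
  qed simp
  have C: "(L' j ^^ \<alpha> j) (L' i f) = L' i ((L' j ^^ \<alpha> j) f)" if "f \<in> tests" for i f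
    using funpow_intertwine[of tests "L' j" "L' i" "L' j" f "\<alpha> j"] linopD(1)[OF L'] com that by simp
  have "ip (fold (\<lambda>j. L j ^^ \<alpha> j) (j # js) f) g = ip ((L j ^^ \<alpha> j) f) (fold (\<lambda>j. L' j ^^ \<alpha> j) js g)"
    using Cons linopD(1)[OF linop_funpow[OF L]] by simp
  also have "\<dots> = ip f ((L' j ^^ \<alpha> j) (fold (\<lambda>j. L' j ^^ \<alpha> j) js g))"
    using Cons.prems linopD(1)[OF linop_fold[of "\<lambda>j. L' j ^^ \<alpha> j", OF linop_funpow[OF L']]] by (intro P)
  also have "(L' j ^^ \<alpha> j) (fold (\<lambda>j. L' j ^^ \<alpha> j) js g) = fold (\<lambda>j. L' j ^^ \<alpha> j) js ((L' j ^^ \<alpha> j) g)"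
    using fold_intertwine[of tests L' "L' j ^^ \<alpha> j" L' g \<alpha> js] linopD(1)[OF L'] C Cons.prems by simp
  finally show ?case by simp
qed simp

lemma ev_adjoint:
  assumes L: "\<And>j. linop (L j)" and L': "\<And>j. linop (L' j)"
    and adj: "\<And>j f g. f \<in> tests \<Longrightarrow> g \<in> tests \<Longrightarrow> ip (L j f) g = ip f (L' j g)"
    and com: "\<And>i j f. f \<in> tests \<Longrightarrow> L' i (L' j f) = L' j (L' i f)"
    and fg: "f \<in> tests" "g \<in> tests"
  shows "ip (ev L A p f) g = ip f (ev L' A (\<lambda>\<alpha>. cnj (p \<alpha>)) g)"
proof -
  note m = linopD(1)[OF linop_mon[of L, OF L]] linopD(1)[OF linop_mon[of L', OF L']]
  have "ip (mon L \<alpha> f) g = ip f (mon L' \<alpha> g)" for \<alpha>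
    unfolding mon_def by (rule fold_adjoint[OF L L' adj com fg])
  then show ?thesis
    unfolding ev_def using fg m
    by (simp add: ip_sum_left ip_sum_right test_cmult ip_cmult_left ip_cmult_right)
qed

text \<open>\<open>?S\<close> is the adjoint of \<open>?R\<close> and commutes with it, so the
  squared norm of \<open>?R f\<close> is \<open>ip f (?S (?R f)) = ip f (?R (?S f))\<close>, which
  is the squared norm of \<open>?S f\<close>.\<close>

lemma nsq_ev_adjoint:
  assumes L: "\<And>j. linop (L j)" and L': "\<And>j. linop (L' j)"
    and adj: "\<And>j f g. f \<in> tests \<Longrightarrow> g \<in> tests \<Longrightarrow> ip (L j f) g = ip f (L' j g)"
    and comL: "\<And>i j f. f \<in> tests \<Longrightarrow> L i (L j f) = L j (L i f)"
    and comL': "\<And>i j f. f \<in> tests \<Longrightarrow> L' i (L' j f) = L' j (L' i f)"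
    and com: "\<And>i j f. f \<in> tests \<Longrightarrow> L i (L' j f) = L' j (L i f)"
    and f: "f \<in> tests"
  shows "nsq (ev L A p f) = nsq (ev L' A (\<lambda>\<alpha>. cnj (p \<alpha>)) f)"
proof -
  let ?R = "ev L A p" and ?S = "ev L' A (\<lambda>\<alpha>. cnj (p \<alpha>))"
  have adj': "ip (L' j f) g = ip f (L j g)" if "f \<in> tests" "g \<in> tests" for j f g
    using adj[OF that(2,1)] ip_cnj by metis
  have lin: "linop ?R" "linop ?S" using L L' by (auto intro: linop_ev)
  have "?S (L j f) = L j (?S f)" if "f \<in> tests" for j f
    by (rule ev_intertwine[OF L' L, symmetric]) (use com that in auto)
  then have comm: "?S (?R f) = ?R (?S f)"
    using lin f L by (intro ev_intertwine) auto
  have "of_real (nsq (?R f)) = ip (?R f) (?R f)" by (rule nsq_eq_ip)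
  also have "\<dots> = ip f (?S (?R f))"
    by (rule ev_adjoint[OF L L' adj comL' f linopD(1)[OF lin(1) f]])
  also have "\<dots> = ip f (?R (?S f))" by (simp add: comm)
  also have "\<dots> = ip (?S f) (?S f)"
    using ev_adjoint[OF L' L adj' comL f linopD(1)[OF lin(2) f], where A = A and p = "\<lambda>\<alpha>. cnj (p \<alpha>)"] by simp
  also have "\<dots> = of_real (nsq (?S f))" by (rule nsq_eq_ip[symmetric])
  finally show ?thesis by simp
qed

lemma nsq_ev_aff:
  assumes f: "f \<in> tests"
  shows "nsq (ev (aff s a) A p f) = nsq (ev (aff (- s) (\<lambda>j. a j - s)) A (\<lambda>\<alpha>. cnj (p \<alpha>)) f)"
proof (rule nsq_ev_adjoint)
  show "ip (aff s a j f) g = ip f (aff (- s) (\<lambda>j. a j - s) j g)" if "f \<in> tests" "g \<in> tests" for j f g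
    using that by (rule ip_aff)
qed (rule linop_aff | erule aff_commute | rule f)+

section \<open>Monomial weights and their effect on the Euler operators\<close>

text \<open>Natural exponents without absolute values make the weight smooth across the coordinate
  hyperplanes, so it maps test functions to test functions.\<close>

definition xpow :: "('n::finite \<Rightarrow> nat) \<Rightarrow> real ^ 'n \<Rightarrow> real" where
  "xpow \<gamma> x = (\<Prod>j\<in>UNIV. (x $ j) ^ \<gamma> j)"

lemma xpow_add: "xpow (\<lambda>j. \<gamma> j + \<delta> j) x = xpow \<gamma> x * xpow \<delta> x"
  by (simp add: xpow_def power_add prod.distrib)

lemma xpow_mult: "xpow (\<lambda>j. l * \<eta> j) x = xpow \<eta> x ^ l"
  by (simp add: xpow_def power_mult mult.commute[of l] prod_power_distrib)

lemma xpow_unit: "xpow (\<lambda>i. if i = j then 1 else 0) x = x $ j"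
proof -
  have "(\<Prod>i\<in>UNIV. (x $ i) ^ (if i = j then 1 else 0)) = (\<Prod>i\<in>UNIV. if i = j then x $ j else 1)"
    by (rule prod.cong) auto
  then show ?thesis unfolding xpow_def by simp
qed

abbreviation wt :: "('n::finite \<Rightarrow> nat) \<Rightarrow> (real ^ 'n \<Rightarrow> complex) \<Rightarrow> real ^ 'n \<Rightarrow> complex" where
  "wt \<gamma> f \<equiv> (\<lambda>x. complex_of_real (xpow \<gamma> x) * f x)"

lemma smooth_xpow: "smooth (\<lambda>x. of_real (xpow \<gamma> x))"
  unfolding xpow_def by (simp add: of_real_prod) (intro smooth_prod smooth_power smooth_coord)

lemma euler_coord_power:
  "of_real (x $ j) * partial j (\<lambda>x. of_real (x $ i) ^ n) x =
    (if i = j then of_nat n * of_real (x $ i) ^ n else 0)"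
proof (induction n)
  case (Suc n)
  have "partial j (\<lambda>x. of_real (x $ i) * of_real (x $ i) ^ n) x =
     (if i = j then 1 else 0) * of_real (x $ i) ^ n + of_real (x $ i) * partial j (\<lambda>x. of_real (x $ i) ^ n) x"
    by (subst partial_mult) (auto simp: partial_coord intro!: smooth_differentiable)
  then show ?case using Suc by (auto simp: algebra_simps)
qed simp

lemma euler_prod:
  "of_real (x $ j) * partial j (\<lambda>x. \<Prod>i\<in>I. of_real (x $ i) ^ \<gamma> i) x =
    (if j \<in> I \<and> finite I then of_nat (\<gamma> j) else 0) * (\<Prod>i\<in>I. of_real (x $ i) ^ \<gamma> i)"
proof (induction I rule: infinite_finite_induct)
  case (insert i I)
  have "partial j (\<lambda>x. of_real (x $ i) ^ \<gamma> i * (\<Prod>i\<in>I. of_real (x $ i) ^ \<gamma> i)) x =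
     partial j (\<lambda>x. of_real (x $ i) ^ \<gamma> i) x * (\<Prod>i\<in>I. of_real (x $ i) ^ \<gamma> i) +
     of_real (x $ i) ^ \<gamma> i * partial j (\<lambda>x. \<Prod>i\<in>I. of_real (x $ i) ^ \<gamma> i) x"
    by (rule partial_mult; rule smooth_differentiable; intro smooth_prod smooth_power smooth_coord)
  then have "of_real (x $ j) * partial j (\<lambda>x. of_real (x $ i) ^ \<gamma> i * (\<Prod>i\<in>I. of_real (x $ i) ^ \<gamma> i)) x =
     (of_real (x $ j) * partial j (\<lambda>x. of_real (x $ i) ^ \<gamma> i) x) * (\<Prod>i\<in>I. of_real (x $ i) ^ \<gamma> i) +
     of_real (x $ i) ^ \<gamma> i * (of_real (x $ j) * partial j (\<lambda>x. \<Prod>i\<in>I. of_real (x $ i) ^ \<gamma> i) x)"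
    by (simp add: algebra_simps)
  then show ?case using insert by (auto simp: euler_coord_power insert.IH)
qed simp_all

text \<open>Monomials are eigenfunctions of \<open>x_j \<partial>_j\<close>. Keeping the factor
  \<open>x_j\<close> in the statement avoids the exponent \<open>\<gamma> j - 1\<close> and a case
  distinction at \<open>\<gamma> j = 0\<close>.\<close>

lemma euler_xpow:
  "of_real (x $ j) * partial j (\<lambda>x. of_real (xpow \<gamma> x)) x = of_nat (\<gamma> j) * of_real (xpow \<gamma> x)"
  using euler_prod[where I = UNIV and x = x and j = j and \<gamma> = \<gamma>] by (simp add: xpow_def of_real_prod)

lemma aff_xpow:
  assumes f: "f \<in> tests"
  shows "wt \<gamma> (aff s a j f) =
    aff s (\<lambda>j. a j + s * real (\<gamma> j)) j (wt \<gamma> f)"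
proof
  fix x
  have sf: "smooth f" using f by (rule test_functionsD)
  have "of_real (x $ j) * partial j (wt \<gamma> f) x =
    (of_real (x $ j) * partial j (\<lambda>x. of_real (xpow \<gamma> x)) x) * f x
     + of_real (xpow \<gamma> x) * (of_real (x $ j) * partial j f x)"
    by (subst partial_mult) (auto simp: algebra_simps intro!: smooth_differentiable smooth_xpow sf)
  then show "of_real (xpow \<gamma> x) * aff s a j f x =
     aff s (\<lambda>j. a j + s * real (\<gamma> j)) j (wt \<gamma> f) x"
    by (simp add: aff_def tau_eq sf smooth_mult smooth_xpow euler_xpow algebra_simps)
qed

lemma ev_xpow:
  assumes f: "f \<in> tests"
  shows "(wt \<gamma> (ev (aff s a) A p f)) =
    ev (aff s (\<lambda>j. a j + s * real (\<gamma> j))) A p (wt \<gamma> f)"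
  by (rule ev_intertwine[of "aff s a" "\<lambda>f x. of_real (xpow \<gamma> x) * f x"])
    (auto simp: linop_aff linop_mult smooth_xpow aff_xpow f)

text \<open>The substitute for Plancherel's theorem: the operators involved are normal, and each
  weight \<open>x\<^sup>\<gamma>\<close> turns the same polynomial into a different reflected translate.\<close>

lemma nsq_reflection:
  assumes f: "f \<in> tests"
  shows "nsq (wt \<gamma> (ev (aff 1 c) A p f)) =
    nsq (wt \<gamma> (ev (aff (- 1) (\<lambda>j. c j - 1 + 2 * real (\<gamma> j))) A (\<lambda>\<alpha>. cnj (p \<alpha>)) f))"
proof -
  let ?f = "\<lambda>x. of_real (xpow \<gamma> x) * f x"
  have "?f \<in> tests" by (intro test_mult f smooth_xpow)
  \<comment> \<open>Passing the weight inside adds \<open>\<gamma>\<close>, the adjoint subtracts 1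
    and flips the sign of \<open>s\<close>, and passing the weight back out with
    \<open>s = - 1\<close> adds \<open>\<gamma>\<close> again: hence the factor 2.\<close>
  have e: "(\<lambda>j. c j - 1 + 2 * real (\<gamma> j) + - 1 * real (\<gamma> j)) = (\<lambda>j. c j + 1 * real (\<gamma> j) - 1)" by auto
  show ?thesis
    unfolding ev_xpow[OF f] e by (rule nsq_ev_aff) fact
qed

section \<open>The weighted \<open>L\<^sup>2\<close> estimate\<close>

text \<open>Polynomial dependence on the index \<open>i\<close>, of degree at most \<open>n\<close>,
  with test functions as coefficients. Only the coefficient \<open>h\<close> of \<open>i^n\<close>
  is recorded, since it is all that a finite difference of order \<open>n\<close> retains.\<close>

definition polyseq :: "nat \<Rightarrow> (nat \<Rightarrow> real ^ 'n::finite \<Rightarrow> complex) \<Rightarrow> (real ^ 'n \<Rightarrow> complex) \<Rightarrow> bool" where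
  "polyseq n G h \<longleftrightarrow> (\<exists>g. (\<forall>l. g l \<in> tests) \<and> g n = h \<and> (\<forall>i. G i = (\<lambda>x. \<Sum>l\<le>n. of_nat i ^ l * g l x)))"

lemma polyseq_const: "f \<in> tests \<Longrightarrow> polyseq 0 (\<lambda>i. f) f"
  unfolding polyseq_def by (rule exI[of _ "\<lambda>l. f"]) simp

text \<open>A shift affine in \<open>i\<close> raises the degree by one: the part
  \<open>i * w j\<close> multiplies the top coefficient by \<open>w j\<close>, while the part
  \<open>b\<close> contributes to lower powers only.\<close>

lemma polyseq_aff:
  assumes "polyseq n G h"
  shows "polyseq (Suc n) (\<lambda>i. aff s (\<lambda>j. b j + real i * w j) j (G i)) (\<lambda>x. of_real (w j) * h x)"
proof -
  from assms obtain g where g: "\<And>l. g l \<in> tests" "g n = h" "\<And>i. G i = (\<lambda>x. \<Sum>l\<le>n. of_nat i ^ l * g l x)"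
    unfolding polyseq_def by blast
  define T where "T = aff s b j"
  \<comment> \<open>Coefficient \<open>l\<close> collects \<open>T\<close> of the old coefficient
    \<open>l\<close> and \<open>w j\<close> times the old coefficient \<open>l - 1\<close>; the
    conditionals cover the ends \<open>l = Suc n\<close> and \<open>l = 0\<close>.\<close>
  define g' where "g' l = (\<lambda>x. (if l \<le> n then T (g l) x else 0) + of_real (w j) * (if l = 0 then 0 else g (l - 1) x))" for l
  have T: "T f \<in> tests" if "f \<in> tests" for f using that by (simp add: T_def aff_test)
  show ?thesis unfolding polyseq_def
  proof (intro exI[of _ g'] conjI allI)
    show "g' l \<in> tests" for l
      unfolding g'_def using g(1) T test_zero[of UNIV]
      by (intro test_add test_cmult) (cases "l \<le> n"; cases "l = 0"; simp)+
    show "g' (Suc n) = (\<lambda>x. of_real (w j) * h x)" by (simp add: g'_def g(2))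
    fix i
    have "T (G i) = (\<lambda>x. \<Sum>l\<le>n. of_nat i ^ l * T (g l) x)"
      unfolding g(3) T_def by (rule linop_lincomb[OF linop_aff g(1)])
    moreover have "aff s (\<lambda>j. b j + real i * w j) j (G i) = (\<lambda>x. T (G i) x + of_nat i * of_real (w j) * G i x)"
      by (simp add: T_def aff_def algebra_simps)
    ultimately have "aff s (\<lambda>j. b j + real i * w j) j (G i) =
      (\<lambda>x. (\<Sum>l\<le>n. of_nat i ^ l * T (g l) x) + of_nat i * of_real (w j) * (\<Sum>l\<le>n. of_nat i ^ l * g l x))"
      by (simp add: g(3))
    also have "\<dots> = (\<lambda>x. \<Sum>l\<le>Suc n. of_nat i ^ l * g' l x)"
    proof
      fix x
      have "(\<Sum>l\<le>Suc n. of_nat i ^ l * g' l x) = (\<Sum>l\<le>Suc n. of_nat i ^ l * (if l \<le> n then T (g l) x else 0))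
        + of_real (w j) * (\<Sum>l\<le>Suc n. of_nat i ^ l * (if l = 0 then 0 else g (l - 1) x))"
        by (simp only: g'_def sum.distrib sum_distrib_left ring_distribs mult.left_commute)
      also have "(\<Sum>l\<le>Suc n. of_nat i ^ l * (if l \<le> n then T (g l) x else 0)) = (\<Sum>l\<le>n. of_nat i ^ l * T (g l) x)"
        by simp
      also have "(\<Sum>l\<le>Suc n. of_nat i ^ l * (if l = 0 then 0 else g (l - 1) x)) = of_nat i * (\<Sum>l\<le>n. of_nat i ^ l * g l x)"
        by (subst sum.atMost_Suc_shift) (simp add: sum_distrib_left mult.assoc)
      finally show "(\<Sum>l\<le>n. of_nat i ^ l * T (g l) x) + of_nat i * of_real (w j) * (\<Sum>l\<le>n. of_nat i ^ l * g l x)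
        = (\<Sum>l\<le>Suc n. of_nat i ^ l * g' l x)" by (simp add: algebra_simps)
    qed
    finally show "aff s (\<lambda>j. b j + real i * w j) j (G i) = (\<lambda>x. \<Sum>l\<le>Suc n. of_nat i ^ l * g' l x)" .
  qed
qed

lemma polyseq_funpow:
  assumes "polyseq n G h"
  shows "polyseq (k + n) (\<lambda>i. (aff s (\<lambda>j. b j + real i * w j) j ^^ k) (G i)) (\<lambda>x. of_real (w j ^ k) * h x)"
proof (induction k)
  case (Suc k)
  from polyseq_aff[OF this, of s b w j] show ?case by (simp add: mult.assoc)
qed (use assms in simp)

lemma polyseq_fold:
  assumes "polyseq n G h"
  shows "polyseq (sum_list (map \<alpha> js) + n) (\<lambda>i. fold (\<lambda>j. aff s (\<lambda>j. b j + real i * w j) j ^^ \<alpha> j) js (G i))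
    (\<lambda>x. of_real (prod_list (map (\<lambda>j. w j ^ \<alpha> j) js)) * h x)"
  using assms
proof (induction js arbitrary: n G h)
  case (Cons j js)
  from Cons.IH[OF polyseq_funpow[OF Cons.prems, of "\<alpha> j" s b w j]]
  show ?case by (simp add: ac_simps)
qed simp

lemma polyseq_mon:
  assumes f: "f \<in> tests"
  shows "polyseq (sum \<alpha> UNIV) (\<lambda>i. mon (aff s (\<lambda>j. b j + real i * w j)) \<alpha> f)
    (\<lambda>x. of_real (\<Prod>j\<in>UNIV. w j ^ \<alpha> j) * f x)"
  using polyseq_fold[OF polyseq_const[OF f], of \<alpha> "sorted_list_of_set UNIV" s b w]
  by (simp add: mon_def sum_list_distinct_conv_sum_set prod.distinct_set_conv_list[symmetric] del: of_real_prod)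

lemma polyseq_raise:
  assumes "polyseq n G h" "n < m" shows "polyseq m G (\<lambda>x. 0)"
proof -
  from assms(1) obtain g where g: "\<And>l. g l \<in> tests" "g n = h" "\<And>i. G i = (\<lambda>x. \<Sum>l\<le>n. of_nat i ^ l * g l x)"
    unfolding polyseq_def by blast
  show ?thesis unfolding polyseq_def
  proof (intro exI[of _ "\<lambda>l. if l \<le> n then g l else (\<lambda>x. 0)"] conjI allI)
    fix i
    have "(\<Sum>l\<le>n. of_nat i ^ l * g l x) = (\<Sum>l\<le>m. of_nat i ^ l * (if l \<le> n then g l else (\<lambda>x. 0)) x)" for x
      using assms(2) by (intro sum.mono_neutral_cong_left) auto
    then show "G i = (\<lambda>x. \<Sum>l\<le>m. of_nat i ^ l * (if l \<le> n then g l else (\<lambda>x. 0)) x)"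
      by (simp add: g(3))
  qed (use assms(2) g(1) test_zero[of UNIV] in auto)
qed

lemma polyseq_lincomb:
  assumes "\<And>\<alpha>. \<alpha> \<in> A \<Longrightarrow> polyseq m (G \<alpha>) (h \<alpha>)"
  shows "polyseq m (\<lambda>i x. \<Sum>\<alpha>\<in>A. p \<alpha> * G \<alpha> i x) (\<lambda>x. \<Sum>\<alpha>\<in>A. p \<alpha> * h \<alpha> x)"
proof -
  from assms have "\<forall>\<alpha>\<in>A. \<exists>g. (\<forall>l. g l \<in> tests) \<and> g m = h \<alpha> \<and> (\<forall>i. G \<alpha> i = (\<lambda>x. \<Sum>l\<le>m. of_nat i ^ l * g l x))"
    unfolding polyseq_def by blast
  from bchoice[OF this] obtain g where g: "\<And>\<alpha> l. \<alpha> \<in> A \<Longrightarrow> g \<alpha> l \<in> tests" "\<And>\<alpha>. \<alpha> \<in> A \<Longrightarrow> g \<alpha> m = h \<alpha>"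
    "\<And>\<alpha> i. \<alpha> \<in> A \<Longrightarrow> G \<alpha> i = (\<lambda>x. \<Sum>l\<le>m. of_nat i ^ l * g \<alpha> l x)"
    by auto
  show ?thesis unfolding polyseq_def
  proof (intro exI[of _ "\<lambda>l x. \<Sum>\<alpha>\<in>A. p \<alpha> * g \<alpha> l x"] conjI allI)
    fix i
    have "(\<Sum>\<alpha>\<in>A. p \<alpha> * G \<alpha> i x) = (\<Sum>l\<le>m. of_nat i ^ l * (\<Sum>\<alpha>\<in>A. p \<alpha> * g \<alpha> l x))" for x
      by (simp add: g(3) sum_distrib_left mult.left_commute) (rule sum.swap)
    then show "(\<lambda>x. \<Sum>\<alpha>\<in>A. p \<alpha> * G \<alpha> i x) = (\<lambda>x. \<Sum>l\<le>m. of_nat i ^ l * (\<Sum>\<alpha>\<in>A. p \<alpha> * g \<alpha> l x))" by blast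
  qed (auto intro!: test_sum test_cmult g(1) simp: g(2) cong: sum.cong)
qed

text \<open>Terms of degree below \<open>m\<close> have coefficient 0 at \<open>i^m\<close>, so only
  the homogeneous part of degree \<open>m\<close>, evaluated at \<open>w\<close>, survives. The base
  shift \<open>b\<close> is absent from it: this is the origin of the uniformity in \<open>c\<close>
  and \<open>\<eta>\<close>.\<close>

lemma polyseq_ev:
  assumes f: "f \<in> tests" and m: "\<And>\<alpha>. \<alpha> \<in> A \<Longrightarrow> sum (Poly_Mapping.lookup \<alpha>) UNIV \<le> m" and A: "finite A"
  shows "polyseq m (\<lambda>i. ev (aff s (\<lambda>j. b j + real i * w j)) A p f)
    (\<lambda>x. (\<Sum>\<alpha>\<in>{\<alpha>\<in>A. sum (Poly_Mapping.lookup \<alpha>) UNIV = m}. p \<alpha> * of_real (\<Prod>j\<in>UNIV. w j ^ Poly_Mapping.lookup \<alpha> j)) * f x)"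
proof -
  have "polyseq m (\<lambda>i. mon (aff s (\<lambda>j. b j + real i * w j)) (Poly_Mapping.lookup \<alpha>) f)
    (\<lambda>x. (if sum (Poly_Mapping.lookup \<alpha>) UNIV = m then of_real (\<Prod>j\<in>UNIV. w j ^ Poly_Mapping.lookup \<alpha> j) * f x else 0))"
    if "\<alpha> \<in> A" for \<alpha>
    using polyseq_mon[OF f, of "Poly_Mapping.lookup \<alpha>" s b w]
      polyseq_raise[OF polyseq_mon[OF f, of "Poly_Mapping.lookup \<alpha>" s b w], of m] m[OF that]
    by (cases "sum (Poly_Mapping.lookup \<alpha>) UNIV = m") auto
  note * = this
  have e: "(\<lambda>x. (\<Sum>\<alpha>\<in>{\<alpha>\<in>A. sum (Poly_Mapping.lookup \<alpha>) UNIV = m}. p \<alpha> * of_real (\<Prod>j\<in>UNIV. w j ^ Poly_Mapping.lookup \<alpha> j)) * f x)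
    = (\<lambda>x. \<Sum>\<alpha>\<in>A. p \<alpha> * (if sum (Poly_Mapping.lookup \<alpha>) UNIV = m then of_real (\<Prod>j\<in>UNIV. w j ^ Poly_Mapping.lookup \<alpha> j) * f x else 0))"
    using A by (simp add: sum_distrib_right if_distrib mult.assoc sum.If_cases Int_def conj_commute cong: if_cong)
  show ?thesis unfolding e ev_def by (rule polyseq_lincomb) (rule *)
qed

section \<open>Finite differences and nonvanishing at natural points\<close>

text \<open>The functional is the \<open>m\<close>-th forward difference at 0 divided by
  \<open>m!\<close>, which kills lower powers and sends \<open>i^m\<close> to 1.\<close>

lemma leading_coefficient_functional:
  "\<exists>c :: nat \<Rightarrow> real. \<forall>l\<le>m. (\<Sum>i\<le>m. c i * real i ^ l) = (if l = m then 1 else 0)"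
proof (induction m)
  case 0
  show ?case by (rule exI[of _ "\<lambda>i. 1"]) simp
next
  case (Suc m)
  then obtain c where c: "\<And>l. l \<le> m \<Longrightarrow> (\<Sum>i\<le>m. c i * real i ^ l) = (if l = m then 1 else 0)" by blast
  \<comment> \<open>One more difference: the shifted functional minus the unshifted one, divided by
    \<open>Suc m\<close>.\<close>
  define c' where "c' i = ((if i = 0 then 0 else c (i - 1)) - (if i \<le> m then c i else 0)) / real (Suc m)" for i
  have *: "(\<Sum>i\<le>Suc m. c' i * u i) = (\<Sum>i\<le>m. c i * (u (Suc i) - u i)) / real (Suc m)" for u :: "nat \<Rightarrow> real"
  proof -
    have "(\<Sum>i\<le>Suc m. c' i * u i) = ((\<Sum>i\<le>Suc m. (if i = 0 then 0 else c (i - 1)) * u i)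
      - (\<Sum>i\<le>Suc m. (if i \<le> m then c i else 0) * u i)) / real (Suc m)"
      unfolding c'_def sum_subtractf[symmetric] sum_divide_distrib by (simp add: algebra_simps diff_divide_distrib)
    also have "(\<Sum>i\<le>Suc m. (if i = 0 then 0 else c (i - 1)) * u i) = (\<Sum>i\<le>m. c i * u (Suc i))"
      by (subst sum.atMost_Suc_shift) simp
    also have "(\<Sum>i\<le>Suc m. (if i \<le> m then c i else 0) * u i) = (\<Sum>i\<le>m. c i * u i)" by simp
    finally show ?thesis by (simp add: right_diff_distrib sum_subtractf)
  qed
  show ?case
  proof (intro exI[of _ c'] allI impI)
    fix l assume l: "l \<le> Suc m"
    \<comment> \<open>Differencing lowers the degree by one. Among the powers
      \<open>r < l \<le> Suc m\<close> the functional \<open>c\<close> sees only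
      \<open>r = m\<close>, with coefficient \<open>Suc m\<close> when
      \<open>l = Suc m\<close>.\<close>
    have d: "real (Suc i) ^ l - real i ^ l = (\<Sum>r<l. real (l choose r) * real i ^ r)" for i
    proof -
      have "real (Suc i) ^ l = (real i + 1) ^ l" by (simp add: add.commute)
      also have "\<dots> = (\<Sum>r\<le>l. real (l choose r) * real i ^ r)" by (subst binomial_ring) simp
      also have "\<dots> = (\<Sum>r<l. real (l choose r) * real i ^ r) + real i ^ l"
        by (simp add: lessThan_Suc_atMost[symmetric])
      finally show ?thesis by simp
    qed
    have "(\<Sum>i\<le>Suc m. c' i * real i ^ l) = (\<Sum>i\<le>m. c i * (\<Sum>r<l. real (l choose r) * real i ^ r)) / real (Suc m)"
      unfolding * d ..
    also have "(\<Sum>i\<le>m. c i * (\<Sum>r<l. real (l choose r) * real i ^ r)) = (\<Sum>r<l. real (l choose r) * (\<Sum>i\<le>m. c i * real i ^ r))"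
      by (simp add: sum_distrib_left mult.left_commute) (rule sum.swap)
    also have "\<dots> = (\<Sum>r<l. real (l choose r) * (if r = m then 1 else 0))"
      by (rule sum.cong) (use c l in auto)
    also have "\<dots> = (if m < l then real (l choose m) else 0)"
      by (simp add: if_distrib cong: if_cong)
    finally show "(\<Sum>i\<le>Suc m. c' i * real i ^ l) = (if l = Suc m then 1 else 0)"
      using l by (auto simp: le_Suc_eq)
  qed
qed

text \<open>Induction on the variables: by the induction hypothesis the coefficient of one power of
  the new variable is nonzero at a suitable \<open>v\<close>, and a nonzero univariate polynomial
  has only finitely many roots among the naturals.\<close>

lemma multivariate_nonvanishing:
  fixes p :: "('n \<Rightarrow> nat) \<Rightarrow> complex"
  assumes "finite J" "finite B" "B \<noteq> {}" "\<And>\<alpha>. \<alpha> \<in> B \<Longrightarrow> p \<alpha> \<noteq> 0" "\<And>\<alpha> j. \<alpha> \<in> B \<Longrightarrow> j \<notin> J \<Longrightarrow> \<alpha> j = 0"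
  shows "\<exists>v :: 'n \<Rightarrow> nat. (\<Sum>\<alpha>\<in>B. p \<alpha> * of_nat (\<Prod>j\<in>J. v j ^ \<alpha> j)) \<noteq> 0"
  using assms
proof (induction J arbitrary: B p rule: finite_induct)
  case empty
  then have "\<And>\<alpha>. \<alpha> \<in> B \<Longrightarrow> \<alpha> = (\<lambda>j. 0)" by auto
  then have "B = {\<lambda>j. 0}" using empty by blast
  then show ?case using empty by auto
next
  case (insert j J)
  obtain \<beta> where \<beta>: "\<beta> \<in> B" using insert by blast
  define k where "k = \<beta> j"
  define Bk where "Bk = {\<alpha>\<in>B. \<alpha> j = k}"
  \<comment> \<open>The exponents in \<open>Bk\<close> agree at \<open>j\<close>, so erasing that
    entry is injective there.\<close>
  define r where "r \<alpha> = \<alpha>(j := 0::nat)" for \<alpha> :: "'n \<Rightarrow> nat"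
  have inj: "inj_on r Bk"
    by (rule inj_onI) (auto simp: Bk_def r_def fun_eq_iff split: if_splits, metis)
  have "\<exists>v :: 'n \<Rightarrow> nat. (\<Sum>\<alpha>\<in>r ` Bk. p (\<alpha>(j := k)) * of_nat (\<Prod>i\<in>J. v i ^ \<alpha> i)) \<noteq> 0"
  proof (rule insert.IH)
    show "p (\<alpha>(j := k)) \<noteq> 0" if a: "\<alpha> \<in> r ` Bk" for \<alpha>
    proof -
      obtain \<alpha>' where "\<alpha> = r \<alpha>'" "\<alpha>' \<in> Bk" using a by blast
      then have "\<alpha>(j := k) = \<alpha>'" by (auto simp: r_def Bk_def)
      then show ?thesis using \<open>\<alpha>' \<in> Bk\<close> insert.prems by (auto simp: Bk_def)
    qed
    show "\<alpha> i = 0" if "\<alpha> \<in> r ` Bk" "i \<notin> J" for \<alpha> i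
      using that insert.prems(4)[of _ i] by (cases "i = j") (auto simp: r_def Bk_def)
  qed (use insert \<beta> in \<open>auto simp: Bk_def k_def\<close>)
  then obtain v :: "'n \<Rightarrow> nat" where v: "(\<Sum>\<alpha>\<in>r ` Bk. p (\<alpha>(j := k)) * of_nat (\<Prod>i\<in>J. v i ^ \<alpha> i)) \<noteq> 0" by blast
  have vi: "(\<Prod>i\<in>J. v i ^ (r \<alpha>) i) = (\<Prod>i\<in>J. v i ^ \<alpha> i)" for \<alpha>
    using insert.hyps by (intro prod.cong) (auto simp: r_def)
  have "(\<Sum>\<alpha>\<in>r ` Bk. p (\<alpha>(j := k)) * of_nat (\<Prod>i\<in>J. v i ^ \<alpha> i)) =
      (\<Sum>\<alpha>\<in>Bk. p ((r \<alpha>)(j := k)) * of_nat (\<Prod>i\<in>J. v i ^ \<alpha> i))"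
    by (subst sum.reindex[OF inj]) (simp only: vi comp_def)
  also have "\<dots> = (\<Sum>\<alpha>\<in>Bk. p \<alpha> * of_nat (\<Prod>i\<in>J. v i ^ \<alpha> i))"
    by (rule sum.cong) (auto simp: r_def Bk_def)
  finally have ck: "(\<Sum>\<alpha>\<in>Bk. p \<alpha> * of_nat (\<Prod>i\<in>J. v i ^ \<alpha> i)) \<noteq> 0" using v by simp
  define q where "q = (\<Sum>\<alpha>\<in>B. monom (p \<alpha> * of_nat (\<Prod>i\<in>J. v i ^ \<alpha> i)) (\<alpha> j))"
  have "coeff q k = (\<Sum>\<alpha>\<in>Bk. p \<alpha> * of_nat (\<Prod>i\<in>J. v i ^ \<alpha> i))"
    using insert.prems(1) by (simp add: q_def coeff_sum Bk_def sum.inter_filter)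
  then have "q \<noteq> 0" using ck by auto
  then have "finite {x. poly q x = 0}" by (rule poly_roots_finite)
  then have "finite (of_nat -` {x. poly q x = 0} :: nat set)"
    by (rule finite_vimageI) (simp add: inj_of_nat)
  then obtain t :: nat where t: "poly q (of_nat t) \<noteq> 0"
    using infinite_UNIV_nat ex_new_if_finite by fastforce
  have "(\<Sum>\<alpha>\<in>B. p \<alpha> * of_nat (\<Prod>i\<in>insert j J. (v(j := t)) i ^ \<alpha> i)) = poly q (of_nat t)"
    unfolding q_def poly_sum
  proof (rule sum.cong)
    fix \<alpha> assume "\<alpha> \<in> B"
    have "(\<Prod>i\<in>J. (v(j := t)) i ^ \<alpha> i) = (\<Prod>i\<in>J. v i ^ \<alpha> i)"
      using insert.hyps by (intro prod.cong) auto
    then show "p \<alpha> * of_nat (\<Prod>i\<in>insert j J. (v(j := t)) i ^ \<alpha> i) =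
        poly (monom (p \<alpha> * of_nat (\<Prod>i\<in>J. v i ^ \<alpha> i)) (\<alpha> j)) (of_nat t)"
      using insert.hyps by (simp add: poly_monom mult.assoc)
  qed simp
  then show ?case using t by metis
qed

lemma xpow_mono_dominated:
  fixes x :: "real ^ 'n::finite"
  assumes "\<And>j. (1 \<le> \<bar>x $ j\<bar> \<and> \<gamma> j \<le> \<delta> j) \<or> (\<bar>x $ j\<bar> \<le> 1 \<and> \<delta> j \<le> \<gamma> j)"
  shows "\<bar>xpow \<gamma> x\<bar> \<le> \<bar>xpow \<delta> x\<bar>"
  unfolding xpow_def abs_prod power_abs
proof (rule prod_mono)
  fix j
  show "0 \<le> \<bar>x $ j\<bar> ^ \<gamma> j \<and> \<bar>x $ j\<bar> ^ \<gamma> j \<le> \<bar>x $ j\<bar> ^ \<delta> j"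
    using assms[of j] by (auto intro: power_increasing power_decreasing)
qed

text \<open>\<open>m\<close> is the degree of the polynomial and \<open>v\<close> a natural point
  where its conjugated top-degree part does not vanish. Both, and \<open>C\<close>, are fixed before
  \<open>c\<close>, \<open>f\<close> and \<open>\<eta>\<close>. The sum runs over all
  \<open>J\<close> because the coordinates whose exponents must be raised vary with the
  point.\<close>

theorem weighted_L2_estimate:
  fixes A :: "('n::{finite,linorder} \<Rightarrow>\<^sub>0 nat) set" and p :: "('n \<Rightarrow>\<^sub>0 nat) \<Rightarrow> complex"
  assumes A: "finite A" "A \<noteq> {}" and p: "\<And>\<alpha>. \<alpha> \<in> A \<Longrightarrow> p \<alpha> \<noteq> 0"
  obtains C :: real and m :: nat and v :: "'n \<Rightarrow> nat" where "C \<ge> 0"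
    "\<And>c f \<eta>. f \<in> tests \<Longrightarrow>
      nsq (wt (\<lambda>j. \<eta> j + m * v j) f) \<le>
      C * (\<Sum>J\<in>UNIV. \<Sum>i\<le>m. nsq (wt (\<lambda>j. \<eta> j + (if j \<in> J then m * v j else 0) + i * v j) (ev (aff 1 c) A p f)))"
proof -
  define deg where "deg \<alpha> = sum (Poly_Mapping.lookup \<alpha>) UNIV" for \<alpha> :: "'n \<Rightarrow>\<^sub>0 nat"
  define m where "m = Max (deg ` A)"
  have m: "deg \<alpha> \<le> m" if "\<alpha> \<in> A" for \<alpha> using A that by (simp add: m_def)
  define B where "B = {\<alpha>\<in>A. deg \<alpha> = m}"
  have B: "finite B" "B \<noteq> {}"
  proof -
    have "m \<in> deg ` A" unfolding m_def using A by (intro Max_in) auto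
    then show "finite B" "B \<noteq> {}" using A by (auto simp: B_def)
  qed
  have injl: "inj_on Poly_Mapping.lookup B" by (auto intro: inj_onI poly_mapping_eqI)
  have "\<exists>v :: 'n \<Rightarrow> nat. (\<Sum>\<alpha>\<in>Poly_Mapping.lookup ` B. cnj (p (Abs_poly_mapping \<alpha>)) * of_nat (\<Prod>j\<in>UNIV. v j ^ \<alpha> j)) \<noteq> 0"
    by (rule multivariate_nonvanishing) (use B p in \<open>auto simp: B_def\<close>)
  then obtain v :: "'n \<Rightarrow> nat" where v: "(\<Sum>\<alpha>\<in>B. cnj (p \<alpha>) * of_nat (\<Prod>j\<in>UNIV. v j ^ Poly_Mapping.lookup \<alpha> j)) \<noteq> 0"
    by (auto simp: sum.reindex[OF injl])
  \<comment> \<open>The coefficient of \<open>i^m\<close> in the reflected operators; the factor 2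
    stems from \<open>2 * \<gamma>\<close> in the reflection.\<close>
  define K where "K = (\<Sum>\<alpha>\<in>B. cnj (p \<alpha>) * of_real (\<Prod>j\<in>UNIV. (2 * real (v j)) ^ Poly_Mapping.lookup \<alpha> j))"
  have "(\<Prod>j\<in>UNIV. (2 * real (v j)) ^ Poly_Mapping.lookup \<alpha> j) = 2 ^ m * real (\<Prod>j\<in>UNIV. v j ^ Poly_Mapping.lookup \<alpha> j)"
    if "\<alpha> \<in> B" for \<alpha>
    using that power_sum[of "2::real" "Poly_Mapping.lookup \<alpha>" UNIV]
    by (simp add: B_def deg_def power_mult_distrib prod.distrib)
  then have "K = 2 ^ m * (\<Sum>\<alpha>\<in>B. cnj (p \<alpha>) * of_nat (\<Prod>j\<in>UNIV. v j ^ Poly_Mapping.lookup \<alpha> j))"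
    unfolding K_def sum_distrib_left by (intro sum.cong) (simp_all add: of_real_of_nat_eq del: of_nat_prod of_real_prod)
  then have K: "K \<noteq> 0" using v by simp
  obtain d :: "nat \<Rightarrow> real" where d: "\<And>l. l \<le> m \<Longrightarrow> (\<Sum>i\<le>m. d i * real i ^ l) = (if l = m then 1 else 0)"
    using leading_coefficient_functional[of m] by blast
  \<comment> \<open>Cauchy-Schwarz over the terms of the finite difference, with the leading
    coefficient divided out.\<close>
  define D where "D = (\<Sum>i\<le>m. (d i)\<^sup>2) / (norm K)\<^sup>2"
  let ?G = "\<lambda>c \<gamma> i f. ev (aff (- 1) (\<lambda>j. c j - 1 + 2 * real (\<gamma> j + i * v j))) A (\<lambda>\<alpha>. cnj (p \<alpha>)) f"
  have top_coeff: "K * f x = (\<Sum>i\<le>m. of_real (d i) * ?G c \<gamma> i f x)" if f: "f \<in> tests" for f c \<gamma> x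
  proof -
    have e: "(\<lambda>j. c j - 1 + 2 * real (\<gamma> j + i * v j)) = (\<lambda>j. (c j - 1 + 2 * real (\<gamma> j)) + real i * (2 * real (v j)))" for i
      by (auto simp: algebra_simps)
    have "polyseq m (\<lambda>i. ?G c \<gamma> i f) (\<lambda>x. K * f x)"
      unfolding e K_def B_def deg_def by (rule polyseq_ev[OF f _ A(1)]) (use m in \<open>auto simp: deg_def\<close>)
    then obtain g where g: "g m = (\<lambda>x. K * f x)" "\<And>i. ?G c \<gamma> i f = (\<lambda>x. \<Sum>l\<le>m. of_nat i ^ l * g l x)"
      unfolding polyseq_def by blast
    have "(\<Sum>i\<le>m. of_real (d i) * ?G c \<gamma> i f x) = (\<Sum>l\<le>m. of_real (\<Sum>i\<le>m. d i * real i ^ l) * g l x)"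
      unfolding g(2) by (simp add: sum_distrib_left sum_distrib_right mult.assoc) (rule sum.swap)
    also have "\<dots> = (\<Sum>l\<le>m. (if l = m then 1 else 0) * g l x)"
      by (rule sum.cong) (auto simp: d)
    also have "\<dots> = K * f x" by (simp add: g(1) if_distrib[of "\<lambda>c. c * _"] cong: if_cong)
    finally show ?thesis by simp
  qed
  show thesis
  proof (rule that[of D m v])
    show "D \<ge> 0" by (simp add: D_def sum_nonneg)
    fix c :: "'n \<Rightarrow> real" and f :: "(real, 'n) vec \<Rightarrow> complex" and \<eta> :: "'n \<Rightarrow> nat"
    assume f: "f \<in> tests"
    define \<gamma> where "\<gamma> J j = \<eta> j + (if j \<in> J then m * v j else 0)" for J j
    \<comment> \<open>Weight and operator carry the same exponent \<open>\<gamma> J + i v\<close>,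
      the form in which \<open>nsq_reflection\<close> applies.\<close>
    define H where "H J i = (wt (\<lambda>j. \<gamma> J j + i * v j) (?G c (\<gamma> J) i f))" for J i
    have H: "H J i \<in> tests" for J i
      unfolding H_def by (intro test_mult smooth_xpow linopD(1)[OF linop_ev] linop_aff f)
    let ?F = "\<lambda>x. of_real (xpow (\<lambda>j. \<eta> j + m * v j) x) * f x"
    have F: "?F \<in> tests" by (intro test_mult smooth_xpow f)
    have pw: "(norm (?F x))\<^sup>2 \<le> D * (\<Sum>J\<in>UNIV. \<Sum>i\<le>m. (norm (H J i x))\<^sup>2)" for x
    proof -
      \<comment> \<open>The weights \<open>\<eta> + i v\<close> with \<open>i \<le> m\<close> dominate \<open>\<eta> + m v\<close> only where \<open>\<bar>x\<^sub>j\<bar> \<le> 1\<close>;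
        in the other coordinates the base exponent is raised by \<open>m v\<close> first.\<close>
      define J where "J = {j. \<bar>x $ j\<bar> \<ge> 1}"
      have le: "\<bar>xpow (\<lambda>j. \<eta> j + m * v j) x\<bar> \<le> \<bar>xpow (\<lambda>j. \<gamma> J j + i * v j) x\<bar>" if "i \<le> m" for i
        by (rule xpow_mono_dominated) (use that in \<open>auto simp: J_def \<gamma>_def intro!: mult_right_mono\<close>)
      have "norm K * norm (?F x) = norm (\<Sum>i\<le>m. of_real (d i) * (of_real (xpow (\<lambda>j. \<eta> j + m * v j) x) * ?G c (\<gamma> J) i f x))"
        using arg_cong[OF top_coeff[OF f, of x c "\<gamma> J"], of "\<lambda>z. norm (of_real (xpow (\<lambda>j. \<eta> j + m * v j) x) * z)"]
        by (simp add: sum_distrib_left norm_mult mult.left_commute)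
      also have "\<dots> \<le> (\<Sum>i\<le>m. norm (of_real (d i) * (of_real (xpow (\<lambda>j. \<eta> j + m * v j) x) * ?G c (\<gamma> J) i f x)))"
        by (rule norm_sum)
      also have "\<dots> \<le> (\<Sum>i\<le>m. \<bar>d i\<bar> * norm (H J i x))"
        unfolding norm_mult norm_of_real H_def
        by (intro sum_mono mult_left_mono mult_right_mono le) auto
      finally have "(norm K * norm (?F x))\<^sup>2 \<le> (\<Sum>i\<le>m. \<bar>d i\<bar> * norm (H J i x))\<^sup>2"
        by (intro power_mono) auto
      also have "\<dots> \<le> (\<Sum>i\<le>m. (d i)\<^sup>2) * (\<Sum>i\<le>m. (norm (H J i x))\<^sup>2)"
        using Cauchy_Schwarz_ineq_sum[of "\<lambda>i. \<bar>d i\<bar>" "\<lambda>i. norm (H J i x)" "{..m}"] by simp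
      finally have "(norm (?F x))\<^sup>2 \<le> D * (\<Sum>i\<le>m. (norm (H J i x))\<^sup>2)"
        using K by (simp add: D_def power_mult_distrib field_simps)
      also have "\<dots> \<le> D * (\<Sum>J\<in>UNIV. \<Sum>i\<le>m. (norm (H J i x))\<^sup>2)"
        by (intro mult_left_mono \<open>D \<ge> 0\<close> member_le_sum[of J UNIV "\<lambda>J. \<Sum>i\<le>m. (norm (H J i x))\<^sup>2"] sum_nonneg) auto
      finally show ?thesis .
    qed
    have I: "integrable lborel (\<lambda>x. \<Sum>J\<in>UNIV. \<Sum>i\<le>m. (norm (H J i x))\<^sup>2)"
      by (intro Bochner_Integration.integrable_sum test_norm2_integrable H)
    have "nsq ?F \<le> (\<integral>x. D * (\<Sum>J\<in>UNIV. \<Sum>i\<le>m. (norm (H J i x))\<^sup>2) \<partial>lborel)"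
      unfolding nsq_def by (rule integral_mono[OF test_norm2_integrable[OF F] integrable_mult_right[OF I] pw])
    also have "\<dots> = D * (\<Sum>J\<in>UNIV. \<Sum>i\<le>m. nsq (H J i))"
      using H by (simp add: nsq_def Bochner_Integration.integral_sum Bochner_Integration.integrable_sum test_norm2_integrable)
    \<comment> \<open>The finite difference works pointwise on the reflected conjugate polynomial;
      only the integrated squares can be turned back into the original operator.\<close>
    also have "\<dots> = D * (\<Sum>J\<in>UNIV. \<Sum>i\<le>m. nsq (wt (\<lambda>j. \<eta> j + (if j \<in> J then m * v j else 0) + i * v j) (ev (aff 1 c) A p f)))"
      unfolding H_def nsq_reflection[OF f, symmetric] \<gamma>_def ..
    finally show "nsq ?F \<le> D * (\<Sum>J\<in>UNIV. \<Sum>i\<le>m. nsq (wt (\<lambda>j. \<eta> j + (if j \<in> J then m * v j else 0) + i * v j) (ev (aff 1 c) A p f)))" .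
  qed
qed

section \<open>Hardy and Sobolev inequalities with monomial weights\<close>

lemma nsq_add_scaled:
  assumes h: "h \<in> tests" and g: "g \<in> tests"
  shows "nsq (\<lambda>x. h x + of_real t * g x) = nsq h + 2 * t * Re (ip h g) + t\<^sup>2 * nsq g"
proof -
  let ?c = "of_real t"
  note cg = test_cmult[OF g, of ?c] and hcg = test_add[OF h test_cmult[OF g, of ?c]]
  have "of_real (nsq (\<lambda>x. h x + ?c * g x)) = ip h h + ?c * ip h g + ?c * (ip g h + ?c * ip g g)"
    unfolding nsq_eq_ip ip_add_left[OF h cg hcg] ip_add_right[OF h cg h] ip_cmult_left[OF g hcg]
      ip_add_right[OF h cg g] ip_cmult_right[OF g h] ip_cmult_right[OF g g] by simp
  from arg_cong[OF this, of Re] show ?thesis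
    by (simp add: nsq_eq_ip[symmetric] ip_cnj[of g h] power2_eq_square algebra_simps)
qed

text \<open>With \<open>g = x^\<eta> f\<close>, the function \<open>h\<close> equals
  \<open>- \<tau>_j g - a g\<close> for \<open>a = 1 + \<eta>_j\<close>, and the real part of
  \<open>ip (\<tau>_j g) g\<close> is minus half of \<open>nsq g\<close>. Hence
  \<open>Re (ip h g) \<le> - nsq g / 2\<close>, and expanding \<open>nsq (h + g / 2) \<ge> 0\<close>
  gives the constant 4 for every \<open>\<eta>\<close>.\<close>

lemma hardy_partial:
  assumes f: "f \<in> tests"
  shows "nsq (wt \<eta> f) \<le>
    4 * nsq (wt (\<lambda>i. \<eta> i + (if i = j then 1 else 0)) (partial j f))"
proof -
  have sf: "smooth f" using f by (rule test_functionsD)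
  define g where "g = (wt \<eta> f)"
  have g: "g \<in> tests" unfolding g_def by (intro test_mult smooth_xpow f)
  define h where "h = (wt (\<lambda>i. \<eta> i + (if i = j then 1 else 0)) (partial j f))"
  have h: "h \<in> tests" unfolding h_def by (intro test_mult smooth_xpow test_partial f)
  have xe: "xpow (\<lambda>i. \<eta> i + (if i = j then 1 else 0)) x = x $ j * xpow \<eta> x" for x
    by (simp add: xpow_add xpow_unit)
  define a where "a = 1 + real (\<eta> j)"
  have hg: "h = (\<lambda>x. (- 1) * tau j g x + (- of_real a) * g x)"
  proof
    fix x
    have "of_real (x $ j) * partial j g x =
      (of_real (x $ j) * partial j (\<lambda>x. of_real (xpow \<eta> x)) x) * f x
       + of_real (xpow \<eta> x) * (of_real (x $ j) * partial j f x)"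
      unfolding g_def by (subst partial_mult) (auto simp: algebra_simps intro!: smooth_differentiable smooth_xpow sf)
    then have "of_real (x $ j) * partial j g x = of_nat (\<eta> j) * g x + h x"
      unfolding euler_xpow by (simp add: h_def g_def xe mult.assoc)
    then show "h x = (- 1) * tau j g x + (- of_real a) * g x"
      using tau_eq[OF test_functionsD(1)[OF g], of j] by (simp add: a_def algebra_simps)
  qed
  let ?N = "nsq g"
  define z where "z = ip (tau j g) g"
  have tg: "tau j g \<in> tests" by (rule tau_test[OF g])
  have zz: "z = - cnj z - of_real ?N"
  proof -
    have "z = ip g (\<lambda>x. - 1 * tau j g x + (- 1) * g x)" unfolding z_def by (rule ip_tau[OF g g])
    also have "\<dots> = cnj (- 1) * ip g (tau j g) + cnj (- 1) * ip g g"
      using ip_add_right[OF test_cmult[OF tg] test_cmult[OF g] g, of "- 1" "- 1"]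
        ip_cmult_right[OF tg g, of "- 1"] ip_cmult_right[OF g g, of "- 1"] by simp
    also have "ip g (tau j g) = cnj z" unfolding z_def by (rule ip_cnj)
    finally show ?thesis by (simp add: nsq_eq_ip)
  qed
  have "Re z = - Re z - ?N" using arg_cong[OF zz, of Re] by simp
  then have Rez: "Re z = - ?N / 2" by simp
  have "ip h g = (- 1) * z + (- of_real a) * of_real ?N"
    unfolding hg using ip_add_left[OF test_cmult[OF tg] test_cmult[OF g] g, of "- 1" "- of_real a"]
      ip_cmult_left[OF tg g, of "- 1"] ip_cmult_left[OF g g, of "- of_real a"]
    by (simp add: z_def nsq_eq_ip)
  from arg_cong[OF this, of Re] have Rehg: "Re (ip h g) = (1/2 - a) * ?N" using Rez by (simp add: algebra_simps)
  have "nsq (\<lambda>x. h x + of_real (1/2) * g x) = nsq h + Re (ip h g) + ?N / 4"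
    unfolding nsq_add_scaled[OF h g] by (simp add: power2_eq_square)
  then have "0 \<le> nsq h + (1/2 - a) * ?N + ?N / 4" using nsq_nonneg[of "\<lambda>x. h x + of_real (1/2) * g x"] Rehg by simp
  moreover have "(1/2 - a) * ?N \<le> - ?N / 2"
    using nsq_nonneg[of g] mult_right_mono[of "1/2 - a" "- 1/2" ?N] by (simp add: a_def)
  ultimately have "?N \<le> 4 * nsq h" by simp
  then show ?thesis by (simp add: g_def h_def)
qed

text \<open>Each derivative in \<open>js\<close> buys one power of its coordinate at a factor 4;
  this absorbs the surplus weight of the \<open>L^2\<close> estimate.\<close>

lemma hardy_partials:
  assumes f: "f \<in> tests"
  shows "nsq (wt \<eta> f) \<le>
    4 ^ length js * nsq (wt (\<lambda>i. \<eta> i + count_list js i) (partials js f))"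
proof (induction js)
  case (Cons j js)
  have "nsq (wt (\<lambda>i. \<eta> i + count_list js i) (partials js f)) \<le>
    4 * nsq (wt (\<lambda>i. \<eta> i + count_list js i + (if i = j then 1 else 0)) (partial j (partials js f)))"
    by (rule hardy_partial) (rule test_partials[OF f])
  also have "(\<lambda>i. \<eta> i + count_list js i + (if i = j then 1 else 0)) = (\<lambda>i. \<eta> i + count_list (j # js) i)"
    by auto
  finally have *: "nsq (wt (\<lambda>i. \<eta> i + count_list js i) (partials js f)) \<le>
    4 * nsq (wt (\<lambda>i. \<eta> i + count_list (j # js) i) (partials (j # js) f))"
    by (simp only: partials_Cons)
  show ?case
    by (rule order_trans[OF Cons.IH]) (use mult_left_mono[OF *, of "4 ^ length js"] in simp)
qed simp

lemma exists_list_count: "\<exists>js. \<forall>j. count_list js j = (\<kappa> :: 'n::finite \<Rightarrow> nat) j"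
proof -
  have r: "count_list (replicate n i) j = (if i = j then n else 0)" for n and i j :: 'n
    by (induction n) auto
  have "\<exists>js. \<forall>j. count_list js j = (if j \<in> I then \<kappa> j else 0)" if "finite I" for I
    using that
  proof induction
    case (insert i I)
    then obtain js where "\<forall>j. count_list js j = (if j \<in> I then \<kappa> j else 0)" by blast
    then show ?case using insert.hyps
      by (intro exI[of _ "replicate (\<kappa> i) i @ js"]) (auto simp: r)
  qed (auto intro: exI[of _ "[]"])
  from this[of UNIV] show ?thesis by simp
qed

lemma partial_uminus: "f differentiable at x \<Longrightarrow> partial j (\<lambda>x. - f x) x = - partial j f x"
  using partial_cmult[of f x j "- 1"] by simp

lemma partial_aff:
  assumes f: "f \<in> tests"
  shows "partial i (aff 1 c j f) = aff 1 (\<lambda>j. c j - (if j = i then 1 else 0)) j (partial i f)"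
proof
  fix x
  have sf: "smooth f" using f by (rule test_functionsD)
  have e: "aff 1 c j f = (\<lambda>x. of_real (c j - 1) * f x + (- 1) * (of_real (x $ j) * partial j f x))"
    by (simp add: aff_def tau_eq[OF sf] algebra_simps)
  have s: "smooth (\<lambda>x. of_real (x $ j) * partial j f x)" by (intro smooth_mult smooth_coord smooth_partial sf)
  have "partial i (aff 1 c j f) x = of_real (c j - 1) * partial i f x +
     (- 1) * partial i (\<lambda>x. of_real (x $ j) * partial j f x) x"
    unfolding e by (subst partial_add) (simp_all add: smooth_differentiable s sf smooth_mult partial_cmult partial_uminus smooth_uminus)
  also have "partial i (\<lambda>x. of_real (x $ j) * partial j f x) x =
      (if j = i then partial j f x else 0) + of_real (x $ j) * partial j (partial i f) x"
    by (subst partial_mult) (auto simp: smooth_differentiable sf smooth_partial partial_coord partial_commute[OF sf, of i j])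
  finally have F: "partial i (aff 1 c j f) x = of_real (c j - 1) * partial i f x + (- 1) *
     ((if j = i then partial j f x else 0) + of_real (x $ j) * partial j (partial i f) x)" .
  show "partial i (aff 1 c j f) x = aff 1 (\<lambda>j. c j - (if j = i then 1 else 0)) j (partial i f) x"
    unfolding F by (simp add: aff_def tau_eq[OF smooth_partial[OF sf]] algebra_simps)
qed

lemma linop_partial: "linop (partial i)"
  unfolding linop_def
  by (auto simp: test_partial fun_eq_iff partial_add partial_cmult test_functionsD smooth_differentiable)

text \<open>A derivative passes the polynomial at the price of a unit shift in its own coordinate,
  so derivatives of \<open>P(\<tau>) f\<close> are covered by any estimate that is uniform in the
  shift.\<close>

lemma partials_ev:
  assumes f: "f \<in> tests"
  shows "partials js (ev (aff 1 c) A p f) = ev (aff 1 (\<lambda>j. c j - real (count_list js j))) A p (partials js f)"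
proof (induction js)
  case (Cons i js)
  have "partial i (ev (aff 1 (\<lambda>j. c j - real (count_list js j))) A p (partials js f)) =
     ev (aff 1 (\<lambda>j. c j - real (count_list js j) - (if j = i then 1 else 0))) A p (partial i (partials js f))"
    by (rule ev_intertwine[OF linop_aff linop_partial partial_aff test_partials[OF f]])
  moreover have "(\<lambda>j. c j - real (count_list js j) - (if j = i then 1 else 0)) = (\<lambda>j. c j - real (count_list (i # js) j))"
    by auto
  ultimately show ?case using Cons by (simp add: partials_Cons)
qed simp

section \<open>A Sobolev inequality with one derivative per coordinate\<close>

text \<open>Integrating a function of \<open>upd I x g\<close> over \<open>Pi\<^sub>M I\<close> is a
  partial integration with the other coordinates of \<open>x\<close> frozen.\<close>

definition upd :: "'n set \<Rightarrow> real ^ 'n::finite \<Rightarrow> ('n \<Rightarrow> real) \<Rightarrow> real ^ 'n" where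
  "upd I x g = (\<chi> i. if i \<in> I then g i else x $ i)"

lemma abs_xpow_mono: "(\<And>j. \<bar>x $ j\<bar> \<le> \<bar>y $ j\<bar>) \<Longrightarrow> \<bar>xpow \<eta> x\<bar> \<le> \<bar>xpow \<eta> y\<bar>"
  unfolding xpow_def abs_prod power_abs by (intro prod_mono) (auto intro: power_mono)

text \<open>The bound is stated with \<open>nn_integral\<close> so that the iteration over
  coordinates can use Tonelli, with measurability as the only side condition.\<close>

lemma norm_diff_le_nn_integral:
  fixes h k :: "real \<Rightarrow> complex"
  assumes "a \<le> b" "\<And>s. (h has_vector_derivative k s) (at s)" "continuous_on UNIV k"
  shows "ennreal (norm (h b - h a)) \<le> (\<integral>\<^sup>+s. ennreal (norm (k s)) * indicator {a..b} s \<partial>lborel)"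
proof -
  have c: "continuous_on {a..b} k" using assms(3) continuous_on_subset by blast
  have I: "integrable lborel (\<lambda>s. indicator {a..b} s *\<^sub>R k s)"
    by (rule borel_integrable_compact[OF _ c]) simp
  have "h b - h a = (\<integral>s. indicator {a..b} s *\<^sub>R k s \<partial>lborel)"
    by (rule integral_FTC_atLeastAtMost[symmetric, OF assms(1) _ c]) (rule has_vector_derivative_at_within[OF assms(2)])
  then have "ennreal (norm (h b - h a)) \<le> (\<integral>\<^sup>+s. ennreal (norm (indicator {a..b} s *\<^sub>R k s)) \<partial>lborel)"
    using integral_norm_bound_ennreal[OF I] by simp
  also have "\<dots> = (\<integral>\<^sup>+s. ennreal (norm (k s)) * indicator {a..b} s \<partial>lborel)"
    by (intro nn_integral_cong) (auto split: split_indicator)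
  finally show ?thesis .
qed

text \<open>Integrating away from the hyperplane \<open>y\<^sub>j = 0\<close> only meets points where \<open>\<bar>x\<^sup>\<eta>\<bar>\<close> is larger, so the
  monomial weight can be moved under the integral with constant 1.\<close>

lemma sobolev_one_variable:
  assumes f: "f \<in> tests"
  shows "ennreal (\<bar>xpow \<eta> y\<bar> * norm (f y)) \<le>
    (\<integral>\<^sup>+s. ennreal (\<bar>xpow \<eta> (upd {j} y (\<lambda>_. s))\<bar> * norm (partial j f (upd {j} y (\<lambda>_. s)))) \<partial>lborel)"
proof -
  define z where "z s = upd {j} y (\<lambda>_. s)" for s
  have z: "z s = (y - (y $ j) *\<^sub>R axis j 1) + s *\<^sub>R axis j 1" for s
    by (auto simp: z_def upd_def vec_eq_iff axis_def)
  have sf: "smooth f" using f by (rule test_functionsD)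
  have der: "((\<lambda>s. f (z s)) has_vector_derivative partial j f (z s)) (at s)" for s
    unfolding z by (rule line_has_vector_derivative[OF sf])
  have cz: "continuous_on UNIV z" unfolding z[abs_def] by (intro continuous_intros)
  have cont: "continuous_on UNIV (\<lambda>s. partial j f (z s))"
    by (rule continuous_on_compose2[OF smooth_continuous[OF smooth_partial[OF sf], of UNIV] cz]) auto
  obtain R where R: "\<And>x. x \<in> supp f \<Longrightarrow> norm x \<le> R"
    using compact_imp_bounded[OF test_functionsD(2)[OF f]] unfolding bounded_iff by auto
  define S where "S = max (R + 1) \<bar>y $ j\<bar>"
  have zero: "f (z s) = 0" if "\<bar>s\<bar> \<ge> S" for s
  proof -
    have "\<bar>s\<bar> \<le> norm (z s)" using component_le_norm_cart[of "z s" j] by (simp add: z_def upd_def)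
    then show ?thesis using R[of "z s"] that zero_outside_supp[of "z s" f] by (force simp: S_def)
  qed
  \<comment> \<open>The interval runs from \<open>y $ j\<close> away from 0 to a point beyond the
    support, so \<open>f\<close> vanishes at its far end.\<close>
  define a b where "a = (if y $ j \<ge> 0 then y $ j else - S)" and "b = (if y $ j \<ge> 0 then S else y $ j)"
  have ab: "a \<le> b" by (auto simp: a_def b_def S_def)
  have zy: "z (y $ j) = y" by (auto simp: z_def upd_def vec_eq_iff)
  have S: "0 \<le> S" by (auto simp: S_def)
  have fy: "norm (f y) = norm (f (z b) - f (z a))"
    using zero[of S] zero[of "- S"] zy S by (auto simp: a_def b_def)
  have "ennreal (\<bar>xpow \<eta> y\<bar> * norm (f y)) \<le>
     ennreal \<bar>xpow \<eta> y\<bar> * (\<integral>\<^sup>+s. ennreal (norm (partial j f (z s))) * indicator {a..b} s \<partial>lborel)"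
    unfolding fy using norm_diff_le_nn_integral[OF ab der cont] by (simp add: ennreal_mult mult_left_mono)
  also have "\<dots> = (\<integral>\<^sup>+s. ennreal \<bar>xpow \<eta> y\<bar> * (ennreal (norm (partial j f (z s))) * indicator {a..b} s) \<partial>lborel)"
    using borel_measurable_continuous_onI[OF cont] by (intro nn_integral_cmult[symmetric]) auto
  also have "\<dots> \<le> (\<integral>\<^sup>+s. ennreal (\<bar>xpow \<eta> (z s)\<bar> * norm (partial j f (z s))) \<partial>lborel)"
  proof (rule nn_integral_mono)
    fix s
    have "\<bar>xpow \<eta> y\<bar> \<le> \<bar>xpow \<eta> (z s)\<bar>" if "s \<in> {a..b}"
      using that by (intro abs_xpow_mono) (auto simp: z_def upd_def a_def b_def split: if_splits)
    then show "ennreal \<bar>xpow \<eta> y\<bar> * (ennreal (norm (partial j f (z s))) * indicator {a..b} s)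
        \<le> ennreal (\<bar>xpow \<eta> (z s)\<bar> * norm (partial j f (z s)))"
      by (auto split: split_indicator simp: ennreal_mult[symmetric] intro!: ennreal_leI mult_right_mono)
  qed
  finally show ?thesis by (simp add: z_def)
qed

lemma measurable_upd [measurable]: "upd I x \<in> borel_measurable (Pi\<^sub>M I (\<lambda>_. lborel))"
proof -
  have "(\<lambda>g. upd I x g \<bullet> b) \<in> borel_measurable (Pi\<^sub>M I (\<lambda>_. lborel))" if "b \<in> Basis" for b
  proof -
    obtain i where b: "b = axis i 1" using \<open>b \<in> Basis\<close> by (auto simp: Basis_vec_def)
    have *: "(\<lambda>g. upd I x g \<bullet> b) = (\<lambda>g. if i \<in> I then g i else x $ i)"
      by (auto simp: b upd_def inner_axis)
    show ?thesis unfolding * by (cases "i \<in> I") auto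
  qed
  then show ?thesis by (subst borel_measurable_euclidean_space) auto
qed

lemma continuous_on_xpow: "continuous_on S (xpow \<eta>)"
  unfolding xpow_def[abs_def] by (intro continuous_intros)

text \<open>Coordinates are freed one at a time: under the integral over \<open>set js\<close> the
  one-variable inequality is applied in the new direction \<open>j\<close>, and Tonelli merges the
  two integrals.\<close>

lemma sobolev_iterated:
  assumes "distinct js" "f \<in> tests"
  shows "ennreal (\<bar>xpow \<eta> x\<bar> * norm (f x)) \<le>
    (\<integral>\<^sup>+g. ennreal (\<bar>xpow \<eta> (upd (set js) x g)\<bar> * norm (partials js f (upd (set js) x g))) \<partial>(Pi\<^sub>M (set js) (\<lambda>_. lborel)))"
  using assms
proof (induction js)
  case Nil
  interpret product_sigma_finite "\<lambda>_. lborel :: real measure" by standard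
  have "upd {} x g = x" for g by (simp add: upd_def vec_eq_iff)
  then show ?case by (simp add: PiM_empty)
next
  case (Cons j js)
  interpret product_sigma_finite "\<lambda>_. lborel :: real measure" by standard
  let ?F = "\<lambda>js y. ennreal (\<bar>xpow \<eta> y\<bar> * norm (partials js f y))"
  have meas: "?F js \<in> borel_measurable borel" for js
    using borel_measurable_continuous_onI[OF continuous_on_xpow[of UNIV \<eta>]]
      borel_measurable_continuous_onI[OF smooth_continuous[OF smooth_partials[OF test_functionsD(1)[OF Cons.prems(2)]], of UNIV js]]
    by simp
  have "ennreal (\<bar>xpow \<eta> x\<bar> * norm (f x)) \<le> (\<integral>\<^sup>+g. ?F js (upd (set js) x g) \<partial>(Pi\<^sub>M (set js) (\<lambda>_. lborel)))"
    using Cons by simp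
  also have "\<dots> \<le> (\<integral>\<^sup>+g. \<integral>\<^sup>+s. ?F (j # js) (upd {j} (upd (set js) x g) (\<lambda>_. s)) \<partial>lborel \<partial>(Pi\<^sub>M (set js) (\<lambda>_. lborel)))"
    unfolding partials_Cons using Cons.prems(2) by (intro nn_integral_mono sobolev_one_variable test_partials)
  also have "\<dots> = (\<integral>\<^sup>+g. \<integral>\<^sup>+s. ?F (j # js) (upd (set (j # js)) x (g(j := s))) \<partial>lborel \<partial>(Pi\<^sub>M (set js) (\<lambda>_. lborel)))"
  proof -
    have "upd {j} (upd (set js) x g) (\<lambda>_. s) = upd (set (j # js)) x (g(j := s))" for g s
      using Cons.prems(1) by (auto simp: upd_def vec_eq_iff)
    then show ?thesis by simp
  qed
  also have "\<dots> = (\<integral>\<^sup>+g. ?F (j # js) (upd (set (j # js)) x g) \<partial>(Pi\<^sub>M (insert j (set js)) (\<lambda>_. lborel)))"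
    using Cons.prems(1) measurable_compose[OF measurable_upd[of "set (j # js)" x] meas[of "j # js"]]
    by (subst product_nn_integral_insert) auto
  finally show ?case by simp
qed

text \<open>The iterated estimate ends in a product measure over the index type; comparing volumes
  of boxes identifies it with Lebesgue measure on vectors.\<close>

lemma lborel_vec_eq: "(lborel :: (real ^ 'n::finite) measure) = distr (Pi\<^sub>M UNIV (\<lambda>_. lborel)) borel vec_lambda"
proof (rule lborel_eqI)
  interpret product_sigma_finite "\<lambda>_ :: 'n. lborel :: real measure" by standard
  have upd: "upd UNIV 0 = (vec_lambda :: ('n \<Rightarrow> real) \<Rightarrow> _)" by (auto simp: upd_def fun_eq_iff vec_eq_iff)
  have m: "(vec_lambda :: ('n \<Rightarrow> real) \<Rightarrow> _) \<in> borel_measurable (Pi\<^sub>M UNIV (\<lambda>_. lborel))"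
    using measurable_upd[of UNIV "0::real^'n"] unfolding upd .
  fix l u :: "real ^ 'n" assume lu: "\<And>b. b \<in> Basis \<Longrightarrow> l \<bullet> b \<le> u \<bullet> b"
  have le: "l $ i \<le> u $ i" for i using lu[of "axis i 1"] by (auto simp: inner_axis axis_in_Basis_iff)
  have "emeasure (distr (Pi\<^sub>M UNIV (\<lambda>_. lborel)) borel vec_lambda) (box l u) =
    emeasure (Pi\<^sub>M UNIV (\<lambda>_. lborel)) (vec_lambda -` box l u \<inter> space (Pi\<^sub>M UNIV (\<lambda>_. lborel)))"
    by (rule emeasure_distr[OF m]) simp
  also have "vec_lambda -` box l u \<inter> space (Pi\<^sub>M UNIV (\<lambda>_. lborel)) = Pi\<^sub>E UNIV (\<lambda>i. {l $ i<..<u $ i})"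
    by (auto simp: space_PiM mem_box_cart PiE_def Pi_iff extensional_def)
  also have "emeasure (Pi\<^sub>M UNIV (\<lambda>_. lborel)) \<dots> = (\<Prod>i\<in>UNIV. emeasure lborel {l $ i<..<u $ i})"
    by (rule emeasure_PiM) auto
  also have "\<dots> = (\<Prod>i\<in>UNIV. ennreal (u $ i - l $ i))" by (intro prod.cong) (auto simp: le)
  also have "\<dots> = ennreal (\<Prod>i\<in>UNIV. u $ i - l $ i)" by (rule prod_ennreal) (use le in auto)
  also have "(\<Prod>i\<in>UNIV. u $ i - l $ i) = (\<Prod>b\<in>Basis. (u - l) \<bullet> b)"
  proof -
    have B: "(Basis :: (real^'n) set) = (\<lambda>i. axis i 1) ` UNIV" by (auto simp: Basis_vec_def)
    have inj: "inj (\<lambda>i. axis i 1 :: real^'n)" by (auto intro!: injI simp: axis_eq_axis)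
    show ?thesis unfolding B by (subst prod.reindex[OF inj]) (simp add: inner_axis)
  qed
  finally show "emeasure (distr (Pi\<^sub>M UNIV (\<lambda>_. lborel)) borel vec_lambda) (box l u) = ennreal (\<Prod>b\<in>Basis. (u - l) \<bullet> b)" .
qed simp

lemma nn_integral_lborel_vec:
  fixes F :: "real ^ 'n::finite \<Rightarrow> ennreal"
  assumes "F \<in> borel_measurable borel"
  shows "(\<integral>\<^sup>+y. F y \<partial>lborel) = (\<integral>\<^sup>+g. F (upd UNIV x g) \<partial>(Pi\<^sub>M UNIV (\<lambda>_. lborel)))"
proof -
  have upd: "upd UNIV x = (vec_lambda :: ('n \<Rightarrow> real) \<Rightarrow> _)" for x by (auto simp: upd_def fun_eq_iff vec_eq_iff)
  show ?thesis
    unfolding upd by (subst lborel_vec_eq, subst nn_integral_distr) (use measurable_upd[of UNIV "0 :: real ^ 'n"] assms in \<open>auto simp: upd\<close>)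
qed

lemma sobolev:
  fixes f :: "real ^ 'n::finite \<Rightarrow> complex"
  assumes "distinct js" "set js = UNIV" "f \<in> tests"
  shows "ennreal (\<bar>xpow \<eta> x\<bar> * norm (f x)) \<le> (\<integral>\<^sup>+y. ennreal (\<bar>xpow \<eta> y\<bar> * norm (partials js f y)) \<partial>lborel)"
proof -
  have "(\<lambda>y. ennreal (\<bar>xpow \<eta> y\<bar> * norm (partials js f y))) \<in> borel_measurable borel"
    using borel_measurable_continuous_onI[OF continuous_on_xpow[of UNIV \<eta>]]
      borel_measurable_continuous_onI[OF smooth_continuous[OF smooth_partials[OF test_functionsD(1)[OF assms(3)]], of UNIV js]]
    by simp
  from nn_integral_lborel_vec[OF this] sobolev_iterated[OF assms(1,3), of \<eta> x] show ?thesis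
    unfolding assms(2) by simp
qed

section \<open>Passage from \<open>L^1\<close> to \<open>L^2\<close>\<close>

text \<open>A product weight suits both purposes: its inverse factors into integrable functions of
  one variable, and the product expands into squares of square-free monomials, so \<open>jw\<close>
  can be absorbed by monomial weights.\<close>

definition jw :: "real ^ 'n::finite \<Rightarrow> real" where
  "jw y = (\<Prod>j\<in>UNIV. 1 + (y $ j)\<^sup>2)"

lemma jw_ge_1: "1 \<le> jw y"
  unfolding jw_def by (intro prod_ge_1) simp

lemma continuous_on_jw: "continuous_on S jw"
  unfolding jw_def[abs_def] by (intro continuous_intros)

lemma nn_integral_inverse_1_plus_square_finite: "(\<integral>\<^sup>+s. ennreal (1 / (1 + s\<^sup>2)) \<partial>lborel) < \<infinity>"
proof -
  let ?f = "\<lambda>s::real. 1 / (1 + s\<^sup>2)"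
  have pos: "1 + s\<^sup>2 > 0" for s :: real by (simp add: add_pos_nonneg)
  have m: "?f \<in> borel_measurable borel" by measurable
  have half: "(\<integral>\<^sup>+s. ennreal (?f s) * indicator {0..} s \<partial>lborel) = ennreal (pi / 2 - arctan 0)"
    by (rule nn_integral_FTC_atLeast[OF m])
      (auto intro!: derivative_eq_intros tendsto_arctan_at_top simp: pos[THEN less_imp_le] inverse_eq_divide)
  have "(\<integral>\<^sup>+s. ennreal (?f s) \<partial>lborel) \<le> (\<integral>\<^sup>+s. ennreal (?f s) * indicator {0..} s + ennreal (?f (- s)) * indicator {0..} (- s) \<partial>lborel)"
    by (intro nn_integral_mono) (auto split: split_indicator)
  also have "\<dots> = (\<integral>\<^sup>+s. ennreal (?f s) * indicator {0..} s \<partial>lborel) + (\<integral>\<^sup>+s. ennreal (?f (- s)) * indicator {0..} (- s) \<partial>lborel)"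
    by (rule nn_integral_add) (use m in measurable)
  also have "(\<integral>\<^sup>+s. ennreal (?f (- s)) * indicator {0..} (- s) \<partial>lborel) = (\<integral>\<^sup>+s. ennreal (?f s) * indicator {0..} s \<partial>lborel)"
    using nn_integral_real_affine[of "\<lambda>s. ennreal (?f s) * indicator {0..} s" "-1" 0] m by simp
  finally show ?thesis unfolding half
    by (rule le_less_trans) (simp add: ennreal_plus[symmetric] del: ennreal_plus)
qed

lemma integrable_inverse_jw: "integrable lborel (\<lambda>y :: real ^ 'n::finite. 1 / jw y)"
proof (rule integrableI_nonneg)
  interpret product_sigma_finite "\<lambda>_ :: 'n. lborel :: real measure" by standard
  have m: "(\<lambda>y :: real ^ 'n. 1 / jw y) \<in> borel_measurable borel"
    using borel_measurable_continuous_onI[OF continuous_on_jw[of UNIV]] by measurable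
  show "(\<lambda>y :: real ^ 'n. 1 / jw y) \<in> borel_measurable lborel" using m by simp
  have jw0: "0 \<le> 1 / jw y" for y :: "real ^ 'n" using jw_ge_1[of y] by simp
  then show "AE y in lborel. 0 \<le> 1 / jw (y :: real ^ 'n)" by simp
  have "(\<integral>\<^sup>+y. ennreal (1 / jw (y :: real ^ 'n)) \<partial>lborel) = (\<integral>\<^sup>+g. ennreal (1 / jw (upd UNIV (0 :: real ^ 'n) g)) \<partial>(Pi\<^sub>M UNIV (\<lambda>_. lborel)))"
    by (rule nn_integral_lborel_vec) (use m in measurable)
  also have "\<dots> = (\<integral>\<^sup>+g. (\<Prod>j\<in>UNIV. ennreal (1 / (1 + (g j)\<^sup>2))) \<partial>(Pi\<^sub>M (UNIV :: 'n set) (\<lambda>_. lborel)))"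
  proof (rule nn_integral_cong)
    fix g :: "'n \<Rightarrow> real"
    have "ennreal (1 / jw (upd UNIV (0 :: real ^ 'n) g)) = ennreal (\<Prod>j\<in>UNIV. 1 / (1 + (g j)\<^sup>2))"
      by (simp add: jw_def upd_def prod_dividef)
    also have "\<dots> = (\<Prod>j\<in>UNIV. ennreal (1 / (1 + (g j)\<^sup>2)))"
      by (rule prod_ennreal[symmetric]) (simp add: add_nonneg_nonneg)
    finally show "ennreal (1 / jw (upd UNIV (0 :: real ^ 'n) g)) = (\<Prod>j\<in>UNIV. ennreal (1 / (1 + (g j)\<^sup>2)))" .
  qed
  also have "\<dots> = (\<Prod>j\<in>(UNIV :: 'n set). \<integral>\<^sup>+s. ennreal (1 / (1 + s\<^sup>2)) \<partial>lborel)"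
    by (rule product_nn_integral_prod) (auto intro!: measurable_compose[OF _ measurable_ennreal])
  also have "\<dots> < \<infinity>"
    using nn_integral_inverse_1_plus_square_finite by (simp add: power_less_top_ennreal)
  finally show "(\<integral>\<^sup>+y. ennreal (1 / jw (y :: real ^ 'n)) \<partial>lborel) < \<infinity>" .
qed

lemma jw_eq_sum_squares: "jw y = (\<Sum>D\<in>UNIV. (xpow (\<lambda>j. if j \<in> D then 1 else 0) y)\<^sup>2)"
proof -
  have "jw y = (\<Prod>j\<in>UNIV. (y $ j)\<^sup>2 + 1)" by (simp add: jw_def add.commute)
  also have "\<dots> = (\<Sum>D\<in>Pow UNIV. \<Prod>j\<in>D. (y $ j)\<^sup>2)" by (subst prod_add) auto
  also have "\<dots> = (\<Sum>D\<in>UNIV. (xpow (\<lambda>j. if j \<in> D then 1 else 0) y)\<^sup>2)"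
  proof (rule sum.cong)
    fix D :: "'a set"
    have "xpow (\<lambda>j. if j \<in> D then 1 else 0) y = (\<Prod>j\<in>UNIV. if j \<in> D then y $ j else 1)"
      unfolding xpow_def by (rule prod.cong) auto
    also have "\<dots> = (\<Prod>j\<in>D. y $ j)" by (simp add: prod.If_cases)
    finally show "(\<Prod>j\<in>D. (y $ j)\<^sup>2) = (xpow (\<lambda>j. if j \<in> D then 1 else 0) y)\<^sup>2"
      by (simp add: prod_power_distrib)
  qed simp
  finally show ?thesis .
qed

lemma abs_xpow_le_jw_power:
  assumes "\<And>j. \<zeta> j \<le> r" shows "\<bar>xpow \<zeta> y\<bar> \<le> jw y ^ r"
  unfolding xpow_def abs_prod power_abs jw_def prod_power_distrib
proof (rule prod_mono)
  fix j
  have "\<bar>y $ j\<bar> \<le> 1 + (y $ j)\<^sup>2"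
    using sum_squares_ge_zero[of "\<bar>y $ j\<bar> - 1" 0] by (simp add: power2_eq_square algebra_simps)
  then have "\<bar>y $ j\<bar> ^ \<zeta> j \<le> (1 + (y $ j)\<^sup>2) ^ \<zeta> j" by (rule power_mono) simp
  also have "\<dots> \<le> (1 + (y $ j)\<^sup>2) ^ r" by (rule power_increasing[OF assms]) simp
  finally show "0 \<le> \<bar>y $ j\<bar> ^ \<zeta> j \<and> \<bar>y $ j\<bar> ^ \<zeta> j \<le> (1 + (y $ j)\<^sup>2) ^ r" by simp
qed

text \<open>The \<open>L^1\<close> integrand is split by \<open>a \<le> a^2 w + 1 / w\<close> with
  \<open>w = jw y\<close>, and \<open>a^2 w\<close> expands into squares with monomial weights. The
  bound is not homogeneous in \<open>f\<close>; scaling restores homogeneity where the resulting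
  estimate is applied.\<close>

lemma sobolev_L2:
  fixes f :: "real ^ 'n::finite \<Rightarrow> complex"
  assumes js: "distinct js" "set js = UNIV" and f: "f \<in> tests"
  shows "\<bar>xpow \<eta> x\<bar> * norm (f x) \<le>
    (\<integral>y. 1 / jw (y :: real ^ 'n) \<partial>lborel) +
    (\<Sum>D\<in>UNIV. nsq (wt (\<lambda>j. \<eta> j + (if j \<in> D then 1 else 0)) (partials js f)))"
proof -
  define u where "u D y = of_real (xpow (\<lambda>j. \<eta> j + (if j \<in> D then 1 else 0)) y) * partials js f y" for D y
  have u: "u D \<in> tests" for D unfolding u_def by (intro test_mult smooth_xpow test_partials f)
  have amgm: "a \<le> a\<^sup>2 * w + 1 / w" if "w \<ge> 1" for a w :: real
  proof (cases "a * w \<le> 1")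
    case True
    then have "a \<le> 1 / w" using that by (simp add: field_simps)
    moreover have "0 \<le> a\<^sup>2 * w" using that by simp
    ultimately show ?thesis by simp
  next
    case False
    then have "0 < a" using that by (smt (verit) mult_nonpos_nonneg)
    then have "a * 1 \<le> a * (a * w)" using False by (intro mult_left_mono) auto
    moreover have "0 \<le> 1 / w" using that by simp
    ultimately show ?thesis unfolding power2_eq_square mult.assoc by linarith
  qed
  have eq: "(\<bar>xpow \<eta> y\<bar> * norm (partials js f y))\<^sup>2 * jw y = (\<Sum>D\<in>UNIV. (norm (u D y))\<^sup>2)" for y
    unfolding jw_eq_sum_squares sum_distrib_left
    by (intro sum.cong) (simp_all add: u_def xpow_add norm_mult power_mult_distrib)
  have I: "integrable lborel (\<lambda>y. (\<Sum>D\<in>UNIV. (norm (u D y))\<^sup>2) + 1 / jw y)"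
    by (intro Bochner_Integration.integrable_add Bochner_Integration.integrable_sum test_norm2_integrable u integrable_inverse_jw)
  have pos: "0 \<le> (\<Sum>D\<in>UNIV. (norm (u D y))\<^sup>2) + 1 / jw y" for y
    using jw_ge_1[of y] by (intro add_nonneg_nonneg sum_nonneg) auto
  have "ennreal (\<bar>xpow \<eta> x\<bar> * norm (f x)) \<le> (\<integral>\<^sup>+y. ennreal (\<bar>xpow \<eta> y\<bar> * norm (partials js f y)) \<partial>lborel)"
    by (rule sobolev[OF js f])
  also have "\<dots> \<le> (\<integral>\<^sup>+y. ennreal ((\<Sum>D\<in>UNIV. (norm (u D y))\<^sup>2) + 1 / jw y) \<partial>lborel)"
    by (intro nn_integral_mono ennreal_leI) (simp only: eq[symmetric] amgm jw_ge_1)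
  also have "\<dots> = ennreal (\<integral>y. (\<Sum>D\<in>UNIV. (norm (u D y))\<^sup>2) + 1 / jw y \<partial>lborel)"
    by (rule nn_integral_eq_integral[OF I]) (use pos in simp)
  finally have "\<bar>xpow \<eta> x\<bar> * norm (f x) \<le> (\<integral>y. (\<Sum>D\<in>UNIV. (norm (u D y))\<^sup>2) + 1 / jw y \<partial>lborel)"
    by (subst (asm) ennreal_le_iff) (auto intro!: integral_nonneg_AE AE_I2 pos)
  also have "\<dots> = (\<Sum>D\<in>UNIV. nsq (u D)) + (\<integral>y. 1 / jw (y :: real ^ 'n) \<partial>lborel)"
    by (subst Bochner_Integration.integral_add)
      (simp_all add: nsq_def u integrable_inverse_jw test_norm2_integrable)
  finally show ?thesis by (simp add: u_def[abs_def] add.commute)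
qed

text \<open>Sobolev with \<open>js0\<close> passes to weighted \<open>L^2\<close> norms, Hardy with
  \<open>js1\<close> raises the weight by \<open>m v\<close>, and the \<open>L^2\<close> estimate is
  applied to the derivative \<open>w\<close> with a shifted \<open>c\<close>. The hypothesis is
  normalized to 1 to suit the inhomogeneous Sobolev step.\<close>

theorem weighted_sup_estimate:
  fixes A :: "('n::{finite,linorder} \<Rightarrow>\<^sub>0 nat) set" and p :: "('n \<Rightarrow>\<^sub>0 nat) \<Rightarrow> complex"
  assumes A: "finite A" "A \<noteq> {}" and p: "\<And>\<alpha>. \<alpha> \<in> A \<Longrightarrow> p \<alpha> \<noteq> 0"
  obtains C :: real and r :: nat and B :: "'n list" where "C \<ge> 0"
    "\<And>c f \<eta> x. f \<in> tests \<Longrightarrow>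
      (\<And>y. \<bar>xpow \<eta> y\<bar> * jw y ^ r * norm (partials B (ev (aff 1 c) A p f) y) \<le> 1) \<Longrightarrow>
      \<bar>xpow \<eta> x\<bar> * norm (f x) \<le> C"
proof -
  obtain C0 m and v :: "'n \<Rightarrow> nat" where C0: "C0 \<ge> 0" and core: "\<And>c f \<eta>. f \<in> tests \<Longrightarrow>
      nsq (wt (\<lambda>j. \<eta> j + m * v j) f) \<le>
      C0 * (\<Sum>J\<in>UNIV. \<Sum>i\<le>m. nsq (wt (\<lambda>j. \<eta> j + (if j \<in> J then m * v j else 0) + i * v j) (ev (aff 1 c) A p f)))"
    using weighted_L2_estimate[of A p, OF A p] by blast
  obtain js1 where js1: "\<And>j. count_list js1 j = m * v j"
    using exists_list_count[of "\<lambda>j. m * v j"] by blast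
  define js0 where "js0 = sorted_list_of_set (UNIV :: 'n set)"
  have js0: "distinct js0" "set js0 = UNIV" by (auto simp: js0_def)
  \<comment> \<open>Largest surplus exponent in one coordinate: 1 from the expansion of
    \<open>jw\<close>, \<open>m * v j\<close> from the set \<open>J\<close>, and at most
    \<open>m * v j\<close> from \<open>i * v j\<close>.\<close>
  define r where "r = Max (range (\<lambda>j. 1 + 2 * (m * v j)))"
  have r: "1 + 2 * (m * v j) \<le> r" for j unfolding r_def by (rule Max_ge) auto
  define I where "I = (\<integral>y. 1 / jw (y :: (real, 'n) vec) \<partial>lborel)"
  have I0: "0 \<le> I" unfolding I_def by (intro integral_nonneg_AE AE_I2) (use jw_ge_1 in \<open>auto intro: order_trans[OF zero_le_one]\<close>)
  define C where "C = I + (\<Sum>D\<in>(UNIV :: 'n set set). 4 ^ length js1 * (C0 * (\<Sum>J\<in>(UNIV :: 'n set set). \<Sum>i\<le>m. I)))"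
  show thesis
  \<comment> \<open>\<open>r\<close> powers of \<open>jw\<close> dominate the surplus monomials; the
    extra one leaves \<open>1 / jw\<close>, whose square is at most the integrable function
    \<open>1 / jw\<close>.\<close>
  proof (rule that[of C "Suc r" "js1 @ js0"])
    show "C \<ge> 0" unfolding C_def using I0 C0 by (intro add_nonneg_nonneg sum_nonneg mult_nonneg_nonneg) auto
    fix c :: "'n \<Rightarrow> real" and f :: "(real, 'n) vec \<Rightarrow> complex" and \<eta> :: "'n \<Rightarrow> nat" and x
    assume f: "f \<in> tests"
      and hyp: "\<And>y. \<bar>xpow \<eta> y\<bar> * jw y ^ Suc r * norm (partials (js1 @ js0) (ev (aff 1 c) A p f) y) \<le> 1"
    define \<psi> where "\<psi> = partials (js1 @ js0) (ev (aff 1 c) A p f)"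
    define w where "w = partials js1 (partials js0 f)"
    have w: "w \<in> tests" unfolding w_def by (intro test_partials f)
    have \<psi>: "\<psi> \<in> tests" unfolding \<psi>_def by (intro test_partials linopD(1)[OF linop_ev] linop_aff f)
    have \<psi>w: "\<psi> = ev (aff 1 (\<lambda>j. c j - real (count_list (js1 @ js0) j))) A p w"
      unfolding \<psi>_def w_def partials_ev[OF f] by (simp only: partials_append)
    have est: "nsq (wt (\<lambda>j. \<eta> j + \<zeta> j) \<psi>) \<le> I"
      if \<zeta>: "\<And>j. \<zeta> j \<le> 1 + 2 * (m * v j)" for \<zeta>
      unfolding nsq_def I_def
    proof (rule integral_mono[OF test_norm2_integrable integrable_inverse_jw])
      show "(wt (\<lambda>j. \<eta> j + \<zeta> j) \<psi>) \<in> tests" by (intro test_mult smooth_xpow \<psi>)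
      fix y :: "(real, 'n) vec"
      have J: "jw y \<ge> 1" by (rule jw_ge_1)
      have "norm (of_real (xpow (\<lambda>j. \<eta> j + \<zeta> j) y) * \<psi> y) = \<bar>xpow \<eta> y\<bar> * \<bar>xpow \<zeta> y\<bar> * norm (\<psi> y)"
        by (simp add: norm_mult xpow_add abs_mult)
      also have "\<dots> \<le> \<bar>xpow \<eta> y\<bar> * jw y ^ r * norm (\<psi> y)"
        by (intro mult_right_mono mult_left_mono abs_xpow_le_jw_power order_trans[OF \<zeta> r]) auto
      also have "\<dots> \<le> 1 / jw y"
        using hyp[of y] J by (simp add: \<psi>_def field_simps)
      finally have "norm (of_real (xpow (\<lambda>j. \<eta> j + \<zeta> j) y) * \<psi> y) \<le> 1 / jw y" .
      then have "(norm (of_real (xpow (\<lambda>j. \<eta> j + \<zeta> j) y) * \<psi> y))\<^sup>2 \<le> (1 / jw y)\<^sup>2"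
        by (rule power_mono) simp
      also have "\<dots> \<le> 1 / jw y" using J by (simp add: power2_eq_square field_simps)
      finally show "(norm (of_real (xpow (\<lambda>j. \<eta> j + \<zeta> j) y) * \<psi> y))\<^sup>2 \<le> 1 / jw y" .
    qed
    have D: "nsq (wt (\<lambda>j. \<eta> j + (if j \<in> D then 1 else 0)) (partials js0 f)) \<le>
       4 ^ length js1 * (C0 * (\<Sum>J\<in>(UNIV :: 'n set set). \<Sum>i\<le>m. I))" for D
    proof -
      let ?\<delta> = "\<lambda>j. \<eta> j + (if j \<in> D then 1 else 0)"
      have "nsq (wt ?\<delta> (partials js0 f)) \<le>
        4 ^ length js1 * nsq (wt (\<lambda>j. ?\<delta> j + m * v j) w)"
        using hardy_partials[OF test_partials[OF f], of ?\<delta> js0 js1] by (simp only: w_def js1)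
      also have "nsq (wt (\<lambda>j. ?\<delta> j + m * v j) w) \<le>
        C0 * (\<Sum>J\<in>UNIV. \<Sum>i\<le>m. nsq (wt (\<lambda>j. ?\<delta> j + (if j \<in> J then m * v j else 0) + i * v j) \<psi>))"
        unfolding \<psi>w by (rule core[OF w])
      also have "\<dots> \<le> C0 * (\<Sum>J\<in>(UNIV :: 'n set set). \<Sum>i\<le>m. I)"
      proof (intro mult_left_mono sum_mono C0)
        fix J :: "'n set" and i assume i: "i \<in> {..m}"
        let ?\<zeta> = "\<lambda>j. (if j \<in> D then 1 else 0) + (if j \<in> J then m * v j else 0) + i * v j"
        have "?\<zeta> j \<le> 1 + 2 * (m * v j)" for j
        proof -
          have "i * v j \<le> m * v j" using i by simp
          moreover have "(if j \<in> D then 1 else 0) \<le> (1::nat)" "(if j \<in> J then m * v j else 0) \<le> m * v j" by auto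
          ultimately show ?thesis by linarith
        qed
        from est[of ?\<zeta>, OF this] show "nsq (wt (\<lambda>j. ?\<delta> j + (if j \<in> J then m * v j else 0) + i * v j) \<psi>) \<le> I"
          by (simp only: add.assoc)
      qed
      finally show ?thesis by (simp add: mult_left_mono)
    qed
    have "\<bar>xpow \<eta> x\<bar> * norm (f x) \<le> I +
      (\<Sum>D\<in>UNIV. nsq (wt (\<lambda>j. \<eta> j + (if j \<in> D then 1 else 0)) (partials js0 f)))"
      unfolding I_def by (rule sobolev_L2[OF js0 f])
    also have "\<dots> \<le> C" unfolding C_def by (intro add_left_mono sum_mono D)
    finally show "\<bar>xpow \<eta> x\<bar> * norm (f x) \<le> C" .
  qed
qed

section \<open>Smooth cutoff functions\<close>

definition expbump :: "real poly \<Rightarrow> real \<Rightarrow> real" where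
  "expbump p t = (if t > 0 then poly p (1 / t) * exp (- (1 / t)) else 0)"

lemma tendsto_poly_div_exp: "((\<lambda>y. poly p y / exp y) \<longlongrightarrow> (0::real)) at_top"
proof -
  have "((\<lambda>y. \<Sum>i\<le>degree p. coeff p i * (y ^ i / exp y)) \<longlongrightarrow> (\<Sum>i\<le>degree p. coeff p i * 0)) at_top"
    by (intro tendsto_sum tendsto_mult tendsto_const tendsto_power_div_exp_0)
  then show ?thesis by (simp add: poly_altdef sum_divide_distrib)
qed

text \<open>With \<open>u = 1 / t\<close>, the derivative of \<open>p(u) exp (- u)\<close> in
  \<open>t\<close> is \<open>u^2 (p - p')(u) exp (- u)\<close>, so differentiation acts on the
  polynomial alone. At \<open>t = 0\<close> the right difference quotient is
  \<open>u p(u) / exp u\<close>, which tends to 0 as \<open>u\<close> grows.\<close>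

lemma DERIV_expbump:
  "(expbump p has_real_derivative expbump ([:0, 0, 1:] * (p - pderiv p)) t) (at t)"
proof -
  consider "t > 0" | "t < 0" | "t = 0" by linarith
  then show ?thesis
  proof cases
    case 1
    have "((\<lambda>t. poly p (1 / t) * exp (- (1 / t))) has_real_derivative
       expbump ([:0, 0, 1:] * (p - pderiv p)) t) (at t)"
      using 1 by (auto intro!: derivative_eq_intros simp: expbump_def field_simps power2_eq_square)
    then show ?thesis
      by (rule has_field_derivative_transform_within_open[of _ _ _ "{0<..}"]) (use 1 in \<open>auto simp: expbump_def\<close>)
  next
    case 2
    have "((\<lambda>t. 0) has_real_derivative expbump ([:0, 0, 1:] * (p - pderiv p)) t) (at t)"
      using 2 by (auto simp: expbump_def)
    then show ?thesis
      by (rule has_field_derivative_transform_within_open[of _ _ _ "{..<0}"]) (use 2 in \<open>auto simp: expbump_def\<close>)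
  next
    case 3
    have "((\<lambda>h. expbump p h / h) \<longlongrightarrow> 0) (at_left 0)"
      by (rule Lim_transform_eventually[OF tendsto_const])
        (auto simp: eventually_at_left_field expbump_def intro!: exI[of _ "-1"])
    moreover have "((\<lambda>h. expbump p h / h) \<longlongrightarrow> 0) (at_right 0)"
    proof (rule Lim_transform_eventually)
      show "((\<lambda>h. poly ([:0, 1:] * p) (inverse h) / exp (inverse h)) \<longlongrightarrow> 0) (at_right 0)"
        by (rule filterlim_compose[OF tendsto_poly_div_exp filterlim_inverse_at_top_right])
      show "\<forall>\<^sub>F h in at_right 0. poly ([:0, 1:] * p) (inverse h) / exp (inverse h) = expbump p h / h"
        by (auto simp: eventually_at_right_field expbump_def exp_minus field_simps intro!: exI[of _ 1])
    qed
    ultimately have "((\<lambda>h. expbump p h / h) \<longlongrightarrow> 0) (at 0)" by (simp add: filterlim_split_at)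
    then show ?thesis using 3 by (simp add: DERIV_def expbump_def)
  qed
qed

definition bump :: "real \<Rightarrow> real" where "bump = expbump 1"

lemma bump_pos: "bump t > 0 \<longleftrightarrow> t > 0" and bump_nonpos: "t \<le> 0 \<Longrightarrow> bump t = 0"
  and bump_nonneg: "bump t \<ge> 0"
  by (auto simp: bump_def expbump_def)

lemma smooth_bump: "smooth (\<lambda>x. of_real (B x)) \<Longrightarrow> smooth (\<lambda>x. of_real (bump (B x)))"
  unfolding bump_def
  by (rule smooth_compose_family[where F = expbump and D = "\<lambda>p. [:0, 0, 1:] * (p - pderiv p)"])
    (rule DERIV_expbump)

lemma smooth_of_real_add: "smooth (\<lambda>x. of_real (f x)) \<Longrightarrow> smooth (\<lambda>x. of_real (g x)) \<Longrightarrow>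
   smooth (\<lambda>x. of_real (f x + g x))"
  by (simp add: smooth_add)

lemma smooth_norm_diff_sq: "smooth (\<lambda>x :: real ^ 'n::finite. of_real (c - (norm (x - a))\<^sup>2))"
proof -
  have "(norm (x - a))\<^sup>2 = (\<Sum>j\<in>UNIV. (x $ j - a $ j)\<^sup>2)" for x
    by (simp add: norm_vec_def L2_set_def sum_nonneg)
  then have e: "(\<lambda>x. of_real (c - (norm (x - a))\<^sup>2)) =
     (\<lambda>x. of_real c - (\<Sum>j\<in>UNIV. (of_real (x $ j) - of_real (a $ j)) ^ 2))"
    by simp
  show ?thesis unfolding e by (intro smooth_diff smooth_const smooth_sum smooth_power smooth_coord)
qed

lemma smooth_of_real_continuous:
  assumes "smooth (\<lambda>x. of_real (f x))" shows "continuous_on S f"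
  using continuous_on_Re[OF smooth_continuous[OF assms, of S]] by simp

text \<open>Finitely many balls inside \<open>U\<close> cover \<open>K\<close>. The sum
  \<open>B\<close> of their bumps is positive on \<open>K\<close> and vanishes outside the closed
  balls; a smooth transition function of \<open>B\<close> turns it into a cutoff.\<close>

lemma smooth_cutoff:
  fixes K :: "(real ^ 'n::finite) set"
  assumes K: "compact K" and U: "open U" "K \<subseteq> U"
  obtains \<rho> V where "\<rho> \<in> test_functions U" "open V" "K \<subseteq> V" "\<And>x. x \<in> V \<Longrightarrow> \<rho> x = 1"
proof (cases "K = {}")
  case True
  then show ?thesis using that[of "\<lambda>x. 0" "{}"] test_zero by auto
next
  case False
  have "\<exists>r>0. cball a r \<subseteq> U" if "a \<in> K" for a
    using U that open_contains_cball by blast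
  then obtain r where r: "\<And>a. a \<in> K \<Longrightarrow> r a > 0" "\<And>a. a \<in> K \<Longrightarrow> cball a (r a) \<subseteq> U" by metis
  have "K \<subseteq> (\<Union>a\<in>K. ball a (r a))" using r(1) by force
  then obtain S where S: "S \<subseteq> K" "finite S" "K \<subseteq> (\<Union>a\<in>S. ball a (r a))"
    using compactE_image[OF K, of K "\<lambda>a. ball a (r a)"] by auto
  define B where "B x = (\<Sum>a\<in>S. bump ((r a)\<^sup>2 - (norm (x - a))\<^sup>2))" for x
  have sB: "smooth (\<lambda>x. of_real (B x))"
    unfolding B_def of_real_sum by (intro smooth_sum smooth_bump smooth_norm_diff_sq)
  have cB: "continuous_on T B" for T by (rule smooth_of_real_continuous[OF sB])
  have B0: "B x \<ge> 0" for x unfolding B_def by (intro sum_nonneg bump_nonneg)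
  have Bpos: "B x > 0" if xK: "x \<in> K" for x
  proof -
    obtain a where a: "a \<in> S" "x \<in> ball a (r a)" using S(3) xK by blast
    then have "(norm (x - a))\<^sup>2 < (r a)\<^sup>2"
      by (intro power_strict_mono) (auto simp: dist_norm norm_minus_commute)
    then show ?thesis unfolding B_def using a S(2)
      by (intro sum_pos2[of _ a]) (auto simp: bump_pos bump_nonneg)
  qed
  obtain x0 where x0: "x0 \<in> K" "\<And>x. x \<in> K \<Longrightarrow> B x0 \<le> B x"
    using continuous_attains_inf[OF K False cB] by blast
  \<comment> \<open>Half the minimum of \<open>B\<close> over \<open>K\<close>: the strict
    inequality \<open>d < B x\<close> then defines an open set that contains
    \<open>K\<close>.\<close>
  define d where "d = B x0 / 2"
  have d: "d > 0" using Bpos[OF x0(1)] by (simp add: d_def)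
  \<comment> \<open>Since \<open>d > 0\<close>, at least one of \<open>B x\<close> and
    \<open>d - B x\<close> is positive, so the denominator never vanishes.\<close>
  define den where "den x = bump (B x) + bump (d - B x)" for x
  have den: "den x > 0" for x
    using bump_pos[of "B x"] bump_pos[of "d - B x"] bump_nonneg[of "B x"] bump_nonneg[of "d - B x"] d
    unfolding den_def by (cases "B x > 0") (auto intro: add_pos_nonneg add_nonneg_pos)
  have sdB: "smooth (\<lambda>x. of_real (d - B x))"
    using smooth_diff[OF smooth_const sB] by simp
  have sden: "smooth (\<lambda>x. of_real (den x))"
    unfolding den_def by (intro smooth_of_real_add smooth_bump sB sdB)
  define \<rho> where "\<rho> x = complex_of_real (bump (B x)) * inverse (of_real (den x))" for x
  have "smooth \<rho>"
    unfolding \<rho>_def[abs_def] by (intro smooth_mult smooth_inverse smooth_bump sB sden) (use den in \<open>simp add: less_imp_neq[THEN not_sym]\<close>)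
  moreover have "\<rho> x = 0" if "x \<notin> (\<Union>a\<in>S. cball a (r a))" for x
  proof -
    have "bump ((r a)\<^sup>2 - (norm (x - a))\<^sup>2) = 0" if "a \<in> S" for a
    proof (rule bump_nonpos)
      have "r a < norm (x - a)" using that \<open>x \<notin> (\<Union>a\<in>S. cball a (r a))\<close>
        by (auto simp: dist_norm norm_minus_commute)
      then have "(r a)\<^sup>2 \<le> (norm (x - a))\<^sup>2" using r(1)[of a] S(1) that by (intro power_mono) auto
      then show "(r a)\<^sup>2 - (norm (x - a))\<^sup>2 \<le> 0" by simp
    qed
    then have "B x = 0" by (simp add: B_def)
    then show ?thesis by (simp add: \<rho>_def bump_nonpos)
  qed
  moreover have "compact (\<Union>a\<in>S. cball a (r a))" by (intro compact_UN S(2) compact_cball)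
  moreover have "(\<Union>a\<in>S. cball a (r a)) \<subseteq> U" using S(1) r(2) by blast
  ultimately have "\<rho> \<in> test_functions U" by (intro test_functionsI[of \<rho> "\<Union>a\<in>S. cball a (r a)"])
  moreover have "open {x. d < B x}" by (intro open_Collect_less continuous_intros cB)
  moreover have "K \<subseteq> {x. d < B x}" using x0(2) Bpos[OF x0(1)] by (force simp: d_def)
  moreover have "\<rho> x = 1" if "x \<in> {x. d < B x}" for x
    using that den[of x] by (simp add: \<rho>_def den_def bump_nonpos)
  ultimately show ?thesis using that[of \<rho> "{x. d < B x}"] by blast
qed

section \<open>Localization of functionals of finite order\<close>

text \<open>The pointwise version of \<open>test_seminorm\<close>: without the supremum it can be
  weighted differently at different points.\<close>

definition dsum :: "nat \<Rightarrow> (real ^ 'n::finite \<Rightarrow> complex) \<Rightarrow> real ^ 'n \<Rightarrow> real" where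
  "dsum N \<phi> x = (\<Sum>js | length js \<le> N. norm (partials js \<phi> x))"

lemma finite_lists_le: "finite {js :: 'n::finite list. length js \<le> N}"
  using finite_lists_length_le[of "UNIV :: 'n set" N] by simp

lemma dsum_nonneg: "0 \<le> dsum N \<phi> x"
  unfolding dsum_def by (intro sum_nonneg) auto

lemma dsum_mono: "M \<le> N \<Longrightarrow> dsum M \<phi> x \<le> dsum N \<phi> x"
  unfolding dsum_def by (intro sum_mono2 finite_lists_le) auto

lemma dsum_partial_le: "dsum N (partial j \<phi>) x \<le> dsum (Suc N) \<phi> x"
proof -
  have "dsum N (partial j \<phi>) x = (\<Sum>js | length js \<le> N. norm (partials (js @ [j]) \<phi> x))"
    by (simp add: dsum_def partials_append partials_Cons)
  also have "\<dots> = (\<Sum>js \<in> (\<lambda>js. js @ [j]) ` {js. length js \<le> N}. norm (partials js \<phi> x))"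
    by (subst sum.reindex) (auto intro: inj_onI)
  also have "\<dots> \<le> dsum (Suc N) \<phi> x"
    unfolding dsum_def by (intro sum_mono2 finite_lists_le) auto
  finally show ?thesis .
qed

text \<open>Peeling the innermost derivative leaves two terms of the same shape, one with
  \<open>partial j \<rho>\<close> and one with \<open>partial j \<phi>\<close>. The constant depends
  on \<open>\<rho>\<close> and \<open>js\<close> only, and the bound holds at each point
  separately.\<close>

lemma leibniz_bound:
  assumes "\<rho> \<in> tests"
  shows "\<exists>C\<ge>0. \<forall>\<phi> x. smooth \<phi> \<longrightarrow> norm (partials js (\<lambda>x. \<rho> x * \<phi> x) x) \<le> C * dsum (length js) \<phi> x"
  using assms
proof (induction js arbitrary: \<rho> rule: rev_induct)
  case Nil
  then obtain B where B: "B \<ge> 0" "\<And>x. norm (\<rho> x) \<le> B" using test_bounded by blast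
  show ?case
    by (rule exI[of _ B]) (use B in \<open>auto simp: norm_mult dsum_def intro!: mult_right_mono\<close>)
next
  case (snoc j js)
  obtain C1 where C1: "C1 \<ge> 0" "\<And>\<phi> x. smooth \<phi> \<Longrightarrow> norm (partials js (\<lambda>x. partial j \<rho> x * \<phi> x) x) \<le> C1 * dsum (length js) \<phi> x"
    using snoc.IH[OF test_partial[OF snoc.prems]] by blast
  obtain C2 where C2: "C2 \<ge> 0" "\<And>\<phi> x. smooth \<phi> \<Longrightarrow> norm (partials js (\<lambda>x. \<rho> x * \<phi> x) x) \<le> C2 * dsum (length js) \<phi> x"
    using snoc.IH[OF snoc.prems] by blast
  have s\<rho>: "smooth \<rho>" using snoc.prems by (rule test_functionsD)
  show ?case
  proof (intro exI[of _ "C1 + C2"] conjI allI impI)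
    show "0 \<le> C1 + C2" using C1 C2 by simp
    fix \<phi> :: "(real, 'a) vec \<Rightarrow> complex" and x assume \<phi>: "smooth \<phi>"
    have "partial j (\<lambda>x. \<rho> x * \<phi> x) = (\<lambda>x. partial j \<rho> x * \<phi> x + \<rho> x * partial j \<phi> x)"
      using \<phi> s\<rho> by (auto simp: partial_mult smooth_differentiable)
    then have "norm (partials (js @ [j]) (\<lambda>x. \<rho> x * \<phi> x) x) =
       norm (partials js (\<lambda>x. partial j \<rho> x * \<phi> x) x + partials js (\<lambda>x. \<rho> x * partial j \<phi> x) x)"
      by (simp add: partials_append partials_Cons partials_add smooth_mult smooth_partial \<phi> s\<rho>)
    also have "\<dots> \<le> C1 * dsum (length js) \<phi> x + C2 * dsum (length js) (partial j \<phi>) x"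
      by (rule norm_triangle_le) (intro add_mono C1(2) C2(2) \<phi> smooth_partial)
    also have "\<dots> \<le> C1 * dsum (Suc (length js)) \<phi> x + C2 * dsum (Suc (length js)) \<phi> x"
      by (intro add_mono mult_left_mono C1(1) C2(1) dsum_partial_le dsum_mono) simp
    finally show "norm (partials (js @ [j]) (\<lambda>x. \<rho> x * \<phi> x) x) \<le> (C1 + C2) * dsum (length (js @ [j])) \<phi> x"
      by (simp add: algebra_simps)
  qed
qed

text \<open>The cutoff confines the argument of \<open>T\<close> to one compact set, so a single
  continuity bound suffices and only the derivatives of \<open>\<phi>\<close> on the support of
  \<open>\<rho>\<close> count.\<close>

lemma localized_bound:
  assumes T: "\<And>K. compact K \<Longrightarrow> K \<subseteq> \<Omega> \<Longrightarrow> bounded_with_order N \<Omega> K T"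
    and \<rho>: "\<rho> \<in> test_functions \<Omega>"
  shows "\<exists>A\<ge>0. \<forall>\<phi>\<in>test_functions \<Omega>. \<forall>m\<ge>0. (\<forall>x\<in>supp \<rho>. dsum N \<phi> x \<le> m) \<longrightarrow> norm (T (\<lambda>x. \<rho> x * \<phi> x)) \<le> A * m"
proof -
  have \<rho>': "\<rho> \<in> tests" using \<rho> by (rule test_functions_mono) simp
  obtain C where C: "\<And>\<phi>. \<phi> \<in> test_functions \<Omega> \<Longrightarrow> supp \<phi> \<subseteq> supp \<rho> \<Longrightarrow> norm (T \<phi>) \<le> C * test_seminorm N \<phi>"
    using T[of "supp \<rho>"] test_functionsD[OF \<rho>] unfolding bounded_with_order_def by blast
  have "\<forall>js. \<exists>C\<ge>0. \<forall>\<phi> x. smooth \<phi> \<longrightarrow> norm (partials js (\<lambda>x. \<rho> x * \<phi> x) x) \<le> C * dsum (length js) \<phi> x"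
    using leibniz_bound[OF \<rho>'] by blast
  then obtain D where D: "\<And>js. D js \<ge> 0"
    "\<And>js \<phi> x. smooth \<phi> \<Longrightarrow> norm (partials js (\<lambda>x. \<rho> x * \<phi> x) x) \<le> D js * dsum (length js) \<phi> x" by metis
  define A where "A = \<bar>C\<bar> * (\<Sum>js | length js \<le> N. D js)"
  show ?thesis
  proof (intro exI[of _ A] conjI ballI allI impI)
    show "0 \<le> A" unfolding A_def by (intro mult_nonneg_nonneg sum_nonneg D) auto
    fix \<phi> m assume \<phi>: "\<phi> \<in> test_functions \<Omega>" and m: "0 \<le> m" "\<forall>x\<in>supp \<rho>. dsum N \<phi> x \<le> m"
    have s\<phi>: "smooth \<phi>" using \<phi> by (rule test_functionsD)
    let ?\<psi> = "\<lambda>x. \<rho> x * \<phi> x"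
    have sub: "supp ?\<psi> \<subseteq> supp \<rho>"
      by (rule supp_subset_closed) (auto simp: zero_outside_supp)
    have "test_seminorm N ?\<psi> \<le> (\<Sum>js | length js \<le> N. D js * m)"
      unfolding test_seminorm_def
    proof (intro sum_mono cSUP_least)
      fix js x assume js: "js \<in> {js :: 'a list. length js \<le> N}"
      show "norm (partials js ?\<psi> x) \<le> D js * m"
      proof (cases "x \<in> supp \<rho>")
        case True
        have "norm (partials js ?\<psi> x) \<le> D js * dsum (length js) \<phi> x" by (rule D(2)[OF s\<phi>])
        also have "\<dots> \<le> D js * m"
          using js m True dsum_mono[of "length js" N \<phi> x] by (intro mult_left_mono D(1)) force
        finally show ?thesis .
      next
        case False
        then have "partials js ?\<psi> x = 0"
          using supp_partials[of js ?\<psi>] sub zero_outside_supp[of x "partials js ?\<psi>"] by blast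
        then show ?thesis using D(1) m by simp
      qed
    qed simp
    also have "\<dots> = (\<Sum>js | length js \<le> N. D js) * m" by (simp add: sum_distrib_right)
    finally have *: "test_seminorm N ?\<psi> \<le> (\<Sum>js | length js \<le> N. D js) * m" .
    have t0: "0 \<le> (\<Sum>js | length js \<le> N. D js) * m" by (intro mult_nonneg_nonneg sum_nonneg D m)
    have ts: "0 \<le> test_seminorm N ?\<psi>"
      unfolding test_seminorm_def
    proof (intro sum_nonneg)
      fix js :: "'a list"
      have t: "partials js ?\<psi> \<in> test_functions \<Omega>"
        by (intro test_partials test_mult \<phi> test_functionsD(1)[OF \<rho>])
      obtain B where "\<And>x. norm (partials js ?\<psi> x) \<le> B" using test_bounded[OF t] by blast
      then have "bdd_above (range (\<lambda>x. norm (partials js ?\<psi> x)))" by (intro bdd_aboveI2)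
      then have "norm (partials js ?\<psi> 0) \<le> (SUP x. norm (partials js ?\<psi> x))" by (rule cSUP_upper2[of _ _ 0]) auto
      then show "0 \<le> (SUP x. norm (partials js ?\<psi> x))" using norm_ge_zero order_trans by blast
    qed
    have "norm (T ?\<psi>) \<le> C * test_seminorm N ?\<psi>"
      by (rule C[OF test_mult[OF \<phi> test_functionsD(1)[OF \<rho>]] sub])
    also have "\<dots> \<le> \<bar>C\<bar> * test_seminorm N ?\<psi>" using ts by (intro mult_right_mono) auto
    also have "\<dots> \<le> A * m" unfolding A_def mult.assoc by (intro mult_left_mono *) auto
    finally show "norm (T ?\<psi>) \<le> A * m" .
  qed
qed

text \<open>A telescoping partition of unity \<open>\<xi> n = \<rho> n - \<rho> (n - 1)\<close> cuts
  \<open>\<phi>\<close> into shells. The support of \<open>\<xi> (Suc n)\<close> misses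
  \<open>K n\<close>, which leaves room for weights that are large on a shell and small inside
  it.\<close>

lemma shell_decomposition:
  fixes \<Omega> :: "(real ^ 'n::finite) set" and K :: "nat \<Rightarrow> (real ^ 'n) set"
  assumes K: "\<And>n. compact (K n)" "\<And>n. K n \<subseteq> interior (K (Suc n))" "(\<Union>n. K n) = \<Omega>"
    and T: "linear_on_test \<Omega> T" "\<And>K. compact K \<Longrightarrow> K \<subseteq> \<Omega> \<Longrightarrow> bounded_with_order N \<Omega> K T"
  obtains A :: "nat \<Rightarrow> real" and Z :: "nat \<Rightarrow> (real ^ 'n) set" where
    "\<And>n. A n \<ge> 0" "\<And>n. compact (Z n)" "\<And>n. Z n \<subseteq> \<Omega>" "\<And>n. Z (Suc n) \<inter> K n = {}"
    "\<And>\<phi> m k. \<phi> \<in> test_functions \<Omega> \<Longrightarrow> supp \<phi> \<subseteq> K k \<Longrightarrow> (\<And>n. m n \<ge> 0) \<Longrightarrow>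
      (\<And>n x. x \<in> Z n \<Longrightarrow> dsum N \<phi> x \<le> m n) \<Longrightarrow> norm (T \<phi>) \<le> (\<Sum>n\<le>k. A n * m n)"
proof -
  have int\<Omega>: "interior (K (Suc n)) \<subseteq> \<Omega>" for n using K(3) interior_subset by blast
  have "\<exists>\<rho> V. \<rho> \<in> test_functions (interior (K (Suc n))) \<and> open V \<and> K n \<subseteq> V \<and> (\<forall>x\<in>V. \<rho> x = 1)" for n
    by (rule smooth_cutoff[OF K(1) open_interior K(2)]) blast
  then obtain \<rho> V where \<rho>: "\<And>n. \<rho> n \<in> test_functions (interior (K (Suc n)))" and V: "\<And>n. open (V n)" "\<And>n. K n \<subseteq> V n"
    "\<And>n x. x \<in> V n \<Longrightarrow> \<rho> n x = 1" by metis
  have \<rho>\<Omega>: "\<rho> n \<in> test_functions \<Omega>" for n using \<rho> int\<Omega> test_functions_mono by blast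
  define \<xi> where "\<xi> n = (case n of 0 \<Rightarrow> \<rho> 0 | Suc k \<Rightarrow> (\<lambda>x. \<rho> (Suc k) x - \<rho> k x))" for n
  have \<xi>: "\<xi> n \<in> test_functions \<Omega>" for n
    unfolding \<xi>_def by (cases n) (auto intro: test_diff \<rho>\<Omega>)
  have "\<forall>n. \<exists>A\<ge>0. \<forall>\<phi>\<in>test_functions \<Omega>. \<forall>m\<ge>0. (\<forall>x\<in>supp (\<xi> n). dsum N \<phi> x \<le> m) \<longrightarrow> norm (T (\<lambda>x. \<xi> n x * \<phi> x)) \<le> A * m"
    using localized_bound[OF T(2) \<xi>] by blast
  then obtain A where A: "\<And>n. A n \<ge> 0" "\<And>n \<phi> m. \<phi> \<in> test_functions \<Omega> \<Longrightarrow> m \<ge> 0 \<Longrightarrow> (\<And>x. x \<in> supp (\<xi> n) \<Longrightarrow> dsum N \<phi> x \<le> m) \<Longrightarrow>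
      norm (T (\<lambda>x. \<xi> n x * \<phi> x)) \<le> A n * m" by metis
  show thesis
  proof (rule that[of A "\<lambda>n. supp (\<xi> n)"])
    show "supp (\<xi> (Suc n)) \<inter> K n = {}" for n
    proof -
      \<comment> \<open>On \<open>V n\<close> both cutoffs are 1, because the support of
        \<open>\<rho> n\<close> lies in \<open>K (Suc n)\<close>, where
        \<open>\<rho> (Suc n)\<close> is 1.\<close>
      have "\<xi> (Suc n) x = 0" if "x \<notin> - V n" for x
      proof -
        have x: "x \<in> V n" using that by simp
        show ?thesis
        proof (cases "x \<in> supp (\<rho> n)")
          case True
          then have "x \<in> V (Suc n)" using test_functionsD(3)[OF \<rho>[of n]] interior_subset V(2) by blast
          then show ?thesis using V(3) x by (simp add: \<xi>_def)
        next
          case False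
          then show ?thesis using zero_outside_supp[of x "\<rho> n"] V(3)[OF x] by simp
        qed
      qed
      then have "supp (\<xi> (Suc n)) \<subseteq> - V n" using V(1) by (intro supp_subset_closed) auto
      then show ?thesis using V(2) by blast
    qed
    fix \<phi> m k assume \<phi>: "\<phi> \<in> test_functions \<Omega>" "supp \<phi> \<subseteq> K k" and m: "\<And>n. m n \<ge> 0"
      "\<And>n x. x \<in> supp (\<xi> n) \<Longrightarrow> dsum N \<phi> x \<le> m n"
    have tel: "(\<Sum>n\<le>k. \<xi> n x) = \<rho> k x" for k x by (induction k) (auto simp: \<xi>_def)
    \<comment> \<open>The cutoff \<open>\<rho> k\<close> is 1 on the support of
      \<open>\<phi>\<close>, so finitely many shells reproduce \<open>\<phi>\<close>.\<close>
    have "\<rho> k x * \<phi> x = \<phi> x" for x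
      using \<phi>(2) V(2,3) zero_outside_supp[of x \<phi>] by (cases "x \<in> supp \<phi>") force+
    then have \<phi>_eq: "\<phi> = (\<lambda>x. \<Sum>n\<le>k. \<xi> n x * \<phi> x)"
      by (simp only: sum_distrib_right[symmetric] tel)
    have Tsum: "T (\<lambda>x. \<Sum>n\<le>k. \<xi> n x * \<phi> x) = (\<Sum>n\<le>k. T (\<lambda>x. \<xi> n x * \<phi> x))" for k
    proof (induction k)
      case (Suc k)
      have "(\<lambda>x. \<Sum>n\<le>k. \<xi> n x * \<phi> x) \<in> test_functions \<Omega>" "(\<lambda>x. \<xi> (Suc k) x * \<phi> x) \<in> test_functions \<Omega>"
        by (intro test_sum test_mult \<phi>(1) test_functionsD(1)[OF \<xi>])+
      then show ?case using T(1) Suc unfolding linear_on_test_def by simp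
    qed simp
    have "norm (T \<phi>) \<le> (\<Sum>n\<le>k. norm (T (\<lambda>x. \<xi> n x * \<phi> x)))"
      by (subst \<phi>_eq, subst Tsum) (rule norm_sum)
    also have "\<dots> \<le> (\<Sum>n\<le>k. A n * m n)" by (intro sum_mono A(2) \<phi>(1) m)
    finally show "norm (T \<phi>) \<le> (\<Sum>n\<le>k. A n * m n)" .
  qed (use A(1) test_functionsD[OF \<xi>] in auto)
qed

section \<open>The Hahn-Banach theorem for seminorms on function spaces\<close>

definition fun_subspace :: "('a \<Rightarrow> complex) set \<Rightarrow> bool" where
  "fun_subspace X \<longleftrightarrow> (\<lambda>x. 0) \<in> X \<and> (\<forall>f\<in>X. \<forall>g\<in>X. (\<lambda>x. f x + g x) \<in> X) \<and> (\<forall>c. \<forall>f\<in>X. (\<lambda>x. c * f x) \<in> X)"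

definition seminorm_on :: "('a \<Rightarrow> complex) set \<Rightarrow> (('a \<Rightarrow> complex) \<Rightarrow> real) \<Rightarrow> bool" where
  "seminorm_on X q \<longleftrightarrow> (\<forall>f\<in>X. \<forall>g\<in>X. q (\<lambda>x. f x + g x) \<le> q f + q g) \<and> (\<forall>c. \<forall>f\<in>X. q (\<lambda>x. c * f x) = norm c * q f)"

text \<open>A partially defined real linear functional is represented by its graph. Domination by \<open>q\<close>
  forces the graph to be single-valued, so this need not be required.\<close>

definition dominated_graph :: "('a \<Rightarrow> complex) set \<Rightarrow> (('a \<Rightarrow> complex) \<Rightarrow> real) \<Rightarrow> (('a \<Rightarrow> complex) \<times> real) set \<Rightarrow> bool" where
  "dominated_graph X q G \<longleftrightarrow> (\<lambda>x. 0, 0) \<in> G \<and>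
    (\<forall>f a. (f, a) \<in> G \<longrightarrow> f \<in> X \<and> a \<le> q f) \<and>
    (\<forall>f a g b. (f, a) \<in> G \<longrightarrow> (g, b) \<in> G \<longrightarrow> (\<lambda>x. f x + g x, a + b) \<in> G) \<and>
    (\<forall>f a t. (f, a) \<in> G \<longrightarrow> (\<lambda>x. of_real t * f x, t * a) \<in> G)"

lemma dominated_graphD:
  assumes "dominated_graph X q G"
  shows "(\<lambda>x. 0, 0) \<in> G" "(f, a) \<in> G \<Longrightarrow> f \<in> X" "(f, a) \<in> G \<Longrightarrow> a \<le> q f"
    "(f, a) \<in> G \<Longrightarrow> (g, b) \<in> G \<Longrightarrow> (\<lambda>x. f x + g x, a + b) \<in> G"
    "(f, a) \<in> G \<Longrightarrow> (\<lambda>x. of_real t * f x, t * a) \<in> G"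
  using assms unfolding dominated_graph_def by blast+

text \<open>The value at \<open>h\<close> must lie above all \<open>a - q (f - h)\<close> and below
  all \<open>q (g + h) - b\<close>. Subadditivity makes these bounds compatible, and scaling reduces
  a nonzero multiple of \<open>h\<close> to \<open>h\<close> or \<open>- h\<close>.\<close>

lemma dominated_graph_extend:
  assumes X: "fun_subspace X" and q: "seminorm_on X q" and G: "dominated_graph X q G"
    and h: "h \<in> X" "\<And>a. (h, a) \<notin> G"
  shows "\<exists>G'. dominated_graph X q G' \<and> G \<subset> G'"
proof -
  note GD = dominated_graphD[OF G]
  have qadd: "q (\<lambda>x. f x + g x) \<le> q f + q g" if "f \<in> X" "g \<in> X" for f g
    using q that unfolding seminorm_on_def by blast
  have qmul: "q (\<lambda>x. c * f x) = norm c * q f" if "f \<in> X" for c f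
    using q that unfolding seminorm_on_def by blast
  have Xadd: "(\<lambda>x. f x + g x) \<in> X" if "f \<in> X" "g \<in> X" for f g
    using X that unfolding fun_subspace_def by blast
  have Xmul: "(\<lambda>x. c * f x) \<in> X" if "f \<in> X" for c f
    using X that unfolding fun_subspace_def by blast
  have Xsub: "(\<lambda>x. f x - g x) \<in> X" if "f \<in> X" "g \<in> X" for f g
    using Xadd[OF that(1) Xmul[OF that(2), of "- 1"]] by simp
  define L where "L = (\<lambda>(f, a). a - q (\<lambda>x. f x - h x)) ` G"
  have key: "a - q (\<lambda>x. f x - h x) \<le> q (\<lambda>x. g x + h x) - b" if "(f, a) \<in> G" "(g, b) \<in> G" for f a g b
  proof -
    have "a + b \<le> q (\<lambda>x. f x + g x)" using GD(3)[OF GD(4)[OF that]] .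
    also have "(\<lambda>x. f x + g x) = (\<lambda>x. (f x - h x) + (g x + h x))" by auto
    also have "q \<dots> \<le> q (\<lambda>x. f x - h x) + q (\<lambda>x. g x + h x)"
      using that by (intro qadd Xsub Xadd GD(2) h(1))
    finally show ?thesis by simp
  qed
  have bdd: "bdd_above L"
    using key[OF _ GD(1)] by (intro bdd_aboveI[of _ "q (\<lambda>x. 0 + h x) - 0"]) (auto simp: L_def)
  define a0 where "a0 = Sup L"
  have lo: "a - q (\<lambda>x. f x - h x) \<le> a0" if "(f, a) \<in> G" for f a
    unfolding a0_def using that by (intro cSup_upper bdd) (force simp: L_def)
  have hi: "a0 \<le> q (\<lambda>x. g x + h x) - b" if "(g, b) \<in> G" for g b
    unfolding a0_def using key[OF _ that] GD(1) by (intro cSup_least) (auto simp: L_def)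
  define G' where "G' = {(\<lambda>x. f x + of_real t * h x, a + t * a0) | f a t. (f, a) \<in> G}"
  have G'I: "(F, b) \<in> G'" if "(f, a) \<in> G" "F = (\<lambda>x. f x + of_real t * h x)" "b = a + t * a0" for F b f a t
    unfolding G'_def using that by blast
  have dom: "a + t * a0 \<le> q (\<lambda>x. f x + of_real t * h x)" if fa: "(f, a) \<in> G" for f a t
  proof -
    consider "t = 0" | "t > 0" | "t < 0" by linarith
    then show ?thesis
    proof cases
      case 1 then show ?thesis using GD(3)[OF fa] by simp
    next
      case 2
      let ?g = "\<lambda>x. of_real (1/t) * f x"
      have m: "(?g, (1/t) * a) \<in> G" by (rule GD(5)[OF fa])
      have "t * a0 \<le> t * (q (\<lambda>x. ?g x + h x) - (1/t) * a)"
        using hi[OF m] 2 by (intro mult_left_mono) auto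
      also have "\<dots> = t * q (\<lambda>x. ?g x + h x) - a" using 2 by (simp add: field_simps)
      also have "t * q (\<lambda>x. ?g x + h x) = q (\<lambda>x. of_real t * (?g x + h x))"
        using 2 by (subst qmul[OF Xadd[OF GD(2)[OF m] h(1)]]) simp
      also have "(\<lambda>x. of_real t * (?g x + h x)) = (\<lambda>x. f x + of_real t * h x)"
        using 2 by (auto simp: ring_distribs)
      finally show ?thesis by simp
    next
      case 3
      let ?g = "\<lambda>x. of_real (- 1/t) * f x"
      have m: "(?g, (- 1/t) * a) \<in> G" by (rule GD(5)[OF fa])
      define z where "z = q (\<lambda>x. ?g x - h x)"
      have "- t * ((- 1/t) * a - z) \<le> - t * a0"
        using lo[OF m] 3 unfolding z_def by (intro mult_left_mono) auto
      moreover have "- t * ((- 1/t) * a - z) = a + t * z" using 3 by (simp add: algebra_simps)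
      ultimately have "a + t * a0 \<le> - t * q (\<lambda>x. ?g x - h x)" unfolding z_def[symmetric] by linarith
      also have "- t * q (\<lambda>x. ?g x - h x) = q (\<lambda>x. of_real (- t) * (?g x - h x))"
        using 3 by (subst qmul[OF Xsub[OF GD(2)[OF m] h(1)]]) simp
      also have "(\<lambda>x. of_real (- t) * (?g x - h x)) = (\<lambda>x. f x + of_real t * h x)"
        using 3 by (auto simp: ring_distribs)
      finally show ?thesis .
    qed
  qed
  have "dominated_graph X q G'"
    unfolding dominated_graph_def
  proof (intro conjI allI impI)
    show "(\<lambda>x. 0, 0) \<in> G'"
      unfolding G'_def using GD(1) by (force intro!: exI[of _ "\<lambda>x. 0"] exI[of _ "0::real"])
  next
    fix f a assume "(f, a) \<in> G'"
    then show "f \<in> X" "a \<le> q f"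
      using dom GD(2) Xadd Xmul h(1) by (auto simp: G'_def)
  next
    fix f a g b assume "(f, a) \<in> G'" "(g, b) \<in> G'"
    then obtain f' a' t g' b' s where *: "f = (\<lambda>x. f' x + of_real t * h x)" "a = a' + t * a0" "(f', a') \<in> G"
      "g = (\<lambda>x. g' x + of_real s * h x)" "b = b' + s * a0" "(g', b') \<in> G" by (auto simp: G'_def)
    have "(\<lambda>x. f x + g x) = (\<lambda>x. (f' x + g' x) + of_real (t + s) * h x)" "a + b = (a' + b') + (t + s) * a0"
      by (auto simp: * ring_distribs)
    then show "(\<lambda>x. f x + g x, a + b) \<in> G'" by (rule G'I[OF GD(4)[OF *(3,6)]])
  next
    fix f a s assume "(f, a) \<in> G'"
    then obtain f' a' t where *: "f = (\<lambda>x. f' x + of_real t * h x)" "a = a' + t * a0" "(f', a') \<in> G"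
      by (auto simp: G'_def)
    have "(\<lambda>x. of_real s * f x) = (\<lambda>x. of_real s * f' x + of_real (s * t) * h x)" "s * a = s * a' + (s * t) * a0"
      by (auto simp: * ring_distribs)
    then show "(\<lambda>x. of_real s * f x, s * a) \<in> G'" by (rule G'I[OF GD(5)[OF *(3), of s]])
  qed
  moreover have "G \<subseteq> G'"
  proof
    fix z assume z: "z \<in> G"
    obtain f a where fa: "z = (f, a)" by (cases z)
    have "(f, a) \<in> G'" by (rule G'I[of f a _ 0]) (use z fa in auto)
    then show "z \<in> G'" using fa by simp
  qed
  moreover have "(h, a0) \<in> G'"
    by (rule G'I[OF GD(1), of _ 1]) auto
  ultimately show ?thesis using h(2) by blast
qed

text \<open>Zorn's lemma for graphs ordered by inclusion; by the one-step extension a maximal graph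
  has all of \<open>X\<close> as its domain.\<close>

lemma hahn_banach_graph:
  assumes X: "fun_subspace X" and q: "seminorm_on X q" and G0: "dominated_graph X q G0"
  obtains G where "dominated_graph X q G" "G0 \<subseteq> G" "\<And>f. f \<in> X \<Longrightarrow> \<exists>a. (f, a) \<in> G"
proof -
  define \<G> where "\<G> = {G. dominated_graph X q G \<and> G0 \<subseteq> G}"
  have "\<exists>M\<in>\<G>. \<forall>G\<in>\<G>. M \<subseteq> G \<longrightarrow> G = M"
  proof (rule subset_Zorn_nonempty)
    show "\<G> \<noteq> {}" using G0 by (auto simp: \<G>_def)
    fix C assume C: "C \<noteq> {}" "subset.chain \<G> C"
    have CG: "dominated_graph X q G" "G0 \<subseteq> G" if "G \<in> C" for G
      using C(2) that by (auto simp: subset_chain_def \<G>_def)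
    have "dominated_graph X q (\<Union>C)"
      unfolding dominated_graph_def
    proof (intro conjI allI impI)
      show "(\<lambda>x. 0, 0) \<in> \<Union>C" using C(1) CG dominated_graphD(1) by blast
    next
      fix f a assume "(f, a) \<in> \<Union>C"
      then show "f \<in> X" "a \<le> q f" using CG dominated_graphD(2,3) by blast+
    next
      fix f a g b assume "(f, a) \<in> \<Union>C" "(g, b) \<in> \<Union>C"
      then obtain G where G: "G \<in> C" "(f, a) \<in> G" "(g, b) \<in> G"
        using C(2) unfolding subset_chain_def by blast
      show "(\<lambda>x. f x + g x, a + b) \<in> \<Union>C"
        using dominated_graphD(4)[OF CG(1)[OF G(1)] G(2,3)] G(1) by blast
    next
      fix f a t assume "(f, a) \<in> \<Union>C"
      then obtain G where G: "G \<in> C" "(f, a) \<in> G" by blast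
      show "(\<lambda>x. of_real t * f x, t * a) \<in> \<Union>C"
        using dominated_graphD(5)[OF CG(1)[OF G(1)] G(2)] G(1) by blast
    qed
    then show "\<Union>C \<in> \<G>" using C(1) CG(2) by (auto simp: \<G>_def)
  qed
  then obtain M where M: "dominated_graph X q M" "G0 \<subseteq> M" "\<And>G. dominated_graph X q G \<Longrightarrow> G0 \<subseteq> G \<Longrightarrow> M \<subseteq> G \<Longrightarrow> G = M"
    by (auto simp: \<G>_def)
  have "\<exists>a. (f, a) \<in> M" if fX: "f \<in> X" for f
  proof (rule ccontr)
    assume "\<nexists>a. (f, a) \<in> M"
    then obtain G' where "dominated_graph X q G'" "M \<subset> G'"
      using dominated_graph_extend[OF X q M(1) fX] by blast
    then show False using M(2,3) by blast
  qed
  then show thesis using that M(1,2) by blast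
qed

text \<open>The real part of \<open>l\<close> is extended to a real functional \<open>L\<close>, and
  a complex-linear functional is recovered from its real part as
  \<open>L f - \<i> * L (\<i> * f)\<close>.\<close>

theorem hahn_banach_complex:
  assumes X: "fun_subspace X" and q: "seminorm_on X q"
    and Y: "fun_subspace Y" "Y \<subseteq> X"
    and ladd: "\<And>f g. f \<in> Y \<Longrightarrow> g \<in> Y \<Longrightarrow> l (\<lambda>x. f x + g x) = l f + l g"
    and lmul: "\<And>c f. f \<in> Y \<Longrightarrow> l (\<lambda>x. c * f x) = c * l f"
    and lq: "\<And>f. f \<in> Y \<Longrightarrow> norm (l f) \<le> q f"
  obtains S where "\<And>f g. f \<in> X \<Longrightarrow> g \<in> X \<Longrightarrow> S (\<lambda>x. f x + g x) = S f + S g"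
    "\<And>c f. f \<in> X \<Longrightarrow> S (\<lambda>x. c * f x) = c * S f"
    "\<And>f. f \<in> X \<Longrightarrow> norm (S f) \<le> q f"
    "\<And>f. f \<in> Y \<Longrightarrow> S f = l f"
proof -
  have Yadd: "(\<lambda>x. f x + g x) \<in> Y" if "f \<in> Y" "g \<in> Y" for f g
    using Y that unfolding fun_subspace_def by blast
  have Ymul: "(\<lambda>x. c * f x) \<in> Y" if "f \<in> Y" for c f
    using Y that unfolding fun_subspace_def by blast
  have Xadd: "(\<lambda>x. f x + g x) \<in> X" if "f \<in> X" "g \<in> X" for f g
    using X that unfolding fun_subspace_def by blast
  have Xmul: "(\<lambda>x. c * f x) \<in> X" if "f \<in> X" for c f
    using X that unfolding fun_subspace_def by blast
  have qmul: "q (\<lambda>x. c * f x) = norm c * q f" if "f \<in> X" for c f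
    using q that unfolding seminorm_on_def by blast
  define G0 where "G0 = (\<lambda>f. (f, Re (l f))) ` Y"
  have Y0: "(\<lambda>x. 0) \<in> Y" using Y unfolding fun_subspace_def by blast
  have l0: "l (\<lambda>x. 0) = 0" using lmul[OF Y0, of 0] by simp
  have "dominated_graph X q G0"
    unfolding dominated_graph_def G0_def
  proof (intro conjI allI impI)
    show "(\<lambda>x. 0, 0) \<in> (\<lambda>f. (f, Re (l f))) ` Y" using Y0 l0 by force
  qed (use Y(2) ladd lmul Yadd Ymul lq in \<open>auto intro!: order_trans[OF complex_Re_le_cmod]\<close>)
  then obtain G where G: "dominated_graph X q G" "G0 \<subseteq> G" "\<And>f. f \<in> X \<Longrightarrow> \<exists>a. (f, a) \<in> G"
    using hahn_banach_graph[OF X q] by blast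
  note GD = dominated_graphD[OF G(1)]
  \<comment> \<open>The difference of two values at \<open>f\<close> is a value at 0, hence at most
    \<open>q\<close> of the zero function, which is 0.\<close>
  have uniq: "a = b" if "(f, a) \<in> G" "(f, b) \<in> G" for f a b
  proof -
    have le: "a \<le> b" if "(f, a) \<in> G" "(f, b) \<in> G" for f a b
    proof -
      have "(\<lambda>x. f x + of_real (- 1) * f x, a + (- 1) * b) \<in> G"
        by (rule GD(4)[OF that(1) GD(5)[OF that(2)]])
      from GD(3)[OF this] have "a - b \<le> q (\<lambda>x. 0 * f x)" by simp
      then show ?thesis using qmul[OF GD(2)[OF that(1)], of 0] by simp
    qed
    show ?thesis using le[OF that] le[OF that(2,1)] by simp
  qed
  define L where "L f = (THE a. (f, a) \<in> G)" for f
  have L: "L f = a" if "(f, a) \<in> G" for f a unfolding L_def using uniq that by blast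
  have LG: "(f, L f) \<in> G" if "f \<in> X" for f using G(3)[OF that] L by auto
  have Ladd: "L (\<lambda>x. f x + g x) = L f + L g" if "f \<in> X" "g \<in> X" for f g
    by (rule L[OF GD(4)[OF LG LG]]) (use that in auto)
  have Lmul: "L (\<lambda>x. of_real t * f x) = t * L f" if "f \<in> X" for t f
    by (rule L[OF GD(5)[OF LG]]) (use that in auto)
  have Lq: "L f \<le> q f" if "f \<in> X" for f using GD(3)[OF LG[OF that]] .
  have Ll: "L f = Re (l f)" if "f \<in> Y" for f
    using G(2) that by (intro L) (auto simp: G0_def)
  define S where "S f = Complex (L f) (- L (\<lambda>x. \<i> * f x))" for f
  have Sadd: "S (\<lambda>x. f x + g x) = S f + S g" if "f \<in> X" "g \<in> X" for f g
    using Ladd[OF that] Ladd[OF Xmul Xmul, OF that, of \<i> \<i>] by (simp add: S_def complex_eq_iff ring_distribs)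
  have Smul: "S (\<lambda>x. c * f x) = c * S f" if f: "f \<in> X" for c f
  proof -
    have 1: "L (\<lambda>x. (of_real a + of_real b * \<i>) * f x) = a * L f + b * L (\<lambda>x. \<i> * f x)" for a b
      using Ladd[OF Xmul[OF f] Xmul[OF Xmul[OF f]], of "of_real a" "of_real b" \<i>]
        Lmul[OF f, of a] Lmul[OF Xmul[OF f], of b \<i>] by (simp add: ring_distribs mult.assoc)
    have 2: "(\<lambda>x. \<i> * (c * f x)) = (\<lambda>x. (of_real (- Im c) + of_real (Re c) * \<i>) * f x)"
      by (rule ext) (simp add: complex_eq_iff algebra_simps)
    have 3: "(\<lambda>x. c * f x) = (\<lambda>x. (of_real (Re c) + of_real (Im c) * \<i>) * f x)"
      by (rule ext) (simp add: complex_eq_iff algebra_simps)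
    have "L (\<lambda>x. c * f x) = Re c * L f + Im c * L (\<lambda>x. \<i> * f x)"
      unfolding 3 by (rule 1)
    moreover have "L (\<lambda>x. \<i> * (c * f x)) = - Im c * L f + Re c * L (\<lambda>x. \<i> * f x)"
      unfolding 2 by (rule 1)
    ultimately show ?thesis by (simp add: S_def complex_eq_iff)
  qed
  show thesis
  proof (rule that[of S])
    show "norm (S f) \<le> q f" if f: "f \<in> X" for f
    proof (cases "S f = 0")
      case True
      have "0 \<le> q f" using Lq[OF f] Lq[OF Xmul[OF f, of "- 1"]] qmul[OF f, of "- 1"] Lmul[OF f, of "- 1"] by simp
      then show ?thesis using True by simp
    next
      case False
      \<comment> \<open>A rotation that makes \<open>S (u * f)\<close> real, so that it coincides
        with the dominated value \<open>L (u * f)\<close>.\<close>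
      define u where "u = cnj (S f) / of_real (norm (S f))"
      have "S (\<lambda>x. u * f x) = (S f * cnj (S f)) / of_real (norm (S f))"
        unfolding Smul[OF f] by (simp add: u_def mult.commute)
      also have "\<dots> = of_real ((norm (S f))\<^sup>2) / of_real (norm (S f))"
        by (simp only: complex_norm_square)
      also have "\<dots> = of_real (norm (S f))"
        using False by (simp add: power2_eq_square)
      finally have "S (\<lambda>x. u * f x) = of_real (norm (S f))" .
      then have "norm (S f) = L (\<lambda>x. u * f x)" by (simp add: S_def complex_eq_iff)
      also have "\<dots> \<le> q (\<lambda>x. u * f x)" by (rule Lq[OF Xmul[OF f]])
      also have "\<dots> = q f" unfolding qmul[OF f] using False by (simp add: u_def norm_divide)
      finally show ?thesis .
    qed
    show "S f = l f" if "f \<in> Y" for f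
      using Ll[OF that] Ll[OF Ymul[OF that, of \<i>]] by (simp add: S_def complex_eq_iff lmul[OF that])
  qed (use Sadd Smul in auto)
qed

section \<open>Monomial weights and surjectivity\<close>

text \<open>Strict separation leaves a ratio above 1 between the value at \<open>x\<close> and those
  on \<open>L\<close>; a high power, again a monomial, pushes the ratio beyond \<open>A\<close>
  while the values on \<open>L\<close> are scaled to at most 1.\<close>

lemma separating_monomial:
  assumes L: "compact L" and sep: "\<exists>\<eta>. \<forall>y\<in>L. \<bar>xpow \<eta> y\<bar> < \<bar>xpow \<eta> x\<bar>"
  shows "\<exists>c \<eta>. c \<ge> 0 \<and> A < c * \<bar>xpow \<eta> x\<bar> \<and> (\<forall>y\<in>L. c * \<bar>xpow \<eta> y\<bar> \<le> 1)"
proof -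
  have "\<exists>\<eta> s. 0 < s \<and> s < \<bar>xpow \<eta> x\<bar> \<and> (\<forall>y\<in>L. \<bar>xpow \<eta> y\<bar> \<le> s)"
  proof (cases "L = {}")
    \<comment> \<open>The empty set has no maximum; the constant monomial 1 with
      \<open>s = 1/2\<close> serves. This case arises for the innermost shell.\<close>
    case True
    then show ?thesis by (intro exI[of _ "\<lambda>j. 0"] exI[of _ "1/2"]) (simp add: xpow_def)
  next
    case False
    obtain \<eta> where \<eta>: "\<And>y. y \<in> L \<Longrightarrow> \<bar>xpow \<eta> y\<bar> < \<bar>xpow \<eta> x\<bar>" using sep by blast
    have "continuous_on L (\<lambda>y. \<bar>xpow \<eta> y\<bar>)" by (intro continuous_intros continuous_on_xpow)
    then obtain y0 where y0: "y0 \<in> L" "\<And>y. y \<in> L \<Longrightarrow> \<bar>xpow \<eta> y\<bar> \<le> \<bar>xpow \<eta> y0\<bar>"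
      using continuous_attains_sup[OF L False] by blast
    show ?thesis
      using y0(2) \<eta>[OF y0(1)]
      by (intro exI[of _ \<eta>] exI[of _ "(\<bar>xpow \<eta> y0\<bar> + \<bar>xpow \<eta> x\<bar>) / 2"]) (force simp: field_simps)
  qed
  then obtain \<eta> s where s: "0 < s" "s < \<bar>xpow \<eta> x\<bar>" "\<And>y. y \<in> L \<Longrightarrow> \<bar>xpow \<eta> y\<bar> \<le> s" by blast
  have "1 < \<bar>xpow \<eta> x\<bar> / s" using s by simp
  then obtain l where l: "A < (\<bar>xpow \<eta> x\<bar> / s) ^ l" using real_arch_pow by blast
  show ?thesis
  proof (intro exI[of _ "1 / s ^ l"] exI[of _ "\<lambda>j. l * \<eta> j"] conjI ballI)
    show "0 \<le> 1 / s ^ l" using s by simp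
    show "A < 1 / s ^ l * \<bar>xpow (\<lambda>j. l * \<eta> j) x\<bar>" using l by (simp add: xpow_mult power_abs power_divide)
    fix y assume "y \<in> L"
    then have "\<bar>xpow \<eta> y\<bar> ^ l \<le> s ^ l" using s(3) by (intro power_mono) auto
    then show "1 / s ^ l * \<bar>xpow (\<lambda>j. l * \<eta> j) y\<bar> \<le> 1" using s(1) by (simp add: xpow_mult power_abs)
  qed
qed

text \<open>Each separating monomial exceeds \<open>A\<close> near its point, and compactness of
  \<open>Z\<close> leaves finitely many. Finiteness later keeps the supremum of all weights locally
  bounded.\<close>

lemma dominating_monomials:
  fixes Z :: "(real ^ 'n::finite) set"
  assumes L: "compact L" and Z: "compact Z"
    and sep: "\<And>x. x \<in> Z \<Longrightarrow> \<exists>\<eta>. \<forall>y\<in>L. \<bar>xpow \<eta> y\<bar> < \<bar>xpow \<eta> x\<bar>"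
  shows "\<exists>F :: (real \<times> ('n \<Rightarrow> nat)) set. finite F \<and> (\<forall>(c, \<eta>)\<in>F. c \<ge> 0 \<and> (\<forall>y\<in>L. c * \<bar>xpow \<eta> y\<bar> \<le> 1)) \<and>
    (\<forall>x\<in>Z. \<exists>(c, \<eta>)\<in>F. A \<le> c * \<bar>xpow \<eta> x\<bar>)"
proof -
  have "\<forall>x\<in>Z. \<exists>c \<eta>. c \<ge> 0 \<and> A < c * \<bar>xpow \<eta> x\<bar> \<and> (\<forall>y\<in>L. c * \<bar>xpow \<eta> y\<bar> \<le> 1)"
    using separating_monomial[OF L] sep by blast
  then obtain c \<eta> where c: "\<And>x. x \<in> Z \<Longrightarrow> c x \<ge> 0 \<and> A < c x * \<bar>xpow (\<eta> x) x\<bar> \<and> (\<forall>y\<in>L. c x * \<bar>xpow (\<eta> x) y\<bar> \<le> 1)"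
    by metis
  define U where "U x = {y. A < c x * \<bar>xpow (\<eta> x) y\<bar>}" for x
  have "open (U x)" for x
    unfolding U_def by (intro open_Collect_less continuous_intros continuous_on_xpow)
  moreover have "Z \<subseteq> (\<Union>x\<in>Z. U x)" using c by (auto simp: U_def)
  ultimately obtain S where S: "S \<subseteq> Z" "finite S" "Z \<subseteq> (\<Union>x\<in>S. U x)"
    using compactE_image[OF Z, of Z U] by metis
  show ?thesis
  proof (intro exI[of _ "(\<lambda>x. (c x, \<eta> x)) ` S"] conjI)
    show "\<forall>(c, \<eta>)\<in>(\<lambda>x. (c x, \<eta> x)) ` S. c \<ge> 0 \<and> (\<forall>y\<in>L. c * \<bar>xpow \<eta> y\<bar> \<le> 1)" using c S(1) by auto
    show "\<forall>x\<in>Z. \<exists>(c, \<eta>)\<in>(\<lambda>x. (c x, \<eta> x)) ` S. A \<le> c * \<bar>xpow \<eta> x\<bar>"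
    proof
      fix x assume "x \<in> Z"
      then obtain x' where "x' \<in> S" "x \<in> U x'" using S(3) by blast
      then show "\<exists>(c, \<eta>)\<in>(\<lambda>x. (c x, \<eta> x)) ` S. A \<le> c * \<bar>xpow \<eta> x\<bar>"
        by (intro bexI[of _ "(c x', \<eta> x')"]) (auto simp: U_def)
    qed
  qed (use S in simp)
qed

lemma seminorm_on_SUP:
  fixes e :: "'i \<Rightarrow> ('a \<Rightarrow> complex) \<Rightarrow> real"
  assumes X: "fun_subspace X" and I: "I \<noteq> {}"
    and add: "\<And>i f g. i \<in> I \<Longrightarrow> f \<in> X \<Longrightarrow> g \<in> X \<Longrightarrow> e i (\<lambda>x. f x + g x) \<le> e i f + e i g"
    and mul: "\<And>i c f. i \<in> I \<Longrightarrow> f \<in> X \<Longrightarrow> e i (\<lambda>x. c * f x) = norm c * e i f"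
    and bdd: "\<And>f. f \<in> X \<Longrightarrow> bdd_above ((\<lambda>i. e i f) ` I)"
  shows "seminorm_on X (\<lambda>f. SUP i\<in>I. e i f)"
proof -
  have Xmul: "(\<lambda>x. c * f x) \<in> X" if "f \<in> X" for c f
    using X that unfolding fun_subspace_def by blast
  have le: "(SUP i\<in>I. e i (\<lambda>x. c * f x)) \<le> norm c * (SUP i\<in>I. e i f)" if f: "f \<in> X" for c f
    using I by (intro cSUP_least) (auto simp: mul[OF _ f] intro!: mult_left_mono cSUP_upper bdd f)
  show ?thesis
    unfolding seminorm_on_def
  proof (intro conjI ballI allI)
    fix f g assume fg: "f \<in> X" "g \<in> X"
    show "(SUP i\<in>I. e i (\<lambda>x. f x + g x)) \<le> (SUP i\<in>I. e i f) + (SUP i\<in>I. e i g)"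
      using I by (intro cSUP_least order_trans[OF add[OF _ fg]] add_mono cSUP_upper bdd fg) auto
  next
    fix c f assume f: "f \<in> X"
    show "(SUP i\<in>I. e i (\<lambda>x. c * f x)) = norm c * (SUP i\<in>I. e i f)"
    proof (cases "c = 0")
      case True
      have "(SUP i\<in>I. e i (\<lambda>x. c * f x)) = (SUP i\<in>I. 0)"
      proof (rule SUP_cong)
        show "e i (\<lambda>x. c * f x) = 0" if "i \<in> I" for i using mul[OF that f, of c] True by simp
      qed simp
      then show ?thesis using I True by simp
    next
      case False
      have "(SUP i\<in>I. e i (\<lambda>x. inverse c * (c * f x))) \<le> norm (inverse c) * (SUP i\<in>I. e i (\<lambda>x. c * f x))"
        by (rule le[OF Xmul[OF f]])
      moreover have "(\<lambda>x. inverse c * (c * f x)) = f" using False by auto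
      ultimately have "(SUP i\<in>I. e i f) \<le> inverse (norm c) * (SUP i\<in>I. e i (\<lambda>x. c * f x))"
        by (simp only: norm_inverse)
      then have "norm c * (SUP i\<in>I. e i f) \<le> norm c * (inverse (norm c) * (SUP i\<in>I. e i (\<lambda>x. c * f x)))"
        by (rule mult_left_mono) simp
      then have "norm c * (SUP i\<in>I. e i f) \<le> (SUP i\<in>I. e i (\<lambda>x. c * f x))"
        using False by (simp add: mult.assoc[symmetric])
      then show ?thesis using le[OF f, of c] by simp
    qed
  qed
qed

lemma aff_tau: "aff 1 (\<lambda>_. 0) = tau"
  by (simp add: aff_def fun_eq_iff)

lemma tau_uminus: "g \<in> tests \<Longrightarrow> tau j (\<lambda>x. - g x) = (\<lambda>x. - tau j g x)"
  using linopD(3)[OF linop_tau, of g j "- 1"] by simp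

lemma test_imp_tests: "\<phi> \<in> test_functions \<Omega> \<Longrightarrow> \<phi> \<in> tests"
  by (erule test_functions_mono) (rule subset_UNIV)

section \<open>Transposition of Euler operators on distributions\<close>

text \<open>\<open>theta\<close> puts its minus sign outside the functional, \<open>tau\<close>
  inside the argument. Oddness is the fragment of linearity that moves the sign, and
  \<open>theta j R\<close> inherits it.\<close>

definition odd_on :: "(real ^ 'n::finite) set \<Rightarrow> ((real ^ 'n \<Rightarrow> complex) \<Rightarrow> complex) \<Rightarrow> bool" where
  "odd_on \<Omega> R \<longleftrightarrow> (\<forall>g\<in>test_functions \<Omega>. R (\<lambda>x. - g x) = - R g)"

lemma theta_eq:
  assumes "odd_on \<Omega> R" "\<phi> \<in> test_functions \<Omega>"
  shows "theta j R \<phi> = R (tau j \<phi>)"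
proof -
  have "partial j (\<lambda>x. of_real (x $ j) * \<phi> x) \<in> test_functions \<Omega>"
    by (intro test_partial test_mult smooth_coord assms)
  then show ?thesis
    using assms(1) by (simp add: theta_def distr_mult_def distr_partial_def tau_def odd_on_def)
qed

lemma odd_on_theta: "odd_on \<Omega> R \<Longrightarrow> odd_on \<Omega> (theta j R)"
  using theta_eq[of \<Omega> R _ j] unfolding odd_on_def
  by (simp add: tau_uminus test_imp_tests test_uminus tau_test)

lemma theta_funpow:
  "odd_on \<Omega> R \<Longrightarrow> odd_on \<Omega> ((theta j ^^ n) R) \<and> (\<forall>\<phi>\<in>test_functions \<Omega>. (theta j ^^ n) R \<phi> = R ((tau j ^^ n) \<phi>))"
proof (induction n)
  case (Suc n)
  then have "(theta j ^^ Suc n) R \<phi> = R ((tau j ^^ Suc n) \<phi>)" if "\<phi> \<in> test_functions \<Omega>" for \<phi>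
    using that theta_eq[of \<Omega> "(theta j ^^ n) R" \<phi> j] by (simp add: tau_test funpow_swap1)
  then show ?case using Suc by (auto intro: odd_on_theta)
qed simp

lemma theta_foldr:
  assumes "odd_on \<Omega> R"
  shows "odd_on \<Omega> (foldr (\<lambda>j. theta j ^^ a j) js R) \<and>
    (\<forall>\<phi>\<in>test_functions \<Omega>. foldr (\<lambda>j. theta j ^^ a j) js R \<phi> = R (fold (\<lambda>j. tau j ^^ a j) js \<phi>))"
proof (induction js)
  case (Cons j js)
  have "(tau j ^^ n) \<phi> \<in> test_functions \<Omega>" if "\<phi> \<in> test_functions \<Omega>" for n \<phi>
    using that by (induction n) (auto intro: tau_test)
  then show ?case
    using Cons theta_funpow[where \<Omega> = \<Omega> and R = "foldr (\<lambda>j. theta j ^^ a j) js R" and j = j and n = "a j"] by simp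
qed (use assms in simp)

lemma linear_on_test_sum:
  assumes S: "linear_on_test \<Omega> S" and f: "\<And>i. i \<in> I \<Longrightarrow> f i \<in> test_functions \<Omega>"
  shows "S (\<lambda>x. \<Sum>i\<in>I. c i * f i x) = (\<Sum>i\<in>I. c i * S (f i))"
proof -
  have S0: "S (\<lambda>x. 0) = 0"
    using S[unfolded linear_on_test_def, THEN conjunct2, rule_format, OF test_zero, of 0] by simp
  show ?thesis
    using f
  proof (induction I rule: infinite_finite_induct)
    case (insert i I)
    have "(\<lambda>x. \<Sum>i\<in>I. c i * f i x) \<in> test_functions \<Omega>" using insert.prems by (intro test_sum test_cmult) auto
    then show ?case using insert S unfolding linear_on_test_def by (simp add: test_cmult)
  qed (simp_all add: S0)
qed

lemma ev_test:
  assumes "\<phi> \<in> test_functions \<Omega>" shows "ev (aff s a) A p \<phi> \<in> test_functions \<Omega>"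
  unfolding ev_def by (intro test_sum test_cmult mon_mem aff_test assms)

text \<open>This reduces the equation \<open>P(\<theta>) S = T\<close> to prescribing the values of
  \<open>S\<close> on the range of \<open>P(\<tau>)\<close>.\<close>

lemma euler_op_eq:
  assumes S: "linear_on_test \<Omega> S" and \<phi>: "\<phi> \<in> test_functions \<Omega>"
  shows "euler_op P S \<phi> = S (ev (aff 1 (\<lambda>_. 0)) (Poly_Mapping.keys P) (Poly_Mapping.lookup P) \<phi>)"
proof -
  have "S (\<lambda>x. - g x) = - S g" if "g \<in> test_functions \<Omega>" for g
  proof -
    have "S (\<lambda>x. - 1 * g x) = - 1 * S g" using S that unfolding linear_on_test_def by blast
    then show ?thesis by simp
  qed
  then have "odd_on \<Omega> S" by (simp add: odd_on_def)
  then have "theta_pow \<alpha> S \<phi> = S (mon tau (Poly_Mapping.lookup \<alpha>) \<phi>)" for \<alpha>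
    unfolding theta_pow_def mon_def using theta_foldr \<phi> by blast
  moreover have "mon tau \<beta> \<phi> \<in> test_functions \<Omega>" for \<beta>
    by (intro mon_mem tau_test \<phi>)
  ultimately show ?thesis
    unfolding euler_op_def ev_def aff_tau by (simp add: linear_on_test_sum[OF S])
qed

lemma fun_subspace_test: "fun_subspace (test_functions \<Omega>)"
  by (auto simp: fun_subspace_def test_zero test_add test_cmult)

lemma dsum_le_test_seminorm:
  assumes "\<psi> \<in> test_functions \<Omega>" shows "dsum N \<psi> x \<le> test_seminorm N \<psi>"
  unfolding dsum_def test_seminorm_def
proof (rule sum_mono)
  fix js :: "'a list"
  obtain B where "\<And>x. norm (partials js \<psi> x) \<le> B" using test_bounded[OF test_partials[OF assms]] by blast
  then have "bdd_above (range (\<lambda>x. norm (partials js \<psi> x)))" by (intro bdd_aboveI2)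
  then show "norm (partials js \<psi> x) \<le> (SUP x. norm (partials js \<psi> x))" by (rule cSUP_upper2[of _ _ x]) auto
qed

text \<open>The derivatives \<open>ls\<close>, up to the order of \<open>T\<close>, act before the
  fixed block \<open>B\<close> lost in the sup estimate. This is the local part of the seminorm that
  bounds the solution.\<close>

definition tail_dsum :: "nat \<Rightarrow> 'n list \<Rightarrow> (real ^ 'n::finite \<Rightarrow> complex) \<Rightarrow> real ^ 'n \<Rightarrow> real" where
  "tail_dsum N B \<psi> y = (\<Sum>ls | length ls \<le> N. norm (partials (B @ ls) \<psi> y))"

lemma tail_dsum_le: "tail_dsum N B \<psi> y \<le> dsum (N + length B) \<psi> y"
proof -
  have "tail_dsum N B \<psi> y = (\<Sum>js \<in> (\<lambda>ls. B @ ls) ` {ls. length ls \<le> N}. norm (partials js \<psi> y))"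
    unfolding tail_dsum_def by (subst sum.reindex) (auto intro: inj_onI)
  also have "\<dots> \<le> dsum (N + length B) \<psi> y"
    unfolding dsum_def by (intro sum_mono2 finite_lists_le) auto
  finally show ?thesis .
qed

lemma tail_dsum_nonneg: "0 \<le> tail_dsum N B \<psi> y"
  unfolding tail_dsum_def by (intro sum_nonneg) auto

lemma tail_dsum_add: "smooth f \<Longrightarrow> smooth g \<Longrightarrow>
    tail_dsum N B (\<lambda>x. f x + g x) y \<le> tail_dsum N B f y + tail_dsum N B g y"
  unfolding tail_dsum_def sum.distrib[symmetric] by (intro sum_mono) (simp add: partials_add norm_triangle_ineq)

lemma tail_dsum_cmult: "smooth f \<Longrightarrow> tail_dsum N B (\<lambda>x. c * f x) y = norm c * tail_dsum N B f y"
  unfolding tail_dsum_def by (simp add: partials_cmult norm_mult sum_distrib_left)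

lemma tail_dsum_outside: "y \<notin> supp \<psi> \<Longrightarrow> tail_dsum N B \<psi> y = 0"
  unfolding tail_dsum_def
  using subsetD[OF supp_partials] zero_outside_supp by (intro sum.neutral ballI) (simp, blast)

lemma exhaustion_compact_subset:
  fixes K :: "nat \<Rightarrow> (real ^ 'n::finite) set"
  assumes K: "\<And>n. K n \<subseteq> interior (K (Suc n))" "(\<Union>n. K n) = \<Omega>" and C: "compact C" "C \<subseteq> \<Omega>"
  shows "\<exists>k. C \<subseteq> K k"
proof -
  have mono: "K m \<subseteq> K n" if "m \<le> n" for m n
    by (rule lift_Suc_mono_le[OF _ that]) (use K(1) interior_subset in blast)
  have cover: "C \<subseteq> (\<Union>n\<in>UNIV. interior (K (Suc n)))" using K C(2) by blast
  obtain S where S: "finite S" "C \<subseteq> (\<Union>n\<in>S. interior (K (Suc n)))"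
    by (rule compactE_image[OF C(1) _ cover]) auto
  have "interior (K (Suc n)) \<subseteq> K (Suc (Max (insert 0 S)))" if "n \<in> S" for n
    using order_trans[OF interior_subset mono[of "Suc n" "Suc (Max (insert 0 S))"]] S(1) that by simp
  then show ?thesis using S(2) by blast
qed

section \<open>Majorants built from monomials\<close>

text \<open>An analogue of polynomial convexity with single monomials as the separating functions.
  Separation is asked within \<open>\<Omega>\<close>, where all the shells lie.\<close>

definition monomial_exhaustion :: "(real ^ 'n::finite) set \<Rightarrow> (nat \<Rightarrow> (real ^ 'n) set) \<Rightarrow> bool" where
  "monomial_exhaustion \<Omega> K \<longleftrightarrow> (\<forall>n. compact (K n)) \<and> (\<forall>n. K n \<subseteq> interior (K (Suc n))) \<and> (\<Union>n. K n) = \<Omega> \<and>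
    (\<forall>n. \<forall>x\<in>\<Omega> - K n. \<exists>\<eta>. \<forall>y\<in>K n. \<bar>xpow \<eta> y\<bar> < \<bar>xpow \<eta> x\<bar>)"

text \<open>\<open>W\<close> is assembled shell by shell: finitely many weights reach
  \<open>a n\<close> on \<open>Z n\<close> and stay at most 1 on \<open>K (n - 1)\<close>. Their
  total supremum is therefore finite on each \<open>K k\<close> and still dominates the growth of
  \<open>T\<close>.\<close>

lemma finite_order_monomial_bound:
  fixes \<Omega> :: "(real ^ 'n::finite) set"
  assumes ex: "monomial_exhaustion \<Omega> K" and T: "linear_on_test \<Omega> T"
    "\<And>K. compact K \<Longrightarrow> K \<subseteq> \<Omega> \<Longrightarrow> bounded_with_order N \<Omega> K T"
  obtains W :: "(real \<times> ('n \<Rightarrow> nat)) set" where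
    "W \<noteq> {}" "\<And>c \<eta>. (c, \<eta>) \<in> W \<Longrightarrow> c \<ge> 0"
    "\<And>k. \<exists>b\<ge>0. \<forall>y\<in>K k. \<forall>(c, \<eta>)\<in>W. c * \<bar>xpow \<eta> y\<bar> \<le> b"
    "\<And>\<phi> Q. \<phi> \<in> test_functions \<Omega> \<Longrightarrow> Q \<ge> 0 \<Longrightarrow>
      (\<And>c \<eta> x. (c, \<eta>) \<in> W \<Longrightarrow> c * \<bar>xpow \<eta> x\<bar> * dsum N \<phi> x \<le> Q) \<Longrightarrow> norm (T \<phi>) \<le> Q"
proof -
  have K: "\<And>n. compact (K n)" "\<And>n. K n \<subseteq> interior (K (Suc n))" "(\<Union>n. K n) = \<Omega>"
    and sep: "\<And>n x. x \<in> \<Omega> - K n \<Longrightarrow> \<exists>\<eta>. \<forall>y\<in>K n. \<bar>xpow \<eta> y\<bar> < \<bar>xpow \<eta> x\<bar>"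
    using ex unfolding monomial_exhaustion_def by blast+
  have mono: "K m \<subseteq> K n" if "m \<le> n" for m n
    by (rule lift_Suc_mono_le[OF _ that]) (use K(2) interior_subset in blast)
  obtain A :: "nat \<Rightarrow> real" and Z where A: "\<And>n. A n \<ge> 0" and Z: "\<And>n. compact (Z n)" "\<And>n. Z n \<subseteq> \<Omega>" "\<And>n. Z (Suc n) \<inter> K n = {}"
    and dec: "\<And>\<phi> m k. \<phi> \<in> test_functions \<Omega> \<Longrightarrow> supp \<phi> \<subseteq> K k \<Longrightarrow> (\<And>n. m n \<ge> 0) \<Longrightarrow>
      (\<And>n x. x \<in> Z n \<Longrightarrow> dsum N \<phi> x \<le> m n) \<Longrightarrow> norm (T \<phi>) \<le> (\<Sum>n\<le>k. A n * m n)"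
  proof (rule shell_decomposition[of K \<Omega> T N], goal_cases)
    case 1 show ?case by (rule K(1))
  next
    case 2 show ?case by (rule K(2))
  next
    case 3 show ?case by (rule K(3))
  next
    case 4 show ?case by (rule T(1))
  next
    case (5 C)
    show ?case using 5(2,3) by (rule T(2))
  next
    case (6 A Z)
    show thesis by (rule that[of A Z]) (use 6(2-) in blast)+
  qed
  \<comment> \<open>The factor \<open>2 ^ Suc n\<close> makes the shell contributions sum to less
    than 1; adding 1 to \<open>A n\<close> keeps \<open>a n\<close> positive.\<close>
  define a where "a n = 2 ^ Suc n * (A n + 1)" for n
  have a: "a n > 0" for n using A[of n] by (simp add: a_def add_nonneg_pos)
  \<comment> \<open>Shell \<open>n\<close> is disjoint from \<open>K (n - 1)\<close>, so the
    smallness condition is shifted by one; shell 0 has nothing inside it.\<close>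
  define L where "L n = (case n of 0 \<Rightarrow> {} | Suc k \<Rightarrow> K k)" for n
  have L: "compact (L n)" for n using K(1) by (cases n) (auto simp: L_def)
  have "\<exists>F :: (real \<times> ('n \<Rightarrow> nat)) set. finite F \<and> (\<forall>(c, \<eta>)\<in>F. c \<ge> 0 \<and> (\<forall>y\<in>L n. c * \<bar>xpow \<eta> y\<bar> \<le> 1)) \<and>
      (\<forall>x\<in>Z n. \<exists>(c, \<eta>)\<in>F. a n \<le> c * \<bar>xpow \<eta> x\<bar>)" for n
  proof (rule dominating_monomials[OF L Z(1)])
    fix x assume x: "x \<in> Z n"
    show "\<exists>\<eta>. \<forall>y\<in>L n. \<bar>xpow \<eta> y\<bar> < \<bar>xpow \<eta> x\<bar>"
    proof (cases n)
      case (Suc k)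
      then have "x \<in> \<Omega> - K k" using x Z(2,3) by blast
      then show ?thesis using sep[of x k] Suc by (simp add: L_def)
    qed (simp add: L_def)
  qed
  then have "\<forall>n. \<exists>F :: (real \<times> ('n \<Rightarrow> nat)) set. finite F \<and> (\<forall>(c, \<eta>)\<in>F. c \<ge> 0 \<and> (\<forall>y\<in>L n. c * \<bar>xpow \<eta> y\<bar> \<le> 1)) \<and>
      (\<forall>x\<in>Z n. \<exists>(c, \<eta>)\<in>F. a n \<le> c * \<bar>xpow \<eta> x\<bar>)" by blast
  from choice[OF this] obtain F :: "nat \<Rightarrow> (real \<times> ('n \<Rightarrow> nat)) set" where
    F': "\<forall>n. finite (F n) \<and> (\<forall>(c, \<eta>)\<in>F n. c \<ge> 0 \<and> (\<forall>y\<in>L n. c * \<bar>xpow \<eta> y\<bar> \<le> 1)) \<and>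
      (\<forall>x\<in>Z n. \<exists>(c, \<eta>)\<in>F n. a n \<le> c * \<bar>xpow \<eta> x\<bar>)" by blast
  have F: "finite (F n)" "(c, \<eta>) \<in> F n \<Longrightarrow> c \<ge> 0" "(c, \<eta>) \<in> F n \<Longrightarrow> y \<in> L n \<Longrightarrow> c * \<bar>xpow \<eta> y\<bar> \<le> 1"
    "x \<in> Z n \<Longrightarrow> \<exists>c \<eta>. (c, \<eta>) \<in> F n \<and> a n \<le> c * \<bar>xpow \<eta> x\<bar>" for n c \<eta> x y
    using F'[rule_format, of n] by (auto dest!: bspec)
  \<comment> \<open>The zero weight guarantees that \<open>W\<close> is nonempty, as required for
    the supremum that defines the seminorm.\<close>
  define W where "W = insert (0, \<lambda>_. 0) (\<Union>n. F n)"
  show thesis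
  proof (rule that[of W])
    show "W \<noteq> {}" by (simp add: W_def)
    show "c \<ge> 0" if "(c, \<eta>) \<in> W" for c \<eta> using that F(2) by (auto simp: W_def)
    show "\<exists>b\<ge>0. \<forall>y\<in>K k. \<forall>(c, \<eta>)\<in>W. c * \<bar>xpow \<eta> y\<bar> \<le> b" for k
    proof -
      have "\<exists>b\<ge>0. \<forall>y\<in>K k. c * \<bar>xpow \<eta> y\<bar> \<le> b" for c \<eta>
      proof -
        have "compact ((\<lambda>y. c * \<bar>xpow \<eta> y\<bar>) ` K k)"
          by (intro compact_continuous_image K(1) continuous_intros continuous_on_xpow)
        then obtain b where b: "\<forall>z\<in>(\<lambda>y. c * \<bar>xpow \<eta> y\<bar>) ` K k. norm z \<le> b"
          using compact_imp_bounded bounded_iff by metis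
        then show ?thesis by (intro exI[of _ "max b 0"]) auto
      qed
      then obtain b :: "real \<Rightarrow> ('n \<Rightarrow> nat) \<Rightarrow> real" where b: "\<And>c \<eta>. b c \<eta> \<ge> 0" "\<And>c \<eta> y. y \<in> K k \<Longrightarrow> c * \<bar>xpow \<eta> y\<bar> \<le> b c \<eta>"
        by metis
      \<comment> \<open>On \<open>K k\<close> the weights from shells beyond \<open>k\<close> are at
        most 1; those collected here are finite in number.\<close>
      define H where "H = (\<Union>n\<le>k. F n)"
      have H: "finite H" unfolding H_def using F(1) by blast
      have "c * \<bar>xpow \<eta> y\<bar> \<le> 1 + (\<Sum>z\<in>H. b (fst z) (snd z))" if y: "y \<in> K k" and W: "(c, \<eta>) \<in> W" for y c \<eta>
      proof -
        have S0: "0 \<le> (\<Sum>z\<in>H. b (fst z) (snd z))" using b(1) by (intro sum_nonneg)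
        consider "(c, \<eta>) \<in> H" | "c = 0" | n where "n > k" "(c, \<eta>) \<in> F n"
          using W not_le unfolding W_def H_def by blast
        then show ?thesis
        proof cases
          case 1
          have "b c \<eta> \<le> (\<Sum>z\<in>H. b (fst z) (snd z))"
            using member_le_sum[of "(c, \<eta>)" H "\<lambda>z. b (fst z) (snd z)"] 1 H b(1) by simp
          then show ?thesis using b(2)[OF y, of c \<eta>] by linarith
        next
          case 2
          then show ?thesis using S0 by simp
        next
          case 3
          then obtain n' where n': "n = Suc n'" "k \<le> n'" by (cases n) auto
          then have "y \<in> L n" using mono[of k n'] y by (auto simp: L_def)
          then show ?thesis using F(3)[OF 3(2)] S0 by fastforce
        qed
      qed
      moreover have "0 \<le> 1 + (\<Sum>z\<in>H. b (fst z) (snd z))" using b(1) by (intro add_nonneg_nonneg sum_nonneg) auto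
      ultimately show ?thesis by blast
    qed
    fix \<phi> Q assume \<phi>: "\<phi> \<in> test_functions \<Omega>" and Q: "Q \<ge> 0"
      and hyp: "\<And>c \<eta> x. (c, \<eta>) \<in> W \<Longrightarrow> c * \<bar>xpow \<eta> x\<bar> * dsum N \<phi> x \<le> Q"
    obtain k where k: "supp \<phi> \<subseteq> K k"
      using exhaustion_compact_subset[OF K(2,3)] test_functionsD[OF \<phi>] by blast
    have "norm (T \<phi>) \<le> (\<Sum>n\<le>k. A n * (Q / a n))"
    proof (rule dec[OF \<phi> k])
      show "0 \<le> Q / a n" for n using Q a[of n] by simp
      fix n x assume "x \<in> Z n"
      then obtain c \<eta> where c: "(c, \<eta>) \<in> F n" "a n \<le> c * \<bar>xpow \<eta> x\<bar>" using F(4) by blast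
      have "a n * dsum N \<phi> x \<le> c * \<bar>xpow \<eta> x\<bar> * dsum N \<phi> x"
        by (intro mult_right_mono c dsum_nonneg)
      also have "\<dots> \<le> Q" using c(1) by (intro hyp) (auto simp: W_def)
      finally show "dsum N \<phi> x \<le> Q / a n" using a[of n] by (simp add: field_simps)
    qed
    also have "\<dots> \<le> (\<Sum>n\<le>k. Q * (1/2) ^ Suc n)"
    proof (rule sum_mono)
      fix n
      have "A n / (A n + 1) \<le> 1" using A[of n] by simp
      then have "Q * (1/2) ^ Suc n * (A n / (A n + 1)) \<le> Q * (1/2) ^ Suc n * 1"
        using Q by (intro mult_left_mono) auto
      then show "A n * (Q / a n) \<le> Q * (1/2) ^ Suc n"
        by (simp add: a_def field_simps power_divide)
    qed
    also have "\<dots> = Q * (\<Sum>n\<le>k. (1/2) ^ Suc n)" by (simp add: sum_distrib_left)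
    also have "(\<Sum>n\<le>k. (1/2::real) ^ Suc n) = 1 - (1/2) ^ Suc k"
      by (induction k) (simp_all add: field_simps)
    also have "Q * (1 - (1/2) ^ Suc k) \<le> Q * 1" using Q by (intro mult_left_mono) auto
    finally show "norm (T \<phi>) \<le> Q" by simp
  qed
qed

text \<open>By the estimate \<open>P(\<tau>) \<phi>\<close> determines \<open>T \<phi>\<close>, so a
  functional bounded by \<open>q\<close> is defined on the range of \<open>P(\<tau>)\<close>, and
  Hahn-Banach extends it with the same bound.\<close>

lemma surjective_from_estimate:
  fixes P :: "'n::{finite,linorder} cpoly"
  assumes T: "linear_on_test \<Omega> T" and q: "seminorm_on (test_functions \<Omega>) q"
    and est: "\<And>\<phi>. \<phi> \<in> test_functions \<Omega> \<Longrightarrow>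
      norm (T \<phi>) \<le> q (ev (aff 1 (\<lambda>_. 0)) (Poly_Mapping.keys P) (Poly_Mapping.lookup P) \<phi>)"
  obtains S where "linear_on_test \<Omega> S" "\<And>\<phi>. \<phi> \<in> test_functions \<Omega> \<Longrightarrow> norm (S \<phi>) \<le> q \<phi>"
    "\<And>\<phi>. \<phi> \<in> test_functions \<Omega> \<Longrightarrow> euler_op P S \<phi> = T \<phi>"
proof -
  let ?X = "test_functions \<Omega>"
  let ?P = "ev (aff 1 (\<lambda>_. 0)) (Poly_Mapping.keys P) (Poly_Mapping.lookup P)"
  have lin: "linop ?P" by (intro linop_ev linop_aff)
  have Padd: "?P (\<lambda>x. f x + g x) = (\<lambda>x. ?P f x + ?P g x)" if "f \<in> ?X" "g \<in> ?X" for f g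
    by (rule linopD(2)[OF lin]) (use that test_imp_tests in blast)+
  have Pmul: "?P (\<lambda>x. c * f x) = (\<lambda>x. c * ?P f x)" if "f \<in> ?X" for c f
    by (rule linopD(3)[OF lin]) (use that test_imp_tests in blast)
  have PX: "?P f \<in> ?X" if "f \<in> ?X" for f using that by (rule ev_test)
  have Tadd: "T (\<lambda>x. f x + g x) = T f + T g" if "f \<in> ?X" "g \<in> ?X" for f g
    using T that unfolding linear_on_test_def by blast
  have Tmul: "T (\<lambda>x. c * f x) = c * T f" if "f \<in> ?X" for c f
    using T that unfolding linear_on_test_def by blast
  have qmul: "q (\<lambda>x. c * f x) = norm c * q f" if "f \<in> ?X" for c f
    using q that unfolding seminorm_on_def by blast
  define Y where "Y = ?P ` ?X"
  \<comment> \<open>Any preimage may be chosen: by the estimate, \<open>T\<close> vanishes on the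
    difference of two preimages.\<close>
  define l where "l \<psi> = T (SOME \<phi>. \<phi> \<in> ?X \<and> ?P \<phi> = \<psi>)" for \<psi>
  have l: "l (?P \<phi>) = T \<phi>" if \<phi>: "\<phi> \<in> ?X" for \<phi>
  proof -
    define \<phi>' where "\<phi>' = (SOME \<phi>'. \<phi>' \<in> ?X \<and> ?P \<phi>' = ?P \<phi>)"
    have \<phi>': "\<phi>' \<in> ?X" "?P \<phi>' = ?P \<phi>"
      unfolding \<phi>'_def using someI[of "\<lambda>\<phi>'. \<phi>' \<in> ?X \<and> ?P \<phi>' = ?P \<phi>" \<phi>] \<phi> by auto
    let ?d = "\<lambda>x. \<phi>' x + (- 1) * \<phi> x"
    have d: "?d \<in> ?X" by (intro test_add test_cmult \<phi> \<phi>')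
    have "?P ?d = (\<lambda>x. ?P \<phi>' x + (- 1) * ?P \<phi> x)"
      using Padd[OF \<phi>'(1) test_cmult[OF \<phi>, of "- 1"]] Pmul[OF \<phi>, of "- 1"] by simp
    then have "?P ?d = (\<lambda>x. 0 * ?P \<phi> x)" by (simp add: \<phi>'(2))
    then have "norm (T ?d) \<le> q (\<lambda>x. 0 * ?P \<phi> x)" using est[OF d] by simp
    then have "T ?d = 0" using qmul[OF PX[OF \<phi>], of 0] by simp
    then have "T \<phi>' = T \<phi>"
      using Tadd[OF \<phi>'(1) test_cmult[OF \<phi>, of "- 1"]] Tmul[OF \<phi>, of "- 1"] by simp
    then show ?thesis by (simp add: l_def \<phi>'_def)
  qed
  have Ysub: "fun_subspace Y"
    unfolding fun_subspace_def
  proof (intro conjI ballI allI)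
    show "(\<lambda>x. 0) \<in> Y"
      using Pmul[OF test_zero, of 0] test_zero[of \<Omega>] unfolding Y_def by (intro image_eqI[of _ _ "\<lambda>x. 0"]) auto
    fix f g assume "f \<in> Y" "g \<in> Y"
    then obtain f' g' where "f = ?P f'" "g = ?P g'" "f' \<in> ?X" "g' \<in> ?X" by (auto simp: Y_def)
    then show "(\<lambda>x. f x + g x) \<in> Y"
      unfolding Y_def by (intro image_eqI[of _ _ "\<lambda>x. f' x + g' x"]) (auto simp: Padd test_add)
  next
    fix c f assume "f \<in> Y"
    then obtain f' where "f = ?P f'" "f' \<in> ?X" by (auto simp: Y_def)
    then show "(\<lambda>x. c * f x) \<in> Y"
      unfolding Y_def by (intro image_eqI[of _ _ "\<lambda>x. c * f' x"]) (auto simp: Pmul test_cmult)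
  qed
  have YX: "Y \<subseteq> ?X" using PX by (auto simp: Y_def)
  have ladd: "l (\<lambda>x. f x + g x) = l f + l g" if fgY: "f \<in> Y" "g \<in> Y" for f g
  proof -
    obtain f' g' where fg: "f = ?P f'" "g = ?P g'" "f' \<in> ?X" "g' \<in> ?X" using fgY by (auto simp: Y_def)
    then show ?thesis using l[OF test_add[OF fg(3,4)]] by (simp add: Padd l Tadd)
  qed
  have lmul: "l (\<lambda>x. c * f x) = c * l f" if fY: "f \<in> Y" for c f
  proof -
    obtain f' where f: "f = ?P f'" "f' \<in> ?X" using fY by (auto simp: Y_def)
    then show ?thesis using l[OF test_cmult[OF f(2), of c]] by (simp add: Pmul l Tmul)
  qed
  have lq: "norm (l f) \<le> q f" if "f \<in> Y" for f
    using that est l by (auto simp: Y_def)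
  obtain S where S: "\<And>f g. f \<in> ?X \<Longrightarrow> g \<in> ?X \<Longrightarrow> S (\<lambda>x. f x + g x) = S f + S g"
    "\<And>c f. f \<in> ?X \<Longrightarrow> S (\<lambda>x. c * f x) = c * S f" "\<And>f. f \<in> ?X \<Longrightarrow> norm (S f) \<le> q f" "\<And>f. f \<in> Y \<Longrightarrow> S f = l f"
    by (rule hahn_banach_complex[OF fun_subspace_test q Ysub YX ladd lmul lq]) (assumption+, rule that, assumption+)
  have linS: "linear_on_test \<Omega> S" using S by (auto simp: linear_on_test_def)
  show thesis
  proof (rule that[OF linS S(3)])
    show "euler_op P S \<phi> = T \<phi>" if "\<phi> \<in> ?X" for \<phi>
      using euler_op_eq[OF linS that] S(4)[of "?P \<phi>"] l[OF that] that by (simp add: Y_def)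
  qed
qed

text \<open>The seminorm \<open>q\<close> is a supremum over all weights in \<open>W\<close> and all
  points. Since the sup estimate is uniform in \<open>\<eta>\<close>, it turns the majorant of
  \<open>T \<phi>\<close> into a multiple of \<open>q (P(\<tau>) \<phi>)\<close>. The solution has
  order at most \<open>N + length B\<close> on every compact set.\<close>

theorem euler_surjective_monomial_exhaustion:
  fixes P :: "'n::{finite,linorder} cpoly"
  assumes P: "P \<noteq> 0" and ex: "monomial_exhaustion \<Omega> K"
  shows "euler_surjective_on P \<Omega>"
  unfolding euler_surjective_on_def
proof
  fix T assume "T \<in> finite_order_distributions \<Omega>"
  then obtain N where T: "linear_on_test \<Omega> T" "\<And>K. compact K \<Longrightarrow> K \<subseteq> \<Omega> \<Longrightarrow> bounded_with_order N \<Omega> K T"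
    by (auto simp: finite_order_distributions_def distributions_def)
  let ?X = "test_functions \<Omega>"
  let ?A = "Poly_Mapping.keys P" and ?p = "Poly_Mapping.lookup P"
  let ?P = "ev (aff 1 (\<lambda>_. 0)) ?A ?p"
  obtain W :: "(real \<times> ('n \<Rightarrow> nat)) set" where
    W: "W \<noteq> {}" "\<And>c \<eta>. (c, \<eta>) \<in> W \<Longrightarrow> c \<ge> 0"
    "\<And>k. \<exists>b\<ge>0. \<forall>y\<in>K k. \<forall>(c, \<eta>)\<in>W. c * \<bar>xpow \<eta> y\<bar> \<le> b"
    "\<And>\<phi> Q. \<phi> \<in> ?X \<Longrightarrow> Q \<ge> 0 \<Longrightarrow>
      (\<And>c \<eta> x. (c, \<eta>) \<in> W \<Longrightarrow> c * \<bar>xpow \<eta> x\<bar> * dsum N \<phi> x \<le> Q) \<Longrightarrow> norm (T \<phi>) \<le> Q"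
    using finite_order_monomial_bound[OF ex T] by blast
  have Pne: "?A \<noteq> {}" using P by simp
  have Pnz: "?p \<alpha> \<noteq> 0" if "\<alpha> \<in> ?A" for \<alpha> using that by (simp add: in_keys_iff)
  obtain C :: real and r :: nat and B :: "'n list" where C: "C \<ge> 0" and key: "\<And>c f \<eta> x. f \<in> tests \<Longrightarrow>
      (\<And>y. \<bar>xpow \<eta> y\<bar> * jw y ^ r * norm (partials B (ev (aff 1 c) ?A ?p f) y) \<le> 1) \<Longrightarrow>
      \<bar>xpow \<eta> x\<bar> * norm (f x) \<le> C"
  proof (rule weighted_sup_estimate[of ?A ?p, OF finite_keys Pne], goal_cases)
    case (1 \<alpha>)
    show ?case using 1(2) by (rule Pnz)
  next
    case (2 C r B)
    show thesis by (rule that[of C r B]) (use 2(2-) in blast)+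
  qed
  \<comment> \<open>The homogeneous form of the sup estimate, by scaling. Strictly larger
    \<open>M'\<close> avoid division by 0 when \<open>M = 0\<close>; letting them decrease to
    \<open>M\<close> gives the claim.\<close>
  have key': "\<bar>xpow \<eta> x\<bar> * norm (f x) \<le> C * M"
    if f: "f \<in> tests" and M: "M \<ge> 0" and hyp: "\<And>y. \<bar>xpow \<eta> y\<bar> * jw y ^ r * norm (partials B (ev (aff 1 c) ?A ?p f) y) \<le> M"
    for c f \<eta> x M
  proof -
    have scaled: "\<bar>xpow \<eta> x\<bar> * norm (f x) \<le> C * M'" if M': "M' > M" for M'
    proof -
      have M'0: "M' > 0" using M M' by simp
      define t where "t = complex_of_real (1 / M')"
      have "ev (aff 1 c) ?A ?p (\<lambda>x. t * f x) = (\<lambda>x. t * ev (aff 1 c) ?A ?p f x)"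
        by (rule linopD(3)[OF linop_ev[OF linop_aff] f])
      then have "partials B (ev (aff 1 c) ?A ?p (\<lambda>x. t * f x)) = (\<lambda>y. t * partials B (ev (aff 1 c) ?A ?p f) y)"
        using partials_cmult[OF test_functionsD(1)[OF ev_test[OF f]]] by metis
      then have "\<bar>xpow \<eta> y\<bar> * jw y ^ r * norm (partials B (ev (aff 1 c) ?A ?p (\<lambda>x. t * f x)) y) \<le> 1" for y
        using hyp[of y] M' M'0 by (simp add: t_def norm_mult norm_divide field_simps)
      from key[OF test_cmult[OF f] this, of x] show ?thesis
        using M'0 by (simp add: t_def norm_mult norm_divide field_simps)
    qed
    show ?thesis
    proof (rule field_le_epsilon)
      fix e :: real assume e: "e > 0"
      have "\<bar>xpow \<eta> x\<bar> * norm (f x) \<le> C * (M + e / (C + 1))"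
        using e C by (intro scaled) simp
      also have "\<dots> = C * M + (C / (C + 1)) * e" by (simp add: algebra_simps)
      also have "(C / (C + 1)) * e \<le> 1 * e" using C e by (intro mult_right_mono) auto
      finally show "\<bar>xpow \<eta> x\<bar> * norm (f x) \<le> C * M + e" by simp
    qed
  qed
  define e where "e = (\<lambda>((c, \<eta>), y) \<psi>. c * \<bar>xpow \<eta> y\<bar> * jw y ^ r * tail_dsum N B \<psi> y)"
  define q where "q \<psi> = (SUP i\<in>W \<times> UNIV. e i \<psi>)" for \<psi>
  have jw0: "0 \<le> jw y ^ r" for y :: "(real, 'n) vec" using jw_ge_1[of y] by simp
  have Kc: "compact (K k)" for k using ex by (simp add: monomial_exhaustion_def)
  \<comment> \<open>The weights of \<open>W\<close> are uniformly bounded on each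
    \<open>K k\<close>. This makes the supremum \<open>q\<close> finite on test functions and later
    gives the continuity of the solution.\<close>
  have ebound: "\<exists>D\<ge>0. \<forall>\<psi>\<in>?X. supp \<psi> \<subseteq> K k \<longrightarrow> (\<forall>i\<in>W \<times> UNIV. e i \<psi> \<le> D * test_seminorm (N + length B) \<psi>)" for k
  proof -
    obtain b where b: "b \<ge> 0" "\<And>y c \<eta>. y \<in> K k \<Longrightarrow> (c, \<eta>) \<in> W \<Longrightarrow> c * \<bar>xpow \<eta> y\<bar> \<le> b" using W(3)[of k] by blast
    have "compact ((\<lambda>y. jw y ^ r) ` K k)"
      by (intro compact_continuous_image Kc continuous_intros continuous_on_jw)
    then obtain h where h: "\<forall>z\<in>(\<lambda>y. jw y ^ r) ` K k. norm z \<le> h"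
      using compact_imp_bounded bounded_iff by metis
    have h': "jw y ^ r \<le> max h 0" if "y \<in> K k" for y using h that by fastforce
    show ?thesis
    proof (intro exI[of _ "b * max h 0"] conjI ballI impI)
      show "0 \<le> b * max h 0" using b(1) by simp
      fix \<psi> i assume \<psi>: "\<psi> \<in> ?X" "supp \<psi> \<subseteq> K k" and i: "i \<in> W \<times> (UNIV :: (real, 'n) vec set)"
      obtain c \<eta> y where i_eq: "i = ((c, \<eta>), y)" "(c, \<eta>) \<in> W" using i by (cases i) auto
      have t: "tail_dsum N B \<psi> y \<le> test_seminorm (N + length B) \<psi>"
        using tail_dsum_le dsum_le_test_seminorm[OF \<psi>(1)] by (rule order_trans)
      have t0: "0 \<le> test_seminorm (N + length B) \<psi>" using t tail_dsum_nonneg[of N B \<psi> y] by linarith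
      show "e i \<psi> \<le> b * max h 0 * test_seminorm (N + length B) \<psi>"
      proof (cases "y \<in> K k")
        case True
        have "e i \<psi> = c * \<bar>xpow \<eta> y\<bar> * jw y ^ r * tail_dsum N B \<psi> y" by (simp add: e_def i_eq)
        also have "\<dots> \<le> b * max h 0 * test_seminorm (N + length B) \<psi>"
          by (intro mult_mono b(2)[OF True i_eq(2)] h'[OF True] t b(1) jw0 tail_dsum_nonneg mult_nonneg_nonneg) auto
        finally show ?thesis .
      next
        case False
        then have "tail_dsum N B \<psi> y = 0" using \<psi>(2) by (intro tail_dsum_outside) auto
        then show ?thesis using b(1) t0 by (simp add: e_def i_eq)
      qed
    qed
  qed
  have exK: "\<exists>k. C \<subseteq> K k" if "compact C" "C \<subseteq> \<Omega>" for C
    using exhaustion_compact_subset[of K \<Omega> C] ex that unfolding monomial_exhaustion_def by blast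
  have bdd: "bdd_above ((\<lambda>i. e i \<psi>) ` (W \<times> UNIV))" if \<psi>: "\<psi> \<in> ?X" for \<psi>
  proof -
    obtain k where "supp \<psi> \<subseteq> K k" using exK test_functionsD[OF \<psi>] by blast
    then show ?thesis using ebound[of k] \<psi> by (meson bdd_aboveI2)
  qed
  have ne: "W \<times> (UNIV :: (real, 'n) vec set) \<noteq> {}" using W(1) by simp
  have e0: "0 \<le> e ((c, \<eta>), y) \<psi>" if "(c, \<eta>) \<in> W" for c \<eta> y \<psi>
    unfolding e_def using W(2)[OF that] by (simp add: jw0 tail_dsum_nonneg)
  have ub: "e i \<psi> \<le> q \<psi>" if "\<psi> \<in> ?X" "i \<in> W \<times> UNIV" for i \<psi>
    unfolding q_def using that by (intro cSUP_upper bdd)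
  obtain w0 where w0: "w0 \<in> W" using W(1) by blast
  have q0: "0 \<le> q \<psi>" if "\<psi> \<in> ?X" for \<psi>
    using ub[OF that, of "(w0, 0)"] e0[of "fst w0" "snd w0" 0 \<psi>] w0 by simp
  have q: "seminorm_on ?X q"
    unfolding q_def[abs_def]
  proof (rule seminorm_on_SUP[OF fun_subspace_test ne _ _ bdd])
    fix i :: "(real \<times> ('n \<Rightarrow> nat)) \<times> (real, 'n) vec" and f g :: "(real, 'n) vec \<Rightarrow> complex"
    assume i: "i \<in> W \<times> UNIV" and f: "f \<in> ?X" and g: "g \<in> ?X"
    obtain c \<eta> y where i_eq: "i = ((c, \<eta>), y)" "(c, \<eta>) \<in> W" using i by (cases i) auto
    have "c * \<bar>xpow \<eta> y\<bar> * jw y ^ r * tail_dsum N B (\<lambda>x. f x + g x) y \<le>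
       c * \<bar>xpow \<eta> y\<bar> * jw y ^ r * (tail_dsum N B f y + tail_dsum N B g y)"
      using W(2)[OF i_eq(2)] jw0[of y] test_functionsD(1)[OF f] test_functionsD(1)[OF g]
      by (intro mult_left_mono tail_dsum_add) auto
    then show "e i (\<lambda>x. f x + g x) \<le> e i f + e i g" by (simp add: e_def i_eq distrib_left)
  next
    fix i :: "(real \<times> ('n \<Rightarrow> nat)) \<times> (real, 'n) vec" and a and f :: "(real, 'n) vec \<Rightarrow> complex"
    assume "f \<in> ?X"
    then show "e i (\<lambda>x. a * f x) = norm a * e i f"
      by (cases i) (auto simp: e_def tail_dsum_cmult[OF test_functionsD(1)] split: prod.splits)
  qed
  define C' where "C' = real (card {ls :: 'n list. length ls \<le> N}) * C"
  have C': "C' \<ge> 0" using C by (simp add: C'_def)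
  have est: "norm (T \<phi>) \<le> C' * q (?P \<phi>)" if \<phi>: "\<phi> \<in> ?X" for \<phi>
  proof (rule W(4)[OF \<phi>])
    have P\<phi>: "?P \<phi> \<in> ?X" by (rule ev_test[OF \<phi>])
    show "0 \<le> C' * q (?P \<phi>)" using C' q0[OF P\<phi>] by simp
    fix c \<eta> x assume c\<eta>: "(c, \<eta>) \<in> W"
    have one: "c * \<bar>xpow \<eta> x\<bar> * norm (partials ls \<phi> x) \<le> C * q (?P \<phi>)" if ls: "length ls \<le> N" for ls
    \<comment> \<open>The factor \<open>c\<close> is divided out below to apply \<open>key'\<close>
      to the bare monomial, so a zero weight is treated apart.\<close>
    proof (cases "c = 0")
      case True
      then show ?thesis using C q0[OF P\<phi>] by simp
    next
      case False
      then have c: "c > 0" using W(2)[OF c\<eta>] by simp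
      have f: "partials ls \<phi> \<in> tests" by (rule test_imp_tests[OF test_partials[OF \<phi>]])
      have "\<bar>xpow \<eta> x\<bar> * norm (partials ls \<phi> x) \<le> C * (q (?P \<phi>) / c)"
      proof (rule key'[OF f])
        show "0 \<le> q (?P \<phi>) / c" using q0[OF P\<phi>] c by simp
        fix y
        have "norm (partials B (partials ls (?P \<phi>)) y) \<le> tail_dsum N B (?P \<phi>) y"
          unfolding tail_dsum_def partials_append[symmetric]
          by (rule member_le_sum) (use ls finite_lists_le in auto)
        then have "c * \<bar>xpow \<eta> y\<bar> * jw y ^ r * norm (partials B (partials ls (?P \<phi>)) y) \<le> e ((c, \<eta>), y) (?P \<phi>)"
          using c jw0[of y] by (simp add: e_def mult_left_mono)
        also have "\<dots> \<le> q (?P \<phi>)" using c\<eta> by (intro ub P\<phi>) auto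
        finally have "c * \<bar>xpow \<eta> y\<bar> * jw y ^ r * norm (partials B (partials ls (?P \<phi>)) y) \<le> q (?P \<phi>)" .
        \<comment> \<open>Commuting \<open>ls\<close> past \<open>P(\<tau>)\<close> shifts its
          argument by \<open>count_list ls\<close>; here the uniformity in the shift is
          used.\<close>
        then show "\<bar>xpow \<eta> y\<bar> * jw y ^ r * norm (partials B (ev (aff 1 (\<lambda>j. 0 - real (count_list ls j))) ?A ?p (partials ls \<phi>)) y) \<le> q (?P \<phi>) / c"
          unfolding partials_ev[OF test_imp_tests[OF \<phi>], of ls "\<lambda>_. 0"] using c by (simp add: field_simps)
      qed
      then show ?thesis using c by (simp add: field_simps)
    qed
    have "c * \<bar>xpow \<eta> x\<bar> * dsum N \<phi> x = (\<Sum>ls | length ls \<le> N. c * \<bar>xpow \<eta> x\<bar> * norm (partials ls \<phi> x))"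
      by (simp add: dsum_def sum_distrib_left)
    also have "\<dots> \<le> (\<Sum>ls | length (ls :: 'n list) \<le> N. C * q (?P \<phi>))"
      by (rule sum_mono) (use one in simp)
    also have "\<dots> = C' * q (?P \<phi>)" by (simp add: C'_def)
    finally show "c * \<bar>xpow \<eta> x\<bar> * dsum N \<phi> x \<le> C' * q (?P \<phi>)" .
  qed
  have "seminorm_on ?X (\<lambda>\<psi>. C' * q \<psi>)"
    using q C' unfolding seminorm_on_def by (auto simp: distrib_left[symmetric] mult_left_mono)
  from surjective_from_estimate[OF T(1) this est]
  obtain S where S: "linear_on_test \<Omega> S" "\<And>\<psi>. \<psi> \<in> ?X \<Longrightarrow> norm (S \<psi>) \<le> C' * q \<psi>"
    "\<And>\<phi>. \<phi> \<in> ?X \<Longrightarrow> euler_op P S \<phi> = T \<phi>" by blast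
  have bw: "bounded_with_order (N + length B) \<Omega> H S" if H: "compact H" "H \<subseteq> \<Omega>" for H
  proof -
    obtain k where k: "H \<subseteq> K k" using exK[OF H] by blast
    obtain D where D: "\<And>\<psi> i. \<psi> \<in> ?X \<Longrightarrow> supp \<psi> \<subseteq> K k \<Longrightarrow> i \<in> W \<times> UNIV \<Longrightarrow> e i \<psi> \<le> D * test_seminorm (N + length B) \<psi>"
      using ebound[of k] by blast
    show ?thesis
      unfolding bounded_with_order_def
    proof (intro exI[of _ "C' * D"] ballI impI)
      fix \<psi> assume \<psi>: "\<psi> \<in> ?X" "supp \<psi> \<subseteq> H"
      have "q \<psi> \<le> D * test_seminorm (N + length B) \<psi>"
        unfolding q_def by (rule cSUP_least[OF ne]) (use D \<psi> k in blast)
      then have "C' * q \<psi> \<le> C' * (D * test_seminorm (N + length B) \<psi>)" by (rule mult_left_mono[OF _ C'])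
      then show "norm (S \<psi>) \<le> C' * D * test_seminorm (N + length B) \<psi>"
        using S(2)[OF \<psi>(1)] by (simp add: mult.assoc)
    qed
  qed
  have "S \<in> finite_order_distributions \<Omega>"
    using S(1) bw unfolding finite_order_distributions_def distributions_def by blast
  then show "\<exists>S\<in>finite_order_distributions \<Omega>. \<forall>\<phi>\<in>?X. euler_op P S \<phi> = T \<phi>" using S(3) by blast
qed

section \<open>Monomially convex exhaustions\<close>

text \<open>Outside a cube some coordinate exceeds the radius, and that coordinate is itself a
  separating monomial.\<close>

lemma cube_exhaustion:
  fixes \<rho> :: "nat \<Rightarrow> real"
  assumes \<rho>: "\<And>n. \<rho> n < \<rho> (Suc n)" and \<Omega>: "\<Omega> = (\<Union>n. {x :: real ^ 'n::finite. \<forall>j. \<bar>x $ j\<bar> \<le> \<rho> n})"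
  shows "monomial_exhaustion \<Omega> (\<lambda>n. {x. \<forall>j. \<bar>x $ j\<bar> \<le> \<rho> n})"
  unfolding monomial_exhaustion_def
proof (intro conjI allI ballI)
  fix n
  have "{x :: real ^ 'n. \<forall>j. \<bar>x $ j\<bar> \<le> \<rho> n} = cbox (\<chi> i. - \<rho> n) (\<chi> i. \<rho> n)"
    by (auto simp: mem_box_cart abs_le_iff minus_le_iff)
  then show "compact {x :: real ^ 'n. \<forall>j. \<bar>x $ j\<bar> \<le> \<rho> n}" by simp
  have "{x :: real ^ 'n. \<forall>j. \<bar>x $ j\<bar> \<le> \<rho> n} \<subseteq> box (\<chi> i. - \<rho> (Suc n)) (\<chi> i. \<rho> (Suc n))"
  proof
    fix x :: "real ^ 'n" assume "x \<in> {x. \<forall>j. \<bar>x $ j\<bar> \<le> \<rho> n}"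
    then have "\<bar>x $ j\<bar> < \<rho> (Suc n)" for j
      using le_less_trans[OF _ \<rho>[of n]] by blast
    then show "x \<in> box (\<chi> i. - \<rho> (Suc n)) (\<chi> i. \<rho> (Suc n))" by (simp add: mem_box_cart abs_less_iff minus_less_iff)
  qed
  also have "\<dots> \<subseteq> interior {x. \<forall>j. \<bar>x $ j\<bar> \<le> \<rho> (Suc n)}"
  proof (rule interior_maximal[OF _ open_box], intro subsetI CollectI allI)
    fix x :: "real ^ 'n" and j assume "x \<in> box (\<chi> i. - \<rho> (Suc n)) (\<chi> i. \<rho> (Suc n))"
    then have "- \<rho> (Suc n) < x $ j" "x $ j < \<rho> (Suc n)" by (simp_all add: mem_box_cart)
    then show "\<bar>x $ j\<bar> \<le> \<rho> (Suc n)" by linarith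
  qed
  finally show "{x :: real ^ 'n. \<forall>j. \<bar>x $ j\<bar> \<le> \<rho> n} \<subseteq> interior {x. \<forall>j. \<bar>x $ j\<bar> \<le> \<rho> (Suc n)}" .
  fix x :: "real ^ 'n" assume "x \<in> \<Omega> - {x. \<forall>j. \<bar>x $ j\<bar> \<le> \<rho> n}"
  then obtain j where "\<rho> n < \<bar>x $ j\<bar>" by (auto simp: not_le)
  then show "\<exists>\<eta>. \<forall>y\<in>{x. \<forall>j. \<bar>x $ j\<bar> \<le> \<rho> n}. \<bar>xpow \<eta> y\<bar> < \<bar>xpow \<eta> x\<bar>"
    by (intro exI[of _ "\<lambda>i. if i = j then 1 else 0"]) (auto simp: xpow_unit intro: le_less_trans)
qed (simp add: \<Omega>)

lemma monomial_exhaustion_UNIV: "\<exists>K. monomial_exhaustion (UNIV :: (real ^ 'n::finite) set) K"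
proof -
  have eq: "(UNIV :: (real ^ 'n) set) = (\<Union>n. {x. \<forall>j. \<bar>x $ j\<bar> \<le> real n})"
  proof -
    have "x \<in> (\<Union>n. {x. \<forall>j. \<bar>x $ j\<bar> \<le> real n})" for x :: "real ^ 'n"
    proof -
      obtain n where "norm x \<le> real n" using real_arch_simple by blast
      then have "\<bar>x $ j\<bar> \<le> real n" for j using component_le_norm_cart[of x j] by linarith
      then show ?thesis by blast
    qed
    then show ?thesis by blast
  qed
  show ?thesis by (rule exI, rule cube_exhaustion[of real, OF _ eq]) simp
qed

lemma exists_radius: "t < 1 \<longleftrightarrow> (\<exists>n. t \<le> 1 - 1 / (real n + 2))"
proof
  assume "t < 1"
  then obtain n where "inverse (real (Suc n)) < 1 - t" using reals_Archimedean[of "1 - t"] by auto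
  moreover have "1 / (real n + 2) \<le> inverse (real (Suc n))" by (simp add: field_simps)
  ultimately show "\<exists>n. t \<le> 1 - 1 / (real n + 2)" by (intro exI[of _ n]) linarith
next
  assume "\<exists>n. t \<le> 1 - 1 / (real n + 2)"
  then obtain n where "t \<le> 1 - 1 / (real n + 2)" by blast
  moreover have "0 < 1 / (real n + 2)" by simp
  ultimately show "t < 1" by linarith
qed

lemma monomial_exhaustion_open_cube: "\<exists>K. monomial_exhaustion {x :: real ^ 'n::finite. \<forall>j. \<bar>x $ j\<bar> < 1} K"
proof -
  have "{x :: real ^ 'n. \<forall>j. \<bar>x $ j\<bar> < 1} = (\<Union>n. {x. \<forall>j. \<bar>x $ j\<bar> \<le> 1 - 1 / (real n + 2)})"
  proof -
    have "(\<forall>j. \<bar>x $ j\<bar> < 1) \<longleftrightarrow> (\<exists>n. \<forall>j. \<bar>x $ j\<bar> \<le> 1 - 1 / (real n + 2))" for x :: "real ^ 'n"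
    proof -
      have "(\<forall>j. \<bar>x $ j\<bar> < 1) \<longleftrightarrow> Max (range (\<lambda>j. \<bar>x $ j\<bar>)) < 1" by (subst Max_less_iff) auto
      also have "\<dots> \<longleftrightarrow> (\<exists>n. Max (range (\<lambda>j. \<bar>x $ j\<bar>)) \<le> 1 - 1 / (real n + 2))" by (rule exists_radius)
      also have "\<dots> \<longleftrightarrow> (\<exists>n. \<forall>j. \<bar>x $ j\<bar> \<le> 1 - 1 / (real n + 2))" by (subst Max_le_iff) auto
      finally show ?thesis .
    qed
    then show ?thesis by auto
  qed
  moreover have "1 - 1 / (real n + 2) < 1 - 1 / (real (Suc n) + 2)" for n by (simp add: field_simps)
  ultimately show ?thesis using cube_exhaustion[of "\<lambda>n. 1 - 1 / (real n + 2)"] by blast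
qed

text \<open>By the weighted arithmetic-geometric mean inequality with weights proportional to
  \<open>\<bar>x\<^sub>j\<bar>\<^sup>p\<close>, the monomial with exponents proportional to these weights separates \<open>x\<close> from every
  smaller \<open>\<ell>\<^sub>p\<close> ball; rounding the exponents up costs only a bounded amount in the logarithm.\<close>

lemma lp_separating_monomial:
  fixes x :: "real ^ 'n::finite"
  assumes p: "p > 0" and \<rho>: "0 \<le> \<rho>" "\<rho> < (\<Sum>j\<in>UNIV. \<bar>x $ j\<bar> powr p)" "\<rho> \<le> 1" and x1: "\<And>j. \<bar>x $ j\<bar> \<le> 1"
  shows "\<exists>\<eta>. \<forall>y. (\<Sum>j\<in>UNIV. \<bar>y $ j\<bar> powr p) \<le> \<rho> \<longrightarrow> \<bar>xpow \<eta> y\<bar> < \<bar>xpow \<eta> x\<bar>"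
proof -
  define R where "R = (\<Sum>j\<in>UNIV. \<bar>x $ j\<bar> powr p)"
  have R: "R > 0" "\<rho> < R" using \<rho> by (auto simp: R_def)
  define J where "J = {j. x $ j \<noteq> 0}"
  define w where "w j = \<bar>x $ j\<bar> powr p / R" for j
  have w0: "w j \<ge> 0" for j using R by (simp add: w_def)
  have "(\<Sum>j\<in>J. \<bar>x $ j\<bar> powr p) = R"
    unfolding R_def by (rule sum.mono_neutral_left) (auto simp: J_def)
  then have wsum: "(\<Sum>j\<in>J. w j) = 1" using R by (simp add: w_def sum_divide_distrib[symmetric])
  define \<delta> where "\<delta> = 1 - \<rho> / R"
  have \<delta>: "\<delta> > 0" using R by (simp add: \<delta>_def)
  define M where "M = (\<Sum>j\<in>J. \<bar>ln \<bar>x $ j\<bar>\<bar>)"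
  \<comment> \<open>\<open>\<delta>\<close> is the gain per unit of scale and \<open>M\<close>
    bounds the total loss from rounding, so \<open>k * \<delta>\<close> must exceed
    \<open>M\<close>.\<close>
  obtain k :: nat where "M / \<delta> < real k" using reals_Archimedean2 by blast
  then have k: "M < real k * \<delta>" using \<delta> by (simp add: field_simps)
  define \<eta> where "\<eta> j = (if j \<in> J then nat \<lceil>real k * (w j * p)\<rceil> else 0)" for j
  have \<eta>: "real k * (w j * p) \<le> real (\<eta> j)" "real (\<eta> j) \<le> real k * (w j * p) + 1" if "j \<in> J" for j
    using that w0[of j] p by (simp_all add: \<eta>_def)
  have xp: "\<bar>xpow \<eta> z\<bar> = exp (\<Sum>j\<in>J. real (\<eta> j) * ln \<bar>z $ j\<bar>)" if z: "\<And>j. j \<in> J \<Longrightarrow> z $ j \<noteq> 0" for z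
  proof -
    have "\<bar>xpow \<eta> z\<bar> = (\<Prod>j\<in>J. \<bar>z $ j\<bar> ^ \<eta> j)"
      unfolding xpow_def abs_prod power_abs by (rule prod.mono_neutral_right) (auto simp: \<eta>_def)
    also have "\<dots> = (\<Prod>j\<in>J. exp (real (\<eta> j) * ln \<bar>z $ j\<bar>))"
      using z by (intro prod.cong) (simp_all add: exp_of_nat_mult)
    finally show ?thesis by (simp add: exp_sum)
  qed
  have xpos: "0 < \<bar>xpow \<eta> x\<bar>" by (subst xp) (auto simp: J_def)
  show ?thesis
  proof (intro exI[of _ \<eta>] allI impI)
    fix y :: "real ^ 'n" assume y: "(\<Sum>j\<in>UNIV. \<bar>y $ j\<bar> powr p) \<le> \<rho>"
    show "\<bar>xpow \<eta> y\<bar> < \<bar>xpow \<eta> x\<bar>"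
    \<comment> \<open>If \<open>y\<close> vanishes in a coordinate where \<open>x\<close> does not,
      the exponent there is positive and the monomial is 0 at \<open>y\<close>. Otherwise logarithms
      are available.\<close>
    proof (cases "\<exists>j\<in>J. y $ j = 0")
      case True
      then obtain j where j: "j \<in> J" "y $ j = 0" by blast
      have "0 < w j" using j R by (simp add: w_def J_def)
      moreover have "k \<noteq> 0"
      proof
        assume "k = 0"
        moreover have "0 \<le> M" unfolding M_def by (intro sum_nonneg) auto
        ultimately show False using k by simp
      qed
      ultimately have "0 < real (\<eta> j)" using \<eta>(1)[OF j(1)] p by (intro less_le_trans[OF _ \<eta>(1)[OF j(1)]]) auto
      then have "xpow \<eta> y = 0" unfolding xpow_def using j by (intro prod_zero) (auto intro!: bexI[of _ j])
      then show ?thesis using xpos by simp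
    next
      case False
      then have ynz: "\<And>j. j \<in> J \<Longrightarrow> y $ j \<noteq> 0" by blast
      have y1: "\<bar>y $ j\<bar> \<le> 1" for j
      proof (rule ccontr)
        assume "\<not> \<bar>y $ j\<bar> \<le> 1"
        then have "1 < \<bar>y $ j\<bar> powr p" using p by (simp add: gr_one_powr)
        also have "\<dots> \<le> (\<Sum>j\<in>UNIV. \<bar>y $ j\<bar> powr p)" by (rule member_le_sum) auto
        finally show False using y \<rho>(3) by simp
      qed
      let ?d = "\<lambda>j. ln \<bar>y $ j\<bar> - ln \<bar>x $ j\<bar>"
      \<comment> \<open>The inequality \<open>ln t \<le> t - 1\<close>, weighted by
        \<open>w\<close>, is the additive form of the mean inequality: the weighted logarithm drops
        by at least \<open>\<delta>\<close>.\<close>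
      have "(\<Sum>j\<in>J. w j * p * ?d j) \<le> (\<Sum>j\<in>J. \<bar>y $ j\<bar> powr p / R - w j)"
      proof (rule sum_mono)
        fix j assume j: "j \<in> J"
        then have pos: "\<bar>x $ j\<bar> > 0" "\<bar>y $ j\<bar> > 0" using ynz by (auto simp: J_def)
        have "p * ?d j = ln (\<bar>y $ j\<bar> powr p / \<bar>x $ j\<bar> powr p)"
          using pos by (simp add: ln_div ln_powr algebra_simps)
        also have "\<dots> \<le> \<bar>y $ j\<bar> powr p / \<bar>x $ j\<bar> powr p - 1"
          using pos by (intro ln_le_minus_one) simp
        finally have "w j * (p * ?d j) \<le> w j * (\<bar>y $ j\<bar> powr p / \<bar>x $ j\<bar> powr p - 1)"
          by (rule mult_left_mono[OF _ w0])
        also have "\<dots> = \<bar>y $ j\<bar> powr p / R - w j"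
          using pos R by (simp add: w_def field_simps)
        finally show "w j * p * ?d j \<le> \<bar>y $ j\<bar> powr p / R - w j" by (simp add: mult.assoc)
      qed
      also have "\<dots> = (\<Sum>j\<in>J. \<bar>y $ j\<bar> powr p) / R - 1" by (simp add: sum_subtractf wsum sum_divide_distrib)
      also have "(\<Sum>j\<in>J. \<bar>y $ j\<bar> powr p) / R \<le> \<rho> / R"
        using R order_trans[OF sum_mono2[of UNIV J "\<lambda>j. \<bar>y $ j\<bar> powr p"] y] by (intro divide_right_mono) auto
      finally have main: "(\<Sum>j\<in>J. w j * p * ?d j) \<le> - \<delta>" by (simp add: \<delta>_def)
      \<comment> \<open>Rounding adds at most 1 to each exponent; as
        \<open>ln \<bar>y $ j\<bar> \<le> 0\<close>, this costs at most
        \<open>\<bar>ln \<bar>x $ j\<bar>\<bar>\<close> per coordinate, whatever \<open>y\<close>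
        is.\<close>
      have "(\<Sum>j\<in>J. real (\<eta> j) * ?d j) \<le> (\<Sum>j\<in>J. real k * (w j * p * ?d j) + \<bar>ln \<bar>x $ j\<bar>\<bar>)"
      proof (rule sum_mono)
        fix j assume j: "j \<in> J"
        then have pos: "\<bar>x $ j\<bar> > 0" "\<bar>y $ j\<bar> > 0" using ynz by (auto simp: J_def)
        have "ln \<bar>y $ j\<bar> \<le> 0" "ln \<bar>x $ j\<bar> \<le> 0" using pos y1[of j] x1[of j] by auto
        then have "(real (\<eta> j) - real k * (w j * p)) * ?d j \<le> (real (\<eta> j) - real k * (w j * p)) * \<bar>ln \<bar>x $ j\<bar>\<bar>"
          using \<eta>(1)[OF j] by (intro mult_left_mono) auto
        also have "\<dots> \<le> 1 * \<bar>ln \<bar>x $ j\<bar>\<bar>" using \<eta>(2)[OF j] by (intro mult_right_mono) auto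
        finally show "real (\<eta> j) * ?d j \<le> real k * (w j * p * ?d j) + \<bar>ln \<bar>x $ j\<bar>\<bar>"
          by (simp add: algebra_simps)
      qed
      also have "\<dots> = real k * (\<Sum>j\<in>J. w j * p * ?d j) + M"
        by (simp add: M_def sum.distrib sum_distrib_left)
      also have "\<dots> \<le> real k * (- \<delta>) + M" by (intro add_right_mono mult_left_mono main) auto
      also have "\<dots> < 0" using k by simp
      finally have "(\<Sum>j\<in>J. real (\<eta> j) * ln \<bar>y $ j\<bar>) < (\<Sum>j\<in>J. real (\<eta> j) * ln \<bar>x $ j\<bar>)"
        by (simp add: right_diff_distrib sum_subtractf)
      then show ?thesis using xp[of y] xp[of x] ynz by (simp add: J_def)
    qed
  qed
qed

text \<open>Taking the power sum instead of its root matches the form of the separation lemma and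
  describes the same unit ball; the sublevel sets at heights \<open>\<rho> n < 1\<close> form the
  exhaustion.\<close>

lemma monomial_exhaustion_lp_ball:
  assumes p: "p > 0"
  shows "\<exists>K. monomial_exhaustion {x :: real ^ 'n::finite. (\<Sum>j\<in>UNIV. \<bar>x $ j\<bar> powr p) < 1} K"
proof -
  define N where "N x = (\<Sum>j\<in>UNIV. \<bar>x $ j\<bar> powr p)" for x :: "real ^ 'n"
  define \<rho> where "\<rho> n = 1 - 1 / (real n + 2)" for n
  have \<rho>: "\<rho> n < \<rho> (Suc n)" "0 \<le> \<rho> n" "\<rho> n \<le> 1" for n by (simp_all add: \<rho>_def field_simps)
  have cN: "continuous_on UNIV N"
    unfolding N_def[abs_def] using p by (intro continuous_intros continuous_on_powr') auto
  have comp: "\<bar>x $ j\<bar> \<le> 1" if "N x \<le> 1" for x j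
  proof (rule ccontr)
    assume "\<not> \<bar>x $ j\<bar> \<le> 1"
    then have "1 < \<bar>x $ j\<bar> powr p" using p by (simp add: gr_one_powr)
    also have "\<dots> \<le> N x" unfolding N_def by (rule member_le_sum) auto
    finally show False using that by simp
  qed
  have "monomial_exhaustion {x. N x < 1} (\<lambda>n. {x. N x \<le> \<rho> n})"
    unfolding monomial_exhaustion_def
  proof (intro conjI allI ballI)
    fix n
    have "closed {x. N x \<le> \<rho> n}" by (intro closed_Collect_le cN continuous_on_const)
    moreover have "{x. N x \<le> \<rho> n} \<subseteq> cbox (\<chi> i. - 1) (\<chi> i. 1)"
    proof
      fix x assume "x \<in> {x. N x \<le> \<rho> n}"
      then have "\<bar>x $ j\<bar> \<le> 1" for j using comp[of x j] \<rho>(3)[of n] by simp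
      then show "x \<in> cbox (\<chi> i. - 1) (\<chi> i. 1)" by (simp add: mem_box_cart abs_le_iff minus_le_iff)
    qed
    ultimately show "compact {x. N x \<le> \<rho> n}"
      using bounded_subset[OF bounded_cbox] compact_eq_bounded_closed by blast
    have "{x. N x \<le> \<rho> n} \<subseteq> {x. N x < \<rho> (Suc n)}" using \<rho>(1)[of n] by auto
    also have "\<dots> \<subseteq> interior {x. N x \<le> \<rho> (Suc n)}"
      by (rule interior_maximal) (auto intro: open_Collect_less cN continuous_on_const)
    finally show "{x. N x \<le> \<rho> n} \<subseteq> interior {x. N x \<le> \<rho> (Suc n)}" .
    fix x assume x: "x \<in> {x. N x < 1} - {x. N x \<le> \<rho> n}"
    have "\<bar>x $ j\<bar> \<le> 1" for j using comp[of x j] x by simp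
    then show "\<exists>\<eta>. \<forall>y\<in>{x. N x \<le> \<rho> n}. \<bar>xpow \<eta> y\<bar> < \<bar>xpow \<eta> x\<bar>"
      using lp_separating_monomial[OF p \<rho>(2)[of n], of x] x \<rho>(3)[of n] by (auto simp: N_def)
  next
    show "(\<Union>n. {x. N x \<le> \<rho> n}) = {x. N x < 1}"
      using exists_radius by (auto simp: \<rho>_def)
  qed
  then show ?thesis by (auto simp: N_def)
qed

lemma monomial_exhaustion_lp_norm_ball:
  assumes p: "1 \<le> p"
  shows "\<exists>K. monomial_exhaustion {x :: real ^ 'n::finite. lp_norm p x < 1} K"
proof (cases "p = \<infinity>")
  case True
  have "{x :: real ^ 'n. lp_norm p x < 1} = {x. \<forall>j. \<bar>x $ j\<bar> < 1}"
    using True by (auto simp: lp_norm_def)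
  then show ?thesis using monomial_exhaustion_open_cube by simp
next
  case False
  then obtain r where r: "p = ereal r" "1 \<le> r" using p by (cases p) (auto simp: one_ereal_def)
  have "lp_norm p x < 1 \<longleftrightarrow> (\<Sum>j\<in>UNIV. \<bar>x $ j\<bar> powr r) < 1" for x :: "real ^ 'n"
  proof -
    have "0 \<le> (\<Sum>j\<in>UNIV. \<bar>x $ j\<bar> powr r)" by (intro sum_nonneg) auto
    then have "((\<Sum>j\<in>UNIV. \<bar>x $ j\<bar> powr r) powr (1 / r) < 1) \<longleftrightarrow> (\<Sum>j\<in>UNIV. \<bar>x $ j\<bar> powr r) < 1"
      using r powr_less_mono2[of "1 / r" "\<Sum>j\<in>UNIV. \<bar>x $ j\<bar> powr r" 1]
        powr_mono2[of "1 / r" 1 "\<Sum>j\<in>UNIV. \<bar>x $ j\<bar> powr r"] by fastforce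
    then show ?thesis using r by (simp add: lp_norm_def)
  qed
  then show ?thesis using monomial_exhaustion_lp_ball[of r] r by simp
qed

lemma ball_eq_lp_norm_ball: "ball 0 1 = {x :: real ^ 'n::finite. lp_norm 2 x < 1}"
proof -
  have "lp_norm 2 x = norm x" for x :: "real ^ 'n"
  proof -
    have "(2 :: ereal) = ereal 2" by simp
    then have 2: "real_of_ereal 2 = 2" "(2 :: ereal) \<noteq> \<infinity>" by (simp_all only: real_of_ereal.simps) auto
    have "\<bar>x $ j\<bar> powr 2 = (x $ j)\<^sup>2" for j by (cases "x $ j = 0") (simp_all add: powr_numeral)
    then show ?thesis
      by (simp add: lp_norm_def 2 norm_vec_def L2_set_def powr_half_sqrt sum_nonneg)
  qed
  then show ?thesis by (auto simp: dist_norm)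
qed

theorem mainTheorem4:
  fixes P :: "'n::{finite,linorder} cpoly"
  assumes "P \<noteq> 0"
  shows "euler_surjective_on P UNIV
    \<and> (\<forall>p::ereal. 1 \<le> p \<longrightarrow> euler_surjective_on P {x. lp_norm p x < 1})
    \<and> euler_surjective_on P (ball 0 1)"
proof -
  have lp: "euler_surjective_on P {x. lp_norm p x < 1}" if "1 \<le> p" for p
    using monomial_exhaustion_lp_norm_ball[OF that] euler_surjective_monomial_exhaustion[OF assms] by blast
  moreover have "euler_surjective_on P UNIV"
    using monomial_exhaustion_UNIV euler_surjective_monomial_exhaustion[OF assms] by blast
  moreover have "euler_surjective_on P (ball 0 1)"
    unfolding ball_eq_lp_norm_ball by (rule lp) simp
  ultimately show ?thesis by blast
qed

end
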